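(* Let $d\ge 3$ and let $(\alpha_1,\ldots,\alpha_{2d})$ be any positive real numbers; write $\alpha_{e_i}=\alpha_i$ for $i=1,\dots,2d$. Set $$\kappa=2\sum_{j=1}^{2d}\alpha_{e_j}-\max_{i=1,\ldots,d}\left(\alpha_{e_i}+\alpha_{-e_i}\right).$$ Then for every real $s>0$, $$\mathbb{E}^{(\alpha)}\left(G(0,0)^s\right)<\infty\quad\text{if and only if}\quad s<\kappa .$$ In particular, for $\mathbb{P}^{(\alpha)}$-almost every environment $p$, the Markov chain with law $P^{(p)}$ on $\mathbb{Z}^d$ is transient.
   Context: Let $(e_1,\ldots,e_d)$ be the canonical basis of $\mathbb{Z}^d$ and set $e_j=-e_{j-d}$ for $j=d+1,\ldots,2d$, so $\{e_1,\dots,e_{2d}\}$ is the set of unit vectors of $\mathbb{Z}^d$; thus $\alpha_{-e_i}=\alpha_{i+d}$ for $i=1,\dots,d$. The Dirichlet law with parameters $(\alpha_1,\ldots,\alpha_{2d})$, $\alpha_i>0$, is the probability law on $\{(x_1,\ldots,x_{2d})\in(0,1]^{2d}:\sum_i x_i=1\}$ with density $\frac{\Gamma(\sum_{i=1}^{2d}\alpha_i)}{\prod_{i=1}^{2d}\Gamma(\alpha_i)}\prod_{i=1}^{2d}x_i^{\alpha_i-1}$ with respect to $dx_1\cdots dx_{2d-1}$ (the image of Lebesgue measure on $\mathbb{R}^{2d-1}$ under $(x_1,\dots,x_{2d-1})\mapsto(x_1,\dots,x_{2d-1},1-\sum_{i<2d}x_i)$). A random environment is $p=(p(x))_{x\in\mathbb{Z}^d}$,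 $p(x)=(p(x,x+e_i))_{i=1,\ldots,2d}$, where the vectors $p(x)$, $x\in\mathbb{Z}^d$, are independent and each has the Dirichlet law with parameters $(\alpha_1,\ldots,\alpha_{2d})$. The law of $p$ is denoted $\mathbb{P}^{(\alpha)}$ and its expectation $\mathbb{E}^{(\alpha)}$. Given $p$, $P^{(p)}_x$ is the law of the nearest-neighbour Markov chain $(X_n)$ on $\mathbb{Z}^d$ started at $x$ with $P^{(p)}_x[X_{n+1}=y+e_i\mid X_n=y]=p(y,y+e_i)$, with expectation $E^{(p)}_x$. The Green function in the environment $p$ is $G(x,y)=E^{(p)}_x\left[\sum_{k=0}^\infty \mathbf{1}_{X_k=y}\right]\in[0,\infty]$. *)

theory Defs
  imports "HOL-Probability.Probability"
begin

text \<open>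
  Sites are functions \<open>nat \<Rightarrow> int\<close>; \<open>\<int>\<^sup>d\<close> is the set of those vanishing outside the
  coordinates \<open>1, \<dots>, d\<close>. Directions are numbered \<open>1, \<dots>, 2 * d\<close>, and direction \<open>j + d\<close> is
  opposite to direction \<open>j\<close> for \<open>j \<le> d\<close>.
\<close>

type_synonym site = "nat \<Rightarrow> int"

definition lattice :: "nat \<Rightarrow> site set" where
  "lattice d = {x. \<forall>i. i \<notin> {1..d} \<longrightarrow> x i = 0}"

definition origin :: site where
  "origin = (\<lambda>_. 0)"

definition unit_vec :: "nat \<Rightarrow> nat \<Rightarrow> site" where
  "unit_vec d j = (\<lambda>i. if j \<le> d then (if i = j then 1 else 0) else (if i = j - d then -1 else 0))"

definition neighbour :: "nat \<Rightarrow> site \<Rightarrow> nat \<Rightarrow> site" where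
  "neighbour d x j = (\<lambda>i. x i + unit_vec d j i)"

text \<open>
  \<open>simplex_measure n\<close> is the image of Lebesgue measure on \<open>\<real>\<^sup>n\<^sup>-\<^sup>1\<close> under the map that appends
  the coordinate \<open>1 - (x\<^sub>1 + \<dots> + x\<^sub>n\<^sub>-\<^sub>1)\<close>.
\<close>

definition simplex_measure :: "nat \<Rightarrow> (nat \<Rightarrow> real) measure" where
  "simplex_measure n =
     distr (PiM {1..<n} (\<lambda>_. lborel)) (PiM {1..n} (\<lambda>_. borel))
       (\<lambda>x. x(n := 1 - (\<Sum>i\<in>{1..<n}. x i)))"

definition dirichlet :: "nat \<Rightarrow> (nat \<Rightarrow> real) \<Rightarrow> (nat \<Rightarrow> real) measure" where
  "dirichlet n \<alpha> =
     density (simplex_measure n)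
       (\<lambda>x. if \<forall>i\<in>{1..n}. 0 < x i \<and> x i \<le> 1
            then ennreal (Gamma (\<Sum>i\<in>{1..n}. \<alpha> i) / (\<Prod>i\<in>{1..n}. Gamma (\<alpha> i)) *
                          (\<Prod>i\<in>{1..n}. x i powr (\<alpha> i - 1)))
            else 0)"

text \<open>
  In an environment \<open>p\<close>, the number \<open>p x j\<close> is the probability of a jump from \<open>x\<close> to
  \<open>neighbour d x j\<close>.
\<close>

type_synonym environment = "site \<Rightarrow> nat \<Rightarrow> real"

definition env_law :: "nat \<Rightarrow> (nat \<Rightarrow> real) \<Rightarrow> environment measure" where
  "env_law d \<alpha> = PiM (lattice d) (\<lambda>_. dirichlet (2 * d) \<alpha>)"

text \<open>
  If \<open>p x\<close> is not a probability vector (a null event under \<open>env_law\<close>), \<open>embed_pmf\<close>, and hence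
  \<open>jump d p x\<close>, is an unspecified probability distribution.
\<close>

definition jump :: "nat \<Rightarrow> environment \<Rightarrow> site \<Rightarrow> site pmf" where
  "jump d p x =
     map_pmf (neighbour d x) (embed_pmf (\<lambda>j. if j \<in> {1..2 * d} then p x j else 0))"

text \<open>
  \<open>walk_kernel d p x n \<omega>\<close> is the conditional law of the position at time \<open>n\<close> given the
  positions \<open>\<omega> 0, \<dots>, \<omega> (n - 1)\<close>; the walk is the measure on trajectories obtained from these
  kernels by the Ionescu-Tulcea theorem.
\<close>

definition walk_kernel :: "nat \<Rightarrow> environment \<Rightarrow> site \<Rightarrow> nat \<Rightarrow> (nat \<Rightarrow> site) \<Rightarrow> site measure" where
  "walk_kernel d p x n \<omega> =
     measure_pmf (case n of 0 \<Rightarrow> return_pmf x | Suc m \<Rightarrow> jump d p (\<omega> m))"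

definition walk :: "nat \<Rightarrow> environment \<Rightarrow> site \<Rightarrow> (nat \<Rightarrow> site) measure" where
  "walk d p x =
     projective_family.lim UNIV
       (Ionescu_Tulcea.CI (walk_kernel d p x) (\<lambda>_. count_space UNIV)) (\<lambda>_. count_space UNIV)"

definition green :: "nat \<Rightarrow> environment \<Rightarrow> site \<Rightarrow> site \<Rightarrow> ennreal" where
  "green d p x y = (\<integral>\<^sup>+\<omega>. (\<Sum>k. indicator {\<omega>. \<omega> k = y} \<omega>) \<partial>walk d p x)"

definition transient :: "nat \<Rightarrow> environment \<Rightarrow> bool" where
  "transient d p \<longleftrightarrow>
     (\<forall>x\<in>lattice d.
        measure (walk d p x) {\<omega> \<in> space (walk d p x). \<exists>n\<ge>1. \<omega> n = x} < 1)"

definition ennpowr :: "ennreal \<Rightarrow> real \<Rightarrow> ennreal" where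
  "ennpowr x s = (if x = \<infinity> then \<infinity> else ennreal (enn2real x powr s))"

definition kappa :: "nat \<Rightarrow> (nat \<Rightarrow> real) \<Rightarrow> real" where
  "kappa d \<alpha> = 2 * (\<Sum>j\<in>{1..2 * d}. \<alpha> j) - (MAX i\<in>{1..d}. \<alpha> i + \<alpha> (i + d))"

text \<open>
  The kernels satisfy the hypotheses of the Ionescu-Tulcea theorem for every \<open>p\<close>, and \<open>walk\<close>
  has the expected finite-dimensional distributions.
\<close>

lemma Ionescu_Tulcea_walk_kernel:
  "Ionescu_Tulcea (walk_kernel d p x) (\<lambda>_. count_space UNIV)"
proof (rule Ionescu_Tulcea.intro)
  fix i
  show "walk_kernel d p x i
          \<in> measurable (PiM {0..<i} (\<lambda>_. count_space UNIV)) (subprob_algebra (count_space UNIV))"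
  proof (cases i)
    case 0
    have "walk_kernel d p x 0 = (\<lambda>_. measure_pmf (return_pmf x))"
      by (rule ext) (simp add: walk_kernel_def)
    then show ?thesis
      unfolding 0 by (simp only:) (intro measurable_const,
          simp add: space_subprob_algebra measure_pmf.subprob_space_axioms)
  next
    case (Suc m)
    have m: "(\<lambda>\<omega>. \<omega> m) \<in> measurable (PiM {0..<i} (\<lambda>_. count_space (UNIV :: site set))) (count_space UNIV)"
      using Suc by (intro measurable_component_singleton) auto
    have "(\<lambda>y. measure_pmf (jump d p y))
            \<in> measurable (count_space UNIV) (subprob_algebra (count_space UNIV))"
      by (auto simp: space_subprob_algebra intro!: measure_pmf.subprob_space_axioms)
    from measurable_compose[OF m this] show ?thesis
      unfolding Suc by (simp add: walk_kernel_def[abs_def])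
  qed
qed (simp add: walk_kernel_def measure_pmf.prob_space_axioms)

lemma pmf_jump:
  assumes "\<And>j. j \<in> {1..2 * d} \<Longrightarrow> 0 \<le> p x j" "(\<Sum>j\<in>{1..2 * d}. p x j) = 1" "i \<in> {1..2 * d}"
  shows "pmf (jump d p x) (neighbour d x i) = p x i"
proof -
  let ?f = "\<lambda>j. if j \<in> {1..2 * d} then p x j else 0"
  have nn: "0 \<le> ?f j" for j using assms(1) by auto
  have "(\<integral>\<^sup>+j. ennreal (?f j) \<partial>count_space UNIV) = (\<integral>\<^sup>+j. ennreal (p x j) \<partial>count_space {1..2 * d})"
    by (subst nn_integral_count_space_indicator)
       (auto intro!: nn_integral_cong split: split_indicator)
  also have "\<dots> = (\<Sum>j\<in>{1..2 * d}. ennreal (p x j))"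
    by (rule nn_integral_count_space_finite) simp
  also have "\<dots> = 1"
    using assms(1,2) by (subst sum_ennreal) auto
  finally have one: "(\<integral>\<^sup>+j. ennreal (?f j) \<partial>count_space UNIV) = 1" .
  have pmf: "pmf (embed_pmf ?f) j = ?f j" for j
    using pmf_embed_pmf[OF nn one] .
  have supp: "set_pmf (embed_pmf ?f) \<subseteq> {1..2 * d}"
    using pmf by (auto simp: set_pmf_iff split: if_splits)
  have "j = i" if "j \<in> {1..2 * d}" "neighbour d x j = neighbour d x i" for j
  proof -
    have "unit_vec d j k = unit_vec d i k" for k
      using fun_cong[OF that(2), of k] by (simp add: neighbour_def)
    from this[of i] this[of "i - d"] this[of j] this[of "j - d"] show ?thesis
      using that(1) assms(3) by (auto simp: unit_vec_def split: if_splits)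
  qed
  note inj = this
  have "pmf (jump d p x) (neighbour d x i) =
          measure (embed_pmf ?f) (neighbour d x -` {neighbour d x i})"
    by (simp add: jump_def pmf_map)
  also have "\<dots> = measure (embed_pmf ?f) {i}"
    using supp inj
    by (intro measure_pmf.finite_measure_eq_AE) (auto simp: AE_measure_pmf_iff)
  also have "\<dots> = p x i"
    using pmf[of i] assms(3) by (simp add: measure_pmf_single)
  finally show ?thesis .
qed

lemma emeasure_walk_cylinder:
  "emeasure (walk d p x) {\<omega>. \<forall>k\<le>n. \<omega> k = y k} =
     (if y 0 = x then \<Prod>k<n. ennreal (pmf (jump d p (y k)) (y (Suc k))) else 0)"
proof -
  interpret IT: Ionescu_Tulcea "walk_kernel d p x" "\<lambda>_. count_space UNIV"
    by (rule Ionescu_Tulcea_walk_kernel)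
  let ?M = "\<lambda>_. count_space UNIV :: site measure"
  let ?u = "\<lambda>x::nat. undefined :: site"
  define Y where "Y m = PiE {0..<m} (\<lambda>k. {y k})" for m
  have Y: "Y m = {restrict y {0..<m}}" for m
    by (auto simp: Y_def PiE_def Pi_def extensional_def restrict_def)
  have Ysets: "Y m \<in> sets (PiM {0..<m} ?M)" for m
    unfolding Y_def by (rule sets_PiM_I_finite) auto
  have und: "?u \<in> space (PiM {0..<0} ?M)"
    by (simp add: space_PiM)
  have C: "IT.C 0 (Suc m) ?u (Y (Suc m)) =
        (if y 0 = x then \<Prod>k<m. ennreal (pmf (jump d p (y k)) (y (Suc k))) else 0)" for m
  proof (induction m)
    have step: "IT.C 0 (Suc m) ?u (Y (Suc m)) =
        emeasure (walk_kernel d p x m (restrict y {0..<m})) {y m} * IT.C 0 m ?u (Y m)" for m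
    proof -
      have sC: "sets (IT.C 0 m ?u) = sets (PiM {0..<m} ?M)"
        using IT.sets_C[OF und, of m] by simp
      have spC: "space (IT.C 0 m ?u) = space (PiM {0..<m} ?M)"
        using sets_eq_imp_space_eq[OF sC] .
      have "IT.C 0 (Suc m) ?u (Y (Suc m)) = (\<integral>\<^sup>+\<omega>. IT.eP m \<omega> (Y (Suc m)) \<partial>IT.C 0 m ?u)"
        using IT.measurable_eP[of m] Ysets[of "Suc m"]
        by (simp, subst emeasure_bind[where N = "PiM {0..<Suc m} ?M"])
           (auto simp: spC space_PiM measurable_cong_sets[OF sC refl])
      also have "\<dots> = (\<integral>\<^sup>+\<omega>. emeasure (walk_kernel d p x m (restrict y {0..<m})) {y m} *
                          indicator (Y m) \<omega> \<partial>IT.C 0 m ?u)"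
      proof (rule nn_integral_cong)
        fix \<omega> assume "\<omega> \<in> space (IT.C 0 m ?u)"
        then have w: "\<omega> \<in> space (PiM {0..<m} ?M)" by (simp add: spC)
        have "fun_upd \<omega> m -` Y (Suc m) \<inter> UNIV = (if \<omega> \<in> Y m then {y m} else {})"
          using w unfolding Y
          by (auto simp: fun_eq_iff space_PiM PiE_def extensional_def less_Suc_eq split: if_splits)
             (metis less_irrefl)+
        then show "IT.eP m \<omega> (Y (Suc m)) =
            emeasure (walk_kernel d p x m (restrict y {0..<m})) {y m} * indicator (Y m) \<omega>"
          by (subst IT.emeasure_eP[OF w Ysets]) (auto simp: Y)
      qed
      also have "\<dots> = emeasure (walk_kernel d p x m (restrict y {0..<m})) {y m} * IT.C 0 m ?u (Y m)"
        using Ysets[of m] sC by (intro nn_integral_cmult_indicator) simp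
      finally show ?thesis .
    qed
    {
      case 0
      have "IT.C 0 0 ?u (Y 0) = 1"
        using Ysets[of 0] by (simp add: Y restrict_def)
      then show ?case
        by (subst step) (auto simp: walk_kernel_def indicator_def)
    next
      case (Suc m)
      then show ?case
        by (simp only: step[of "Suc m"])
           (simp add: walk_kernel_def[of d p x "Suc m"] emeasure_pmf_single mult.commute
             del: IT.C.simps)
    }
  qed
  have "{\<omega>. \<forall>k\<le>n. \<omega> k = y k} = IT.PF.emb UNIV {0..<Suc n} (Y (Suc n))"
  proof -
    have "restrict \<omega> {0..<Suc n} = restrict y {0..<Suc n} \<longleftrightarrow> (\<forall>k\<le>n. \<omega> k = y k)" for \<omega>
    proof
      assume "restrict \<omega> {0..<Suc n} = restrict y {0..<Suc n}"
      then have "restrict \<omega> {0..<Suc n} k = restrict y {0..<Suc n} k" for k by simp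
      then show "\<forall>k\<le>n. \<omega> k = y k"
        by (metis atLeastLessThan_iff less_Suc_eq_le restrict_apply' zero_le)
    qed (auto simp: restrict_def)
    then show ?thesis
      by (auto simp: Y prod_emb_def space_PiM simp del: restrict_apply)
  qed
  then have "emeasure (walk d p x) {\<omega>. \<forall>k\<le>n. \<omega> k = y k} = IT.CI {0..<Suc n} (Y (Suc n))"
    unfolding walk_def using IT.lim[OF _ Ysets] by simp
  also have "\<dots> = IT.C 0 (Suc n) ?u (IT.PF.emb {0..<Suc n} {0..<Suc n} (Y (Suc n)))"
    by (rule IT.emeasure_CI) (auto intro: Ysets)
  also have "IT.PF.emb {0..<Suc n} {0..<Suc n} (Y (Suc n)) = Y (Suc n)"
    by (rule prod_emb_id) (auto simp: Y_def PiE_def)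
  finally show ?thesis
    by (simp only: C)
qed

end

theory Submission
  imports Defs
begin

text \<open>
  The Green function at \<open>z\<close> of the walk killed when leaving a finite set \<open>V\<close> is \<open>1 / (1 - f)\<close>, where
  \<open>f\<close> is the sum of the weights of the first return loops, and its power \<open>s\<close> is a power series
  in \<open>f\<close> with nonnegative coefficients. The expectation of a product of loop weights is a quotient of
  products of Pochhammer symbols. If the parameters are such that at each site the sum over the
  outgoing edges is the sum over the incoming edges, up to an excess \<open>\<gamma>\<close> at \<open>z\<close>, then this expectation
  is unchanged when all loops are reversed and the parameters are transported to the reversed edges,
  with an additional edge of parameter \<open>\<gamma>\<close> from \<open>z\<close> to a cemetery. In the reversed environment,
  \<open>1 - f\<close> is at least the probability of that edge, so that the moment of order \<open>s\<close> is finite,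
  uniformly in \<open>V\<close>, for \<open>s < \<gamma>\<close>.

  Constant parameters \<open>\<alpha>\<close> are turned into parameters of this kind by adding a multiple of a
  flow from \<open>z\<close> to infinity. The first order terms in the flow cancel in the density estimate, so
  that the cost is bounded by the energy of the flow, which is finite for suitable flows since
  \<open>d \<ge> 3\<close>. The flow must be smaller than \<open>\<alpha>\<close>, except on one edge leaving \<open>z\<close> whose transition
  probability is at least \<open>1 / (2 * d)\<close>; some edge has this property. Its two endpoints
  together can emit any flow of strength less than \<open>2 * (\<Sum>j. \<alpha> j) - \<alpha> i - \<alpha> (i + d)\<close>, whose minimum over
  \<open>i\<close> is \<open>\<kappa>\<close>. Conversely, the walk killed when leaving these two sites already has an infinite moment
  of order \<open>\<kappa>\<close> for the minimizing \<open>i\<close>.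
\<close>

text \<open>In the given environment \<open>1 - f\<close> depends on the transition probabilities at
  all sites. Reversal replaces it by one coordinate of one Dirichlet vector, whose negative moments
  are explicit. Only expectations of monomials are compared, so no environment is reversed pathwise,
  and the nonnegative coefficients carry the identity over to every power \<open>s\<close>. In the
  change of measure, tilt and exponents are matched. With parameters \<open>a + (b - 1) * t\<close>
  and the dual exponent \<open>b / (b - 1)\<close>, the power of the density integrates to a
  Dirichlet constant with parameters \<open>a - t\<close>. Hence \<open>t\<close> has to stay below
  \<open>a\<close>, with a margin, and the first order cancels since the displacements
  \<open>(b - 1) * t\<close> and \<open>- t\<close> come with the weights \<open>1 / (b - 1)\<close>
  and 1. The totals at the sites cost nothing, by log-convexity of Gamma. The tilt has excess
  \<open>(b - 1) * g\<close> while the order of the moment rises to \<open>s * b\<close>, so that a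
  large \<open>b\<close> reaches every \<open>s < g\<close>. The flow has no sink, so that no site
  but \<open>z\<close> has an excess, and the bounds are uniform in \<open>V\<close>.\<close>

declare One_nat_def [simp del]

subsection \<open>Dirichlet laws\<close>

text \<open>Divided by \<open>Gamma a\<close>, these kernels form a convolution semigroup. The value
  0 off the positive reals encodes the constraints of the simplex, so that all integrals run over
  the whole space.\<close>

definition pow_kernel :: "real \<Rightarrow> real \<Rightarrow> ennreal" where
  "pow_kernel a u = (if 0 < u then ennreal (u powr (a - 1)) else 0)"

lemma measurable_pow_kernel [measurable]: "pow_kernel a \<in> borel_measurable borel"
  unfolding pow_kernel_def by measurable

lemma pow_kernel_mult_powr:
  "pow_kernel a u * ennreal (u powr b) = pow_kernel (a + b) u"
  by (auto simp: pow_kernel_def ennreal_mult'[symmetric] powr_add[symmetric] algebra_simps)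

lemma pow_kernel_Beta:
  assumes "0 < a" "0 < b"
  shows "(\<integral>\<^sup>+x. pow_kernel a x * pow_kernel b (u - x) \<partial>lborel) = ennreal (Beta a b) * pow_kernel (a + b) u"
proof (cases "0 < u")
  case False
  have "pow_kernel a x * pow_kernel b (u - x) = 0" for x
    using False by (auto simp: pow_kernel_def)
  then have "(\<integral>\<^sup>+x. pow_kernel a x * pow_kernel b (u - x) \<partial>lborel) = (\<integral>\<^sup>+x. 0 \<partial>(lborel :: real measure))"
    by (intro nn_integral_cong) simp
  with False show ?thesis by (simp add: pow_kernel_def)
next
  case True
  let ?f = "\<lambda>x. pow_kernel a x * pow_kernel b (u - x)"
  have "(\<integral>\<^sup>+x. ?f x \<partial>lborel) = ennreal u * (\<integral>\<^sup>+x. ?f (u * x) \<partial>lborel)"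
    using True by (subst nn_integral_real_affine[of ?f u 0]) auto
  also have "(\<integral>\<^sup>+x. ?f (u * x) \<partial>lborel) =
      (\<integral>\<^sup>+x. ennreal (u powr (a + b - 2)) *
        (ennreal (x powr (a - 1) * (1 - x) powr (b - 1)) * indicator {0..1} x) \<partial>lborel)"
  proof (rule nn_integral_cong_AE, rule AE_mp[OF AE_lborel_singleton[of 0]],
         rule AE_mp[OF AE_lborel_singleton[of 1]], intro AE_I2 impI)
    fix x :: real assume x: "x \<noteq> 1" "x \<noteq> 0"
    have *: "u - u * x = u * (1 - x)" by (simp add: algebra_simps)
    have "(u * x) powr (a - 1) * (u * (1 - x)) powr (b - 1) =
        u powr (a + b - 2) * (x powr (a - 1) * (1 - x) powr (b - 1))" if "0 < x" "x < 1"
    proof -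
      have "u powr (a + b - 2) = u powr (a - 1) * u powr (b - 1)"
        by (simp add: powr_add[symmetric] algebra_simps)
      then show ?thesis using that True by (simp add: powr_mult)
    qed
    then show "?f (u * x) = ennreal (u powr (a + b - 2)) *
        (ennreal (x powr (a - 1) * (1 - x) powr (b - 1)) * indicator {0..1} x)"
      using x True unfolding *
      by (auto simp: pow_kernel_def indicator_def ennreal_mult'[symmetric] zero_less_mult_iff)
  qed
  also have "\<dots> = ennreal (u powr (a + b - 2)) * ennreal (Beta a b)"
    using nn_integral_has_integral_lebesgue[OF _ has_integral_Beta_real[OF assms]]
    by (subst nn_integral_cmult) (auto simp: ennreal_mult' ennreal_indicator mult_ac)
  also have "ennreal u * (ennreal (u powr (a + b - 2)) * ennreal (Beta a b)) =
      ennreal (Beta a b) * ennreal (u * u powr (a + b - 2))"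
    using True by (simp add: ennreal_mult' mult_ac)
  also have "u * u powr (a + b - 2) = u powr (a + b - 1)"
    using True by (subst powr_mult_base) (auto simp: algebra_simps)
  finally show ?thesis using True by (simp add: pow_kernel_def)
qed

lemma Beta_pos: "0 < a \<Longrightarrow> 0 < b \<Longrightarrow> 0 < Beta a (b::real)"
  by (simp add: Beta_def Gamma_real_pos)

text \<open>Integrating out the coordinate \<open>k\<close> is a Beta convolution, which merges
  \<open>a k\<close> into the exponent of the last kernel; this is why \<open>b\<close> varies in
  the induction.\<close>

lemma Dirichlet_integral:
  assumes "finite I" "\<And>i. i \<in> I \<Longrightarrow> 0 < a i" "0 < b"
  shows "(\<integral>\<^sup>+x. (\<Prod>i\<in>I. pow_kernel (a i) (x i)) * pow_kernel b (t - (\<Sum>i\<in>I. x i)) \<partial>PiM I (\<lambda>_. lborel)) =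
    ennreal ((\<Prod>i\<in>I. Gamma (a i)) * Gamma b / Gamma ((\<Sum>i\<in>I. a i) + b)) * pow_kernel ((\<Sum>i\<in>I. a i) + b) t"
  using assms
proof (induction I arbitrary: b rule: finite_induct)
  case empty
  then have "Gamma b > 0" by (simp add: Gamma_real_pos)
  then show ?case by (simp add: PiM_empty nn_integral_count_space_finite)
next
  case (insert k I)
  interpret product_sigma_finite "\<lambda>_. lborel :: real measure"
    by standard
  have ak: "0 < a k" and aI: "\<And>i. i \<in> I \<Longrightarrow> 0 < a i" using insert.prems by auto
  let ?P = "\<lambda>x. \<Prod>i\<in>I. pow_kernel (a i) (x i)"
  have "(\<integral>\<^sup>+x. (\<Prod>i\<in>insert k I. pow_kernel (a i) (x i)) * pow_kernel b (t - (\<Sum>i\<in>insert k I. x i)) \<partial>PiM (insert k I) (\<lambda>_. lborel))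
    = (\<integral>\<^sup>+x. \<integral>\<^sup>+y. ?P x * (pow_kernel (a k) y * pow_kernel b ((t - (\<Sum>i\<in>I. x i)) - y)) \<partial>lborel \<partial>PiM I (\<lambda>_. lborel))"
  proof (subst product_nn_integral_insert[OF insert.hyps], measurable, intro nn_integral_cong)
    fix x y
    have "(\<Prod>i\<in>I. pow_kernel (a i) ((x(k := y)) i)) = ?P x" "(\<Sum>i\<in>I. (x(k := y)) i) = (\<Sum>i\<in>I. x i)"
      using insert.hyps by (auto intro!: prod.cong sum.cong)
    then show "(\<Prod>i\<in>insert k I. pow_kernel (a i) ((x(k := y)) i)) * pow_kernel b (t - (\<Sum>i\<in>insert k I. (x(k := y)) i))
      = ?P x * (pow_kernel (a k) y * pow_kernel b ((t - (\<Sum>i\<in>I. x i)) - y))"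
      using insert.hyps by (simp add: algebra_simps)
  qed
  also have "\<dots> = (\<integral>\<^sup>+x. ennreal (Beta (a k) b) * (?P x * pow_kernel (a k + b) (t - (\<Sum>i\<in>I. x i))) \<partial>PiM I (\<lambda>_. lborel))"
    by (subst nn_integral_cmult, measurable, subst pow_kernel_Beta[OF ak insert.prems(2)]) (simp add: mult_ac)
  also have "\<dots> = ennreal (Beta (a k) b) * (ennreal ((\<Prod>i\<in>I. Gamma (a i)) * Gamma (a k + b) / Gamma ((\<Sum>i\<in>I. a i) + (a k + b)))
     * pow_kernel ((\<Sum>i\<in>I. a i) + (a k + b)) t)"
    using ak insert.prems(2) by (subst nn_integral_cmult, measurable, subst insert.IH[OF aI]) auto
  also have "\<dots> = ennreal (Beta (a k) b * ((\<Prod>i\<in>I. Gamma (a i)) * Gamma (a k + b) / Gamma ((\<Sum>i\<in>I. a i) + (a k + b))))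
     * pow_kernel ((\<Sum>i\<in>I. a i) + (a k + b)) t"
    using Beta_pos[OF ak insert.prems(2)] by (subst ennreal_mult') (simp_all add: mult.assoc)
  also have "Beta (a k) b * ((\<Prod>i\<in>I. Gamma (a i)) * Gamma (a k + b) / Gamma ((\<Sum>i\<in>I. a i) + (a k + b)))
    = (\<Prod>i\<in>insert k I. Gamma (a i)) * Gamma b / Gamma ((\<Sum>i\<in>insert k I. a i) + b)"
    using insert.hyps Gamma_real_pos[OF add_pos_pos[OF ak insert.prems(2)]] by (simp add: Beta_def add_ac)
  finally show ?case using insert.hyps by (simp add: add_ac)
qed

text \<open>The multivariate Beta function.\<close>

definition dirichlet_const :: "nat \<Rightarrow> (nat \<Rightarrow> real) \<Rightarrow> real" where
  "dirichlet_const n a = (\<Prod>i=1..n. Gamma (a i)) / Gamma (\<Sum>i=1..n. a i)"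

lemma dirichlet_const_pos:
  assumes "1 \<le> n" "\<forall>i\<in>{1..n}. 0 < a i"
  shows "0 < dirichlet_const n a"
  unfolding dirichlet_const_def using assms
  by (intro divide_pos_pos prod_pos Gamma_real_pos sum_pos) auto

lemma nn_integral_simplex_measure:
  assumes "1 \<le> n" "\<forall>i\<in>{1..n}. 0 < a i"
  shows "(\<integral>\<^sup>+x. (\<Prod>i=1..n. pow_kernel (a i) (x i)) \<partial>simplex_measure n) =
    ennreal (dirichlet_const n a)"
proof -
  have n: "{1..n} = insert n {1..<n}" using assms(1) by auto
  have m: "(\<lambda>x. x(n := 1 - (\<Sum>i\<in>{1..<n}. x i))) \<in> PiM {1..<n} (\<lambda>_. lborel) \<rightarrow>\<^sub>M PiM {1..n} (\<lambda>_. borel :: real measure)"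
    unfolding n by (rule measurable_fun_upd[where J="{1..<n}"]) auto
  have "(\<integral>\<^sup>+x. (\<Prod>i=1..n. pow_kernel (a i) (x i)) \<partial>simplex_measure n) =
    (\<integral>\<^sup>+x. (\<Prod>i\<in>{1..<n}. pow_kernel (a i) (x i)) * pow_kernel (a n) (1 - (\<Sum>i\<in>{1..<n}. x i)) \<partial>PiM {1..<n} (\<lambda>_. lborel))"
    unfolding simplex_measure_def
    by (subst nn_integral_distr[OF m], measurable)
       (auto simp: n mult.commute intro!: nn_integral_cong prod.cong arg_cong[where f="\<lambda>z. _ * z"])
  also have "\<dots> = ennreal (dirichlet_const n a)"
    using assms(2) by (subst Dirichlet_integral) (auto simp: n dirichlet_const_def pow_kernel_def mult_ac add_ac)
  finally show ?thesis .
qed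

lemma AE_simplex_measure_sum:
  assumes "1 \<le> n" shows "AE x in simplex_measure n. (\<Sum>i=1..n. x i) = 1"
proof -
  have n: "{1..n} = insert n {1..<n}" using assms(1) by auto
  have m: "(\<lambda>x. x(n := 1 - (\<Sum>i\<in>{1..<n}. x i))) \<in> PiM {1..<n} (\<lambda>_. lborel) \<rightarrow>\<^sub>M PiM {1..n} (\<lambda>_. borel :: real measure)"
    unfolding n by (rule measurable_fun_upd[where J="{1..<n}"]) auto
  show ?thesis unfolding simplex_measure_def
    by (subst AE_distr_iff[OF m]) (auto simp: n)
qed

lemma sets_simplex_measure [measurable_cong]: "sets (simplex_measure n) = sets (PiM {1..n} (\<lambda>_. borel))"
  by (simp add: simplex_measure_def)

lemma sets_dirichlet [measurable_cong]: "sets (dirichlet n a) = sets (PiM {1..n} (\<lambda>_. borel))"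
  by (simp add: dirichlet_def sets_simplex_measure)

lemma dirichlet_eq_density:
  assumes n: "1 \<le> n" and a: "\<forall>i\<in>{1..n}. 0 < a i"
  shows "dirichlet n a = density (simplex_measure n)
    (\<lambda>x. ennreal (1 / dirichlet_const n a) * (\<Prod>i=1..n. pow_kernel (a i) (x i)))"
  unfolding dirichlet_def
proof (rule density_cong)
  show "AE x in simplex_measure n. (if \<forall>i\<in>{1..n}. 0 < x i \<and> x i \<le> 1
            then ennreal (Gamma (\<Sum>i=1..n. a i) / (\<Prod>i=1..n. Gamma (a i)) *
                          (\<Prod>i=1..n. x i powr (a i - 1)))
            else 0) = ennreal (1 / dirichlet_const n a) * (\<Prod>i=1..n. pow_kernel (a i) (x i))"
    using AE_simplex_measure_sum[OF n]
  proof eventually_elim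
    case (elim x)
    show ?case
    proof (cases "\<forall>i\<in>{1..n}. 0 < x i")
      case True
      have "x i \<le> 1" if "i \<in> {1..n}" for i
        unfolding elim[symmetric] using True that by (intro member_le_sum) (auto intro: less_imp_le)
      with True have "\<forall>i\<in>{1..n}. 0 < x i \<and> x i \<le> 1" by auto
      moreover have "(\<Prod>i=1..n. pow_kernel (a i) (x i)) = ennreal (\<Prod>i=1..n. x i powr (a i - 1))"
        using True by (simp add: pow_kernel_def prod_ennreal)
      ultimately show ?thesis
        using dirichlet_const_pos[OF n a]
        by (simp add: ennreal_mult'[symmetric] del: times_divide_eq_left) (simp add: dirichlet_const_def)
    next
      case False
      then obtain i where "i \<in> {1..n}" "pow_kernel (a i) (x i) = 0" by (auto simp: pow_kernel_def)
      then have "(\<Prod>i=1..n. pow_kernel (a i) (x i)) = 0" by (intro prod_zero) auto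
      with False show ?thesis by auto
    qed
  qed
qed (measurable)

lemma nn_integral_dirichlet:
  assumes "1 \<le> n" "\<forall>i\<in>{1..n}. 0 < a i" "f \<in> borel_measurable (dirichlet n a)"
  shows "(\<integral>\<^sup>+x. f x \<partial>dirichlet n a) =
    ennreal (1 / dirichlet_const n a) * (\<integral>\<^sup>+x. (\<Prod>i=1..n. pow_kernel (a i) (x i)) * f x \<partial>simplex_measure n)"
proof -
  have f[measurable]: "f \<in> borel_measurable (simplex_measure n)"
    using assms(3) by (simp add: dirichlet_def)
  show ?thesis
    unfolding dirichlet_eq_density[OF assms(1,2)]
    by (subst nn_integral_density) (auto simp: mult.assoc nn_integral_cmult)
qed

text \<open>Multiplication by powers only shifts the parameters. Negative exponents are included,
  which serves both for the escape probability and for the powers of densities.\<close>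

lemma dirichlet_moment:
  assumes "1 \<le> n" "\<forall>i\<in>{1..n}. 0 < a i" "\<forall>i\<in>{1..n}. 0 < a i + b i"
  shows "(\<integral>\<^sup>+x. (\<Prod>i=1..n. ennreal (x i powr b i)) \<partial>dirichlet n a) =
    ennreal (dirichlet_const n (\<lambda>i. a i + b i) / dirichlet_const n a)"
  using assms dirichlet_const_pos[OF assms(1,2)]
  by (subst nn_integral_dirichlet, simp, simp, measurable)
     (simp add: prod.distrib[symmetric] pow_kernel_mult_powr nn_integral_simplex_measure
       ennreal_mult'[symmetric])

lemma prob_space_dirichlet:
  assumes "1 \<le> n" "\<forall>i\<in>{1..n}. 0 < a i"
  shows "prob_space (dirichlet n a)"
proof
  have "emeasure (dirichlet n a) (space (dirichlet n a)) = (\<integral>\<^sup>+x. 1 \<partial>dirichlet n a)" by simp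
  also have "\<dots> = 1"
    using assms dirichlet_const_pos[OF assms]
    by (subst nn_integral_dirichlet)
       (auto simp: nn_integral_simplex_measure ennreal_mult'[symmetric])
  finally show "emeasure (dirichlet n a) (space (dirichlet n a)) = 1" .
qed

lemma AE_dirichlet:
  assumes "1 \<le> n" "\<forall>i\<in>{1..n}. 0 < a i"
  shows "AE x in dirichlet n a. (\<forall>i\<in>{1..n}. 0 < x i) \<and> (\<Sum>i=1..n. x i) = 1"
  unfolding dirichlet_eq_density[OF assms]
proof (subst AE_density, measurable)
  show "AE x in simplex_measure n.
      0 < ennreal (1 / dirichlet_const n a) * (\<Prod>i=1..n. pow_kernel (a i) (x i)) \<longrightarrow>
      (\<forall>i\<in>{1..n}. 0 < x i) \<and> (\<Sum>i=1..n. x i) = 1"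
    using AE_simplex_measure_sum[OF assms(1)]
  proof eventually_elim
    case (elim x)
    have "0 < x i" if "(\<Prod>i=1..n. pow_kernel (a i) (x i)) \<noteq> 0" "i \<in> {1..n}" for i
    proof (rule ccontr)
      assume "\<not> 0 < x i"
      then have "pow_kernel (a i) (x i) = 0" by (simp add: pow_kernel_def)
      with that show False by (auto simp: prod_zero_iff)
    qed
    with elim show ?case by (auto simp: zero_less_iff_neq_zero)
  qed
qed

lemma dirichlet_change:
  assumes n: "1 \<le> n" and a: "\<forall>i\<in>{1..n}. 0 < a i" and b: "\<forall>i\<in>{1..n}. 0 < b i"
  shows "dirichlet n a = density (dirichlet n b)
    (\<lambda>x. ennreal (dirichlet_const n b / dirichlet_const n a) * (\<Prod>i=1..n. ennreal (x i powr (a i - b i))))"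
  using dirichlet_const_pos[OF n a] dirichlet_const_pos[OF n b]
  unfolding dirichlet_eq_density[OF n a] dirichlet_eq_density[OF n b]
  by (subst density_density_eq, measurable)
     (auto intro!: density_cong simp: pow_kernel_mult_powr prod.distrib[symmetric] mult_ac
      ennreal_mult'[symmetric] mult.assoc[symmetric]
      simp flip: mult.assoc)

subsection \<open>Words and loops\<close>

text \<open>A finite path is coded by its starting point and its list of directions.\<close>

fun weight :: "nat \<Rightarrow> environment \<Rightarrow> site \<Rightarrow> nat list \<Rightarrow> ennreal" where
  "weight d p x [] = 1"
| "weight d p x (j # w) = ennreal (p x j) * weight d p (neighbour d x j) w"

fun endpoint :: "nat \<Rightarrow> site \<Rightarrow> nat list \<Rightarrow> site" where
  "endpoint d x [] = x"
| "endpoint d x (j # w) = endpoint d (neighbour d x j) w"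

fun steps :: "nat \<Rightarrow> site \<Rightarrow> nat list \<Rightarrow> (site \<times> nat) list" where
  "steps d x [] = []"
| "steps d x (j # w) = (x, j) # steps d (neighbour d x j) w"

lemma weight_append: "weight d p x (u @ v) = weight d p x u * weight d p (endpoint d x u) v"
  by (induction u arbitrary: x) (auto simp: mult_ac)

lemma endpoint_append [simp]: "endpoint d x (u @ v) = endpoint d (endpoint d x u) v"
  by (induction u arbitrary: x) auto

lemma steps_append: "steps d x (u @ v) = steps d x u @ steps d (endpoint d x u) v"
  by (induction u arbitrary: x) auto

lemma length_steps [simp]: "length (steps d x w) = length w"
  by (induction w arbitrary: x) auto

lemma weight_steps: "weight d p x w = (\<Prod>(y, j)\<leftarrow>steps d x w. ennreal (p y j))"
  by (induction w arbitrary: x) auto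

definition opposite :: "nat \<Rightarrow> nat \<Rightarrow> nat" where
  "opposite d j = (if j \<le> d then j + d else j - d)"

lemma opposite_in: "j \<in> {1..2*d} \<Longrightarrow> opposite d j \<in> {1..2*d}"
  by (auto simp: opposite_def)

lemma opposite_opposite: "j \<in> {1..2*d} \<Longrightarrow> opposite d (opposite d j) = j"
  by (auto simp: opposite_def)

lemma neighbour_opposite:
  assumes "j \<in> {1..2*d}" shows "neighbour d (neighbour d x j) (opposite d j) = x"
  using assms by (auto simp: neighbour_def unit_vec_def opposite_def fun_eq_iff)

lemma neighbour_eq_iff:
  assumes "i \<in> {1..2*d}" "j \<in> {1..2*d}"
  shows "neighbour d x i = neighbour d x j \<longleftrightarrow> i = j"
proof
  assume *: "neighbour d x i = neighbour d x j"
  have "unit_vec d j k = unit_vec d i k" for k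
    using fun_cong[OF *, of k] by (simp add: neighbour_def)
  from this[of i] this[of "i - d"] this[of j] this[of "j - d"] show "i = j"
    using assms by (auto simp: unit_vec_def split: if_splits)
qed simp

lemma neighbour_neq:
  assumes "j \<in> {1..2*d}" shows "neighbour d x j \<noteq> x"
proof
  assume *: "neighbour d x j = x"
  from fun_cong[OF *, of j] fun_cong[OF *, of "j - d"] show False
    using assms by (auto simp: unit_vec_def neighbour_def split: if_splits)
qed

text \<open>First return loops: \<open>tl\<close> drops the starting point, which is
  \<open>z\<close> itself. The first step leaves from \<open>z\<close>, so that there are loops only
  if \<open>z\<close> belongs to \<open>V\<close>.\<close>

definition loops :: "nat \<Rightarrow> site set \<Rightarrow> site \<Rightarrow> nat list set" where
  "loops d V z = {w. w \<noteq> [] \<and> set w \<subseteq> {1..2*d} \<and> fst ` set (steps d z w) \<subseteq> V \<and> endpoint d z w = z \<and>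
     z \<notin> fst ` set (tl (steps d z w))}"

definition closed_words :: "nat \<Rightarrow> site set \<Rightarrow> site \<Rightarrow> nat list set" where
  "closed_words d V z = {w. set w \<subseteq> {1..2*d} \<and> fst ` set (steps d z w) \<subseteq> V \<and> endpoint d z w = z}"

lemma loopsD:
  assumes "w \<in> loops d V z"
  shows "w \<noteq> []" "set w \<subseteq> {1..2*d}" "fst ` set (steps d z w) \<subseteq> V" "endpoint d z w = z"
    "z \<notin> fst ` set (tl (steps d z w))"
  using assms by (auto simp: loops_def)

lemma loops_mono: "V \<subseteq> W \<Longrightarrow> loops d V z \<subseteq> loops d W z"
  by (auto simp: loops_def)

lemma weight_concat:
  assumes "ls \<in> lists (loops d V z)"
  shows "weight d p z (concat ls) = (\<Prod>l\<leftarrow>ls. weight d p z l)"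
  using assms by (induction ls) (auto simp: weight_append dest: loopsD)

lemma concat_in_closed_words:
  assumes "ls \<in> lists (loops d V z)" shows "concat ls \<in> closed_words d V z"
  using assms
proof (induction ls)
  case (Cons l ls)
  then have "l \<in> loops d V z" by simp
  from loopsD[OF this] Cons show ?case by (auto simp: closed_words_def steps_append)
qed (simp add: closed_words_def)

text \<open>No loop is a proper prefix of another one, which gives unique factorization.\<close>

lemma loops_prefix_free:
  assumes "u \<in> loops d V z" "v \<in> loops d W z" "u @ u' = v @ v'"
  shows "u = v"
proof -
  have "\<not> length u < length v" if "u \<in> loops d V z" "v \<in> loops d W z" "u @ u' = v @ v'"
    for u v u' v' V W
  proof
    assume lt: "length u < length v"
    have "v = u @ drop (length u) v"
      using that(3) lt by (metis append_eq_append_conv_if append_take_drop_id less_imp_le)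
    moreover have "drop (length u) v \<noteq> []" using lt by simp
    ultimately obtain j r where v: "v = u @ j # r" by (metis neq_Nil_conv)
    have "endpoint d z u = z" "u \<noteq> []" using that(1) by (auto dest: loopsD)
    then have "(z, j) \<in> set (tl (steps d z v))"
      by (cases u) (auto simp: v steps_append)
    then show False using loopsD(5)[OF that(2)] by force
  qed
  from this[of u V v W] this[of v W u V] assms have "length u = length v"
    by (metis linorder_neqE_nat)
  with assms(3) show ?thesis by simp
qed

lemma inj_on_concat_loops: "inj_on concat (lists (loops d V z))"
proof (rule inj_onI)
  fix xs ys assume "xs \<in> lists (loops d V z)" "ys \<in> lists (loops d V z)" "concat xs = concat ys"
  then show "xs = ys"
  proof (induction xs arbitrary: ys)
    case Nil
    then show ?case by (cases ys) (auto dest: loopsD)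
  next
    case (Cons x xs)
    then have xL: "x \<in> loops d V z" by auto
    with Cons.prems obtain y ys' where ys: "ys = y # ys'" by (cases ys) (auto dest: loopsD)
    then have "x = y"
      using loops_prefix_free[OF xL, of y V "concat xs" "concat ys'"] Cons.prems by auto
    moreover have "xs = ys'"
      using Cons.prems ys \<open>x = y\<close> by (intro Cons.IH) auto
    ultimately show ?case using ys by simp
  qed
qed

lemma first_return_decomp:
  assumes "w \<in> closed_words d V z" "w \<noteq> []"
  obtains u v where "u \<in> loops d V z" "v \<in> closed_words d V z" "w = u @ v"
proof -
  define P where "P n \<longleftrightarrow> 0 < n \<and> n \<le> length w \<and> endpoint d z (take n w) = z" for n
  define n where "n = (LEAST n. P n)"
  have "P (length w)"
    using assms by (auto simp: closed_words_def P_def)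
  then have "P n" unfolding n_def by (rule LeastI)
  then have n: "0 < n" "n \<le> length w" "endpoint d z (take n w) = z" by (auto simp: P_def)
  have least: "endpoint d z (take m w) \<noteq> z" if "0 < m" "m < n" for m
    using not_less_Least[of m P, folded n_def] that n by (auto simp: P_def)
  let ?u = "take n w" and ?v = "drop n w"
  have st: "steps d z w = steps d z ?u @ steps d z ?v"
    by (metis append_take_drop_id n(3) steps_append)
  have nth: "fst (steps d x u ! m) = endpoint d x (take m u)" if "m < length u" for x u m
    using that
  proof (induction u arbitrary: x m)
    case (Cons j u) then show ?case by (cases m) auto
  qed simp
  have "z \<notin> fst ` set (tl (steps d z ?u))"
  proof
    assume "z \<in> fst ` set (tl (steps d z ?u))"
    then obtain m where m: "m < length (tl (steps d z ?u))" "fst (tl (steps d z ?u) ! m) = z"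
      by (auto simp: in_set_conv_nth)
    then have "Suc m < n" "fst (steps d z ?u ! Suc m) = z" using n(2) by (auto simp: nth_tl)
    with nth[of "Suc m" ?u z] least[of "Suc m"] n show False by (simp add: min_def)
  qed
  with assms n st have "?u \<in> loops d V z"
    by (auto simp: loops_def closed_words_def dest: in_set_takeD)
  moreover have "?v \<in> closed_words d V z"
    using assms(1) st n(3) endpoint_append[of d z ?u ?v] unfolding closed_words_def
    by (auto dest: in_set_dropD simp del: endpoint_append)
  ultimately show ?thesis using that[of ?u ?v] by simp
qed

lemma concat_loops_eq: "concat ` lists (loops d V z) = closed_words d V z"
proof
  have "w \<in> concat ` lists (loops d V z)" if "w \<in> closed_words d V z" for w
    using that
  proof (induction w rule: length_induct)
    case (1 w)
    show ?case
    proof (cases "w = []")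
      case True then show ?thesis by (intro image_eqI[of _ _ "[]"]) auto
    next
      case False
      from first_return_decomp[OF 1(2) this] obtain u v where
        uv: "u \<in> loops d V z" "v \<in> closed_words d V z" "w = u @ v" .
      then have "length v < length w" by (auto dest: loopsD)
      with 1(1) uv obtain ls where "ls \<in> lists (loops d V z)" "v = concat ls" by blast
      with uv show ?thesis by (intro image_eqI[of _ _ "u # ls"]) auto
    qed
  qed
  then show "closed_words d V z \<subseteq> concat ` lists (loops d V z)" by blast
qed (auto intro: concat_in_closed_words)

section \<open>Powers of the Green function as sums over lists of loops\<close>

definition return_weight :: "nat \<Rightarrow> site set \<Rightarrow> environment \<Rightarrow> site \<Rightarrow> ennreal" where
  "return_weight d V p z = (\<integral>\<^sup>+w. weight d p z w \<partial>count_space (loops d V z))"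

definition loop_prod :: "nat \<Rightarrow> environment \<Rightarrow> site \<Rightarrow> nat list list \<Rightarrow> ennreal" where
  "loop_prod d p z ls = (\<Prod>l\<leftarrow>ls. weight d p z l)"

definition green_coeff :: "real \<Rightarrow> nat \<Rightarrow> real" where
  "green_coeff s k = pochhammer s k / fact k"

text \<open>\<open>green_power d V s p z\<close> is the power \<open>s\<close> of the Green function of the walk killed when
  leaving \<open>V\<close>, expanded by the binomial series of \<open>(1 - f)\<close> to the power \<open>- s\<close>, where \<open>f\<close> is
  the return probability. All terms are nonnegative, so that expectations are taken termwise.\<close>

definition green_power :: "nat \<Rightarrow> site set \<Rightarrow> real \<Rightarrow> environment \<Rightarrow> site \<Rightarrow> ennreal" where
  "green_power d V s p z =
     (\<integral>\<^sup>+ls. ennreal (green_coeff s (length ls)) * loop_prod d p z ls \<partial>count_space (lists (loops d V z)))"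

lemma green_coeff_pos: "0 < s \<Longrightarrow> 0 < green_coeff s k"
  by (simp add: green_coeff_def pochhammer_pos)

lemma green_coeff_1 [simp]: "green_coeff 1 k = 1"
  by (simp add: green_coeff_def pochhammer_fact[symmetric])

text \<open>At \<open>s = 1\<close> all coefficients are 1, and by unique factorization the sum over
  lists of loops is the sum over closed paths, which is the usual Green function.\<close>

lemma green_power_1: "green_power d V 1 p z = (\<integral>\<^sup>+w. weight d p z w \<partial>count_space (closed_words d V z))"
proof -
  have "(\<integral>\<^sup>+w. weight d p z w \<partial>count_space (closed_words d V z)) =
     (\<integral>\<^sup>+ls. weight d p z (concat ls) \<partial>count_space (lists (loops d V z)))"
    by (rule nn_integral_bij_count_space[symmetric])
       (auto simp: bij_betw_def inj_on_concat_loops concat_loops_eq)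
  also have "\<dots> = green_power d V 1 p z"
    unfolding green_power_def by (auto intro!: nn_integral_cong simp: weight_concat loop_prod_def)
  finally show ?thesis by simp
qed

lemma nn_integral_lists_length:
  fixes f :: "'a \<Rightarrow> ennreal"
  shows "(\<integral>\<^sup>+xs. (\<Prod>x\<leftarrow>xs. f x) \<partial>count_space {xs \<in> lists A. length xs = k}) = (\<integral>\<^sup>+x. f x \<partial>count_space A) ^ k"
proof (induction k)
  case 0
  have "{xs \<in> lists A. length xs = 0} = {[]}" by auto
  then show ?case by (simp add: nn_integral_count_space_finite)
next
  case (Suc k)
  let ?L = "\<lambda>k. {xs \<in> lists A. length xs = k}" and ?P = "\<lambda>xs. \<Prod>x\<leftarrow>xs. f x"
  have "(\<integral>\<^sup>+xs. ?P xs \<partial>count_space (?L (Suc k))) =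
      (\<integral>\<^sup>+y. ?P (fst y # snd y) \<partial>count_space (A \<times> ?L k))"
    by (rule nn_integral_bij_count_space[symmetric])
       (auto simp: bij_betw_def inj_on_def length_Suc_conv image_iff)
  also have "\<dots> = (\<integral>\<^sup>+y. f (fst y) * indicator A (fst y) * (?P (snd y) * indicator (?L k) (snd y)) \<partial>count_space UNIV)"
    by (subst nn_integral_count_space_indicator) (auto intro!: nn_integral_cong simp: indicator_def)
  also have "\<dots> = (\<integral>\<^sup>+x. \<integral>\<^sup>+xs. f x * indicator A x * (?P xs * indicator (?L k) xs) \<partial>count_space UNIV \<partial>count_space UNIV)"
    by (subst nn_integral_fst_count_space[symmetric]) simp
  also have "\<dots> = (\<integral>\<^sup>+x. f x * indicator A x \<partial>count_space UNIV) * (\<integral>\<^sup>+xs. ?P xs * indicator (?L k) xs \<partial>count_space UNIV)"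
    by (simp add: nn_integral_cmult nn_integral_multc)
  also have "\<dots> = (\<integral>\<^sup>+x. f x \<partial>count_space A) ^ Suc k"
    by (simp add: nn_integral_count_space_indicator[symmetric] Suc)
  finally show ?case .
qed

lemma green_power_eq_suminf:
  "green_power d V s p z = (\<Sum>k. ennreal (green_coeff s k) * return_weight d V p z ^ k)"
proof -
  let ?A = "loops d V z" and ?L = "\<lambda>k. {xs \<in> lists (loops d V z). length xs = k}"
  let ?g = "\<lambda>ls. ennreal (green_coeff s (length ls)) * loop_prod d p z ls"
  have "green_power d V s p z = (\<integral>\<^sup>+ls. ?g ls * indicator (lists ?A) ls \<partial>count_space UNIV)"
    unfolding green_power_def by (rule nn_integral_count_space_indicator) simp
  also have "\<dots> = (\<integral>\<^sup>+ls. (\<Sum>k. ?g ls * indicator (?L k) ls) \<partial>count_space UNIV)"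
  proof (rule nn_integral_cong)
    fix ls
    have "(\<Sum>k. ?g ls * indicator (?L k) ls) = (\<Sum>k\<in>{length ls}. ?g ls * indicator (?L k) ls)"
      by (rule suminf_finite) (auto simp: indicator_def)
    then show "?g ls * indicator (lists ?A) ls = (\<Sum>k. ?g ls * indicator (?L k) ls)"
      by (auto simp: indicator_def)
  qed
  also have "\<dots> = (\<Sum>k. \<integral>\<^sup>+ls. ?g ls * indicator (?L k) ls \<partial>count_space UNIV)"
    by (rule nn_integral_suminf) simp
  also have "\<dots> = (\<Sum>k. \<integral>\<^sup>+ls. ennreal (green_coeff s k) * (loop_prod d p z ls * indicator (?L k) ls) \<partial>count_space UNIV)"
    by (intro suminf_cong nn_integral_cong) (auto simp: indicator_def)
  also have "\<dots> = (\<Sum>k. ennreal (green_coeff s k) * return_weight d V p z ^ k)"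
    by (simp add: nn_integral_cmult nn_integral_count_space_indicator[symmetric]
        nn_integral_lists_length loop_prod_def return_weight_def)
  finally show ?thesis .
qed

lemma nn_integral_count_space_UN:
  fixes f :: "'a \<Rightarrow> ennreal"
  assumes "incseq A"
  shows "(\<integral>\<^sup>+x. f x \<partial>count_space (\<Union>n. A n)) = (SUP n. \<integral>\<^sup>+x. f x \<partial>count_space (A n))"
proof -
  have "(\<integral>\<^sup>+x. f x \<partial>count_space (\<Union>n. A n)) = (\<integral>\<^sup>+x. (SUP n. f x * indicator (A n) x) \<partial>count_space UNIV)"
  proof (subst nn_integral_count_space_indicator, simp, rule nn_integral_cong)
    fix x
    show "f x * indicator (\<Union>n. A n) x = (SUP n. f x * indicator (A n) x)"
    proof (cases "x \<in> (\<Union>n. A n)")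
      case True
      then obtain n where "x \<in> A n" by auto
      then have "(SUP n. f x * indicator (A n) x) = f x"
        by (intro antisym SUP_least SUP_upper2[of n]) (auto simp: indicator_def)
      with True show ?thesis by simp
    qed auto
  qed
  also have "\<dots> = (SUP n. \<integral>\<^sup>+x. f x * indicator (A n) x \<partial>count_space UNIV)"
    using assms by (intro nn_integral_monotone_convergence_SUP)
      (auto simp: incseq_def le_fun_def indicator_def)
  finally show ?thesis by (simp add: nn_integral_count_space_indicator[symmetric])
qed

lemma nn_integral_count_space_mono:
  fixes f :: "'a \<Rightarrow> ennreal"
  assumes "A \<subseteq> B"
  shows "(\<integral>\<^sup>+x. f x \<partial>count_space A) \<le> (\<integral>\<^sup>+x. f x \<partial>count_space B)"
  using assms by (subst (1 2) nn_integral_count_space_indicator)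
    (auto intro!: nn_integral_mono simp: indicator_def)

subsection \<open>The return probability\<close>

text \<open>The bound on the length makes the set finite and allows an induction. The starting point
  is exempt from avoiding \<open>z\<close>, so that for \<open>x = z\<close> these are the loops of
  length at most \<open>n\<close>.\<close>

definition hit_words :: "nat \<Rightarrow> site set \<Rightarrow> site \<Rightarrow> nat \<Rightarrow> site \<Rightarrow> nat list set" where
  "hit_words d V z n x = {w. w \<noteq> [] \<and> length w \<le> n \<and> set w \<subseteq> {1..2*d} \<and> fst ` set (steps d x w) \<subseteq> V \<and>
     endpoint d x w = z \<and> z \<notin> fst ` set (tl (steps d x w))}"

lemma finite_hit_words: "finite (hit_words d V z n x)"
  by (rule finite_subset[OF _ finite_lists_length_le[of "{1..2*d}" n]]) (auto simp: hit_words_def)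

text \<open>Decomposition at the first step: after it, the probability of reaching \<open>z\<close>
  is at most 1. The bound keeps the mass of the first step instead of 1, because the mass missing at
  \<open>z\<close> is what the reversed walk loses to the cemetery.\<close>

lemma sum_hit_words_le:
  assumes "\<And>y. y \<in> V \<Longrightarrow> (\<Sum>j=1..2*d. ennreal (p y j)) \<le> 1"
  shows "(\<Sum>w\<in>hit_words d V z n x. weight d p x w) \<le> (if x \<in> V then \<Sum>j=1..2*d. ennreal (p x j) else 0)"
proof (induction n arbitrary: x)
  case 0
  have "hit_words d V z 0 x = {}" by (auto simp: hit_words_def)
  then show ?case by simp
next
  case (Suc n)
  show ?case
  proof (cases "x \<in> V")
    case False
    have "hit_words d V z (Suc n) x = {}"
      using False by (auto simp: hit_words_def neq_Nil_conv)
    then show ?thesis by simp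
  next
    case True
    \<comment> \<open>A word that has arrived at \<open>z\<close> must stop there, whereas
      \<open>hit_words\<close> started at \<open>z\<close> would go on to the next return.\<close>
    define T where "T j = (if neighbour d x j = z then {[]} else hit_words d V z n (neighbour d x j))" for j
    have "hit_words d V z (Suc n) x \<subseteq> (\<Union>j\<in>{1..2*d}. (#) j ` T j)"
    proof
      fix w assume w: "w \<in> hit_words d V z (Suc n) x"
      then obtain j v where jv: "w = j # v" by (auto simp: hit_words_def neq_Nil_conv)
      have "v \<in> T j"
      proof (cases v)
        case (Cons i u)
        with w jv show ?thesis by (auto simp: T_def hit_words_def)
      qed (use w jv in \<open>auto simp: T_def hit_words_def\<close>)
      with w jv show "w \<in> (\<Union>j\<in>{1..2*d}. (#) j ` T j)" by (auto simp: hit_words_def)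
    qed
    then have "(\<Sum>w\<in>hit_words d V z (Suc n) x. weight d p x w) \<le> (\<Sum>w\<in>(\<Union>j\<in>{1..2*d}. (#) j ` T j). weight d p x w)"
      by (intro sum_mono2) (auto simp: T_def finite_hit_words)
    also have "\<dots> = (\<Sum>j=1..2*d. \<Sum>w\<in>(#) j ` T j. weight d p x w)"
      by (intro sum.UNION_disjoint) (auto simp: T_def finite_hit_words)
    also have "\<dots> = (\<Sum>j=1..2*d. ennreal (p x j) * (\<Sum>v\<in>T j. weight d p (neighbour d x j) v))"
      by (intro sum.cong refl) (simp add: sum.reindex sum_distrib_left)
    also have "\<dots> \<le> (\<Sum>j=1..2*d. ennreal (p x j) * 1)"
    proof (intro sum_mono mult_left_mono)
      fix j
      show "(\<Sum>v\<in>T j. weight d p (neighbour d x j) v) \<le> 1"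
        using Suc[of "neighbour d x j"] assms[of "neighbour d x j"]
        by (auto simp: T_def split: if_splits intro: order_trans)
    qed auto
    finally show ?thesis using True by simp
  qed
qed

lemma return_weight_le:
  assumes "\<And>y. y \<in> V \<Longrightarrow> (\<Sum>j=1..2*d. ennreal (p y j)) \<le> 1"
  shows "return_weight d V p z \<le> (\<Sum>j=1..2*d. ennreal (p z j))"
proof -
  have L: "loops d V z = (\<Union>n. hit_words d V z n z)"
    by (auto simp: loops_def hit_words_def)
  have "return_weight d V p z = (SUP n. \<Sum>w\<in>hit_words d V z n z. weight d p z w)"
    unfolding return_weight_def L
    by (subst nn_integral_count_space_UN)
       (auto simp: incseq_def hit_words_def nn_integral_count_space_finite[OF finite_hit_words, unfolded hit_words_def])
  also have "\<dots> \<le> (\<Sum>j=1..2*d. ennreal (p z j))"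
    using sum_hit_words_le[where V=V and p=p and d=d and z=z and x=z, OF assms] by (intro SUP_least) (rule order_trans, assumption, auto)
  finally show ?thesis .
qed

lemma green_coeff_sums:
  assumes "0 \<le> f" "f < 1"
  shows "(\<lambda>k. green_coeff s k * f ^ k) sums ((1 - f) powr (- s))"
proof -
  have "(\<lambda>k. ((- s) gchoose k) * (- f) ^ k) sums ((1 + - f) powr (- s))"
    using assms by (intro gen_binomial_real) auto
  moreover have "((- s) gchoose k) * (- f) ^ k = green_coeff s k * f ^ k" for k
    by (simp add: gbinomial_pochhammer green_coeff_def power_minus[of f] mult_ac)
  ultimately show ?thesis by simp
qed

lemma suminf_green_coeff:
  assumes "0 < s" "0 \<le> f" "f < 1"
  shows "(\<Sum>k. ennreal (green_coeff s k) * ennreal f ^ k) = ennreal ((1 - f) powr (- s))"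
proof -
  have "(\<Sum>k. ennreal (green_coeff s k * f ^ k)) = ennreal ((1 - f) powr (- s))"
    using assms green_coeff_pos[OF assms(1)]
    by (intro suminf_ennreal_eq green_coeff_sums) (auto simp: less_imp_le)
  then show ?thesis
    using assms green_coeff_pos[OF assms(1)] by (simp add: ennreal_mult ennreal_power less_imp_le)
qed

text \<open>A finite sum at \<open>f = 1\<close> would bound \<open>(1 - f) powr (- s)\<close> for
  all \<open>f < 1\<close>.\<close>

lemma suminf_green_coeff_top:
  assumes "0 < s" shows "(\<Sum>k. ennreal (green_coeff s k)) = \<infinity>"
proof (rule ccontr)
  assume "(\<Sum>k. ennreal (green_coeff s k)) \<noteq> \<infinity>"
  then obtain r where r: "(\<Sum>k. ennreal (green_coeff s k)) = ennreal r" "0 \<le> r"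
    by (cases "\<Sum>k. ennreal (green_coeff s k)") auto
  \<comment> \<open>Chosen so that the series at \<open>f = 1 - u\<close> has the value
    \<open>r + 2\<close>.\<close>
  define u where "u = (r + 2) powr (- 1 / s)"
  have u: "0 < u" "u < 1"
    using r(2) assms by (auto simp: u_def powr_less_one)
  have "ennreal ((1 - (1 - u)) powr (- s)) = (\<Sum>k. ennreal (green_coeff s k) * ennreal (1 - u) ^ k)"
    using u assms by (intro suminf_green_coeff[symmetric]) auto
  also have "\<dots> \<le> (\<Sum>k. ennreal (green_coeff s k) * 1)"
    using u by (intro suminf_le mult_left_mono) (auto intro!: power_le_one simp: ennreal_power)
  finally have "ennreal (u powr (- s)) \<le> ennreal r" using r by simp
  moreover have "u powr (- s) = r + 2"
    using r(2) assms by (simp add: u_def powr_powr)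
  ultimately show False using r(2) by simp
qed

lemma ennpowr_ennreal: "0 \<le> r \<Longrightarrow> ennpowr (ennreal r) s = ennreal (r powr s)"
  by (simp add: ennpowr_def)

text \<open>For \<open>f < 1\<close> this is the binomial series. For \<open>f = 1\<close> both
  sides are infinite, since the series diverges for every positive order.\<close>

lemma green_power_eq_ennpowr:
  assumes "0 < s" "return_weight d V p z \<le> 1"
  shows "green_power d V s p z = ennpowr (green_power d V 1 p z) s"
proof -
  obtain f where f: "return_weight d V p z = ennreal f" "0 \<le> f" "f \<le> 1"
    using assms(2) by (cases "return_weight d V p z") (auto simp: top_unique)
  show ?thesis
  proof (cases "f = 1")
    case True
    then show ?thesis
      using suminf_green_coeff_top[OF assms(1)] suminf_green_coeff_top[of 1]
      by (simp add: green_power_eq_suminf f ennpowr_def)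
  next
    case False
    then have "green_power d V s p z = ennreal ((1 - f) powr (- s))" if "0 < s" for s
      using f that by (simp add: green_power_eq_suminf suminf_green_coeff)
    from this[of s] this[of 1] assms(1) show ?thesis
      by (simp only: ennpowr_ennreal powr_ge_zero powr_powr) simp
  qed
qed

lemma green_power_le:
  assumes "0 < s" "0 < c" "c \<le> 1" "return_weight d V p z \<le> ennreal (1 - c)"
  shows "green_power d V s p z \<le> ennreal (c powr (- s))"
proof -
  have "green_power d V s p z \<le> (\<Sum>k. ennreal (green_coeff s k) * ennreal (1 - c) ^ k)"
    unfolding green_power_eq_suminf
    using assms by (intro suminf_le mult_left_mono power_mono) auto
  also have "\<dots> = ennreal (c powr (- s))"
    using assms by (subst suminf_green_coeff) auto
  finally show ?thesis .
qed

lemma green_power_mono: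
  "V \<subseteq> W \<Longrightarrow> green_power d V s p z \<le> green_power d W s p z"
  unfolding green_power_def by (intro nn_integral_count_space_mono lists_mono loops_mono)

subsection \<open>Moments of products of step weights\<close>

text \<open>A product of loop weights is a monomial in the transition probabilities, and its
  expectation depends only on how often each edge is used. The order of the steps can therefore be
  forgotten.\<close>

definition step_mset :: "nat \<Rightarrow> site \<Rightarrow> nat list list \<Rightarrow> (site \<times> nat) multiset" where
  "step_mset d z ls = mset (concat (map (steps d z) ls))"

lemma loop_prod_step_mset:
  "loop_prod d p z ls = (\<Prod>s\<in>#step_mset d z ls. ennreal (p (fst s) (snd s)))"
  by (induction ls) (auto simp: loop_prod_def step_mset_def weight_steps case_prod_unfold simp flip: prod_mset_prod_list)

lemma steps_dirs: "snd ` set (steps d x w) = set w"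
  by (induction w arbitrary: x) auto

lemma set_step_mset:
  assumes "ls \<in> lists (loops d V z)"
  shows "set_mset (step_mset d z ls) \<subseteq> V \<times> {1..2*d}"
proof
  fix s assume "s \<in> set_mset (step_mset d z ls)"
  then obtain l where l: "l \<in> set ls" "s \<in> set (steps d z l)" by (auto simp: step_mset_def)
  then have "l \<in> loops d V z" using assms by auto
  from loopsD[OF this] l(2) steps_dirs[of d z l] show "s \<in> V \<times> {1..2*d}" by (cases s) force
qed

text \<open>The number of edges may depend on the site, which leaves room for an edge to the
  cemetery at \<open>z\<close> alone.\<close>

definition dirichlet_prod :: "site set \<Rightarrow> (site \<Rightarrow> nat) \<Rightarrow> (site \<Rightarrow> nat \<Rightarrow> real) \<Rightarrow> environment measure" where
  "dirichlet_prod V n a = PiM V (\<lambda>y. dirichlet (n y) (a y))"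

lemma dirichlet_pochhammer_moment:
  assumes "1 \<le> n" "\<forall>i\<in>{1..n}. 0 < a i"
  shows "(\<integral>\<^sup>+x. (\<Prod>i=1..n. ennreal (x i) ^ k i) \<partial>dirichlet n a) =
    ennreal ((\<Prod>i=1..n. pochhammer (a i) (k i)) / pochhammer (\<Sum>i=1..n. a i) (\<Sum>i=1..n. k i))"
proof -
  have "(\<integral>\<^sup>+x. (\<Prod>i=1..n. ennreal (x i) ^ k i) \<partial>dirichlet n a) =
      (\<integral>\<^sup>+x. (\<Prod>i=1..n. ennreal (x i powr real (k i))) \<partial>dirichlet n a)"
    using AE_dirichlet[OF assms]
    by (intro nn_integral_cong_AE) (auto intro!: prod.cong elim!: eventually_mono simp: powr_realpow ennreal_power)
  also have "\<dots> = ennreal (dirichlet_const n (\<lambda>i. a i + real (k i)) / dirichlet_const n a)"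
    using assms by (intro dirichlet_moment) (auto intro: add_pos_nonneg)
  also have "dirichlet_const n (\<lambda>i. a i + real (k i)) / dirichlet_const n a =
     (\<Prod>i=1..n. pochhammer (a i) (k i)) / pochhammer (\<Sum>i=1..n. a i) (\<Sum>i=1..n. k i)"
  proof -
    have "0 < (\<Sum>i=1..n. a i)" using assms by (intro sum_pos) auto
    moreover have "a i \<notin> \<int>\<^sub>\<le>\<^sub>0" if "i \<in> {1..n}" for i
      using assms that nonpos_Ints_nonpos[of "a i"] by (meson not_le)
    moreover from calculation(1) have "sum a {1..n} \<notin> \<int>\<^sub>\<le>\<^sub>0"
      using nonpos_Ints_nonpos[of "sum a {1..n}"] by (meson not_le)
    ultimately show ?thesis
      by (simp add: dirichlet_const_def pochhammer_Gamma prod_dividef sum.distrib field_simps not_le[symmetric])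
  qed
  finally show ?thesis .
qed

lemma sets_dirichlet_prod [measurable_cong]:
  "sets (dirichlet_prod V n a) = sets (PiM V (\<lambda>y. PiM {1..n y} (\<lambda>_. borel)))"
  unfolding dirichlet_prod_def by (intro sets_PiM_cong) (auto simp: sets_dirichlet)

lemma measurable_dirichlet_prod_component:
  assumes "y \<in> V" "j \<in> {1..n y}"
  shows "(\<lambda>p. p y j) \<in> borel_measurable (dirichlet_prod V n a)"
proof -
  have "(\<lambda>p. p y) \<in> dirichlet_prod V n a \<rightarrow>\<^sub>M PiM {1..n y} (\<lambda>_. borel)"
    using assms(1) by (subst measurable_cong_sets[OF sets_dirichlet_prod refl]) (rule measurable_component_singleton)
  from measurable_compose[OF this measurable_component_singleton[OF assms(2)]] show ?thesis .
qed

lemma product_sigma_finite_dirichlet: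
  assumes "\<And>y. 1 \<le> n y" "\<And>y. \<forall>j\<in>{1..n y}. 0 < a y j"
  shows "product_sigma_finite (\<lambda>y. dirichlet (n y) (a y))"
  using prob_space_dirichlet[OF assms] by (simp add: product_sigma_finite_def prob_space_imp_sigma_finite)

lemma nn_integral_dirichlet_prod:
  assumes "\<And>y. 1 \<le> n y" "\<And>y. \<forall>j\<in>{1..n y}. 0 < a y j" "finite V"
    "\<And>y. y \<in> V \<Longrightarrow> f y \<in> borel_measurable (dirichlet (n y) (a y))"
  shows "(\<integral>\<^sup>+p. (\<Prod>y\<in>V. f y (p y)) \<partial>dirichlet_prod V n a) = (\<Prod>y\<in>V. \<integral>\<^sup>+x. f y x \<partial>dirichlet (n y) (a y))"
proof -
  interpret product_sigma_finite "\<lambda>y. dirichlet (n y) (a y)"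
    by (rule product_sigma_finite_dirichlet[OF assms(1,2)])
  show ?thesis unfolding dirichlet_prod_def using assms(3,4) by (rule product_nn_integral_prod)
qed

lemma sum_count_fst:
  assumes "finite J" "snd ` set_mset m \<subseteq> J"
  shows "(\<Sum>j\<in>J. count m (y, j)) = count (image_mset fst m) y"
  using assms(2)
proof (induction m)
  case (add s m)
  have "(\<Sum>j\<in>J. count (add_mset s m) (y, j)) = (\<Sum>j\<in>J. count m (y, j)) + (\<Sum>j\<in>J. if j = snd s \<and> fst s = y then 1 else 0)"
    by (subst sum.distrib[symmetric]) (auto intro!: sum.cong)
  also have "(\<Sum>j\<in>J. if j = snd s \<and> fst s = y then 1 else 0) = (if fst s = y then 1 else (0::nat))"
    using add.prems assms(1) by auto
  finally show ?case using add by simp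
qed simp

lemma nn_integral_step_prod:
  assumes n: "\<And>y. 1 \<le> n y" and a: "\<And>y. \<forall>j\<in>{1..n y}. 0 < a y j" and V: "finite V"
    and m: "set_mset m \<subseteq> V \<times> {1..2*d}" and nd: "\<And>y. 2*d \<le> n y"
  shows "(\<integral>\<^sup>+p. (\<Prod>s\<in>#m. ennreal (p (fst s) (snd s))) \<partial>dirichlet_prod V n a) =
    ennreal ((\<Prod>s\<in>set_mset m. pochhammer (a (fst s) (snd s)) (count m s)) /
      (\<Prod>y\<in>V. pochhammer (\<Sum>j\<in>{1..n y}. a y j) (count (image_mset fst m) y)))"
proof -
  let ?J = "\<lambda>y. {1..n y}"
  have sub: "set_mset m \<subseteq> Sigma V ?J"
  proof
    fix s assume "s \<in> set_mset m"
    with m have "s \<in> V \<times> {1..2*d}" by blast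
    with nd[of "fst s"] show "s \<in> Sigma V ?J" by (cases s) auto
  qed
  have prod_eq: "(\<Prod>s\<in>set_mset m. g s (count m s)) = (\<Prod>y\<in>V. \<Prod>j\<in>?J y. g (y, j) (count m (y, j)))"
    if "\<And>s. g s 0 = 1" for g :: "site \<times> nat \<Rightarrow> nat \<Rightarrow> 'b::comm_monoid_mult"
  proof -
    have "(\<Prod>s\<in>set_mset m. g s (count m s)) = (\<Prod>s\<in>Sigma V ?J. g s (count m s))"
      using sub V that by (intro prod.mono_neutral_left) (auto simp: not_in_iff)
    then show ?thesis using V by (simp add: prod.Sigma)
  qed
  have "(\<integral>\<^sup>+p. (\<Prod>s\<in>#m. ennreal (p (fst s) (snd s))) \<partial>dirichlet_prod V n a) =
     (\<integral>\<^sup>+p. (\<Prod>y\<in>V. \<Prod>j\<in>?J y. ennreal (p y j) ^ count m (y, j)) \<partial>dirichlet_prod V n a)"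
    using prod_eq[of "\<lambda>s k. ennreal (p (fst s) (snd s)) ^ k" for p]
    by (simp add: image_prod_mset_multiplicity)
  also have "\<dots> = (\<Prod>y\<in>V. \<integral>\<^sup>+x. (\<Prod>j\<in>?J y. ennreal (x j) ^ count m (y, j)) \<partial>dirichlet (n y) (a y))"
    by (rule nn_integral_dirichlet_prod[OF n a V]) measurable
  also have "\<dots> = (\<Prod>y\<in>V. ennreal ((\<Prod>j\<in>?J y. pochhammer (a y j) (count m (y, j))) /
      pochhammer (\<Sum>j\<in>?J y. a y j) (count (image_mset fst m) y)))"
  proof (intro prod.cong refl)
    fix y assume "y \<in> V"
    have "snd ` set_mset m \<subseteq> {1..2*d}" using m by auto
    then have "snd ` set_mset m \<subseteq> {1..n y}" using nd[of y] by auto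
    from sum_count_fst[OF _ this] show
     "(\<integral>\<^sup>+x. (\<Prod>j\<in>?J y. ennreal (x j) ^ count m (y, j)) \<partial>dirichlet (n y) (a y)) =
      ennreal ((\<Prod>j\<in>?J y. pochhammer (a y j) (count m (y, j))) /
      pochhammer (\<Sum>j\<in>?J y. a y j) (count (image_mset fst m) y))"
      by (subst dirichlet_pochhammer_moment[OF n a]) auto
  qed
  also have "\<dots> = ennreal (\<Prod>y\<in>V. (\<Prod>j\<in>?J y. pochhammer (a y j) (count m (y, j))) /
      pochhammer (\<Sum>j\<in>?J y. a y j) (count (image_mset fst m) y))"
    using a n
    by (intro prod_ennreal divide_nonneg_nonneg prod_nonneg ballI pochhammer_nonneg sum_pos)
       (auto simp: less_imp_le)
  finally show ?thesis
    using prod_eq[of "\<lambda>s k. pochhammer (a (fst s) (snd s)) k"] by (simp add: prod_dividef)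
qed

subsection \<open>Reversal\<close>

definition reverse_step :: "nat \<Rightarrow> site \<times> nat \<Rightarrow> site \<times> nat" where
  "reverse_step d s = (neighbour d (fst s) (snd s), opposite d (snd s))"

definition reverse_word :: "nat \<Rightarrow> nat list \<Rightarrow> nat list" where
  "reverse_word d w = rev (map (opposite d) w)"

lemma reverse_word_reverse_word: "set w \<subseteq> {1..2*d} \<Longrightarrow> reverse_word d (reverse_word d w) = w"
  by (simp add: reverse_word_def rev_map) (auto intro!: map_idI simp: opposite_opposite)

lemma steps_reverse_word:
  assumes "set w \<subseteq> {1..2*d}"
  shows "steps d (endpoint d x w) (reverse_word d w) = rev (map (reverse_step d) (steps d x w)) \<and>
    endpoint d (endpoint d x w) (reverse_word d w) = x"
  using assms
proof (induction w arbitrary: x)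
  case (Cons j w)
  then show ?case
    by (simp add: reverse_word_def steps_append reverse_step_def neighbour_opposite)
qed (simp add: reverse_word_def)

text \<open>The first component of a reversed step is the end of the step, so that both sides list
  the sites visited, with the start and the end included.\<close>

lemma visited_after:
  "x # map (fst \<circ> reverse_step d) (steps d x w) = map fst (steps d x w) @ [endpoint d x w]"
  by (induction w arbitrary: x) (auto simp: reverse_step_def)

lemma visited_after_loop:
  assumes "w \<in> loops d V z"
  shows "map (fst \<circ> reverse_step d) (steps d z w) = tl (map fst (steps d z w)) @ [z]"
  using visited_after[of z d w] loopsD(1,4)[OF assms] by (cases w) auto

lemma reverse_word_in_loops:
  assumes w: "w \<in> loops d V z" shows "reverse_word d w \<in> loops d V z"
proof -
  note D = loopsD[OF w]
  have st: "steps d z (reverse_word d w) = rev (map (reverse_step d) (steps d z w))"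
    and e: "endpoint d z (reverse_word d w) = z"
    using steps_reverse_word[OF D(2), of z] D(4) by auto
  have f: "map fst (steps d z (reverse_word d w)) = z # rev (tl (map fst (steps d z w)))"
    using visited_after_loop[OF w] by (simp add: st rev_map[symmetric])
  have "z \<in> V" using D(1,3) by (cases w) auto
  moreover have "fst ` set (steps d z (reverse_word d w)) = insert z (set (tl (map fst (steps d z w))))"
    using arg_cong[OF f, of set] by simp
  moreover have "set (tl (map fst (steps d z w))) \<subseteq> V"
    using D(1,3) by (cases w) auto
  moreover have "fst ` set (tl (steps d z (reverse_word d w))) = set (tl (map fst (steps d z w)))"
    using arg_cong[OF f, of tl] by (metis list.sel(3) list.set_map map_tl set_rev)
  ultimately show ?thesis
    using D e opposite_in[of _ d] by (auto simp: loops_def map_tl[symmetric] reverse_word_def)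
qed

lemma bij_map_reverse_word:
  "bij_betw (map (reverse_word d)) (lists (loops d V z)) (lists (loops d V z))"
  by (rule bij_betwI[where g="map (reverse_word d)"])
     (auto simp: reverse_word_in_loops intro!: map_idI reverse_word_reverse_word[OF loopsD(2)])

lemma step_mset_reverse:
  assumes "ls \<in> lists (loops d V z)"
  shows "step_mset d z (map (reverse_word d) ls) = image_mset (reverse_step d) (step_mset d z ls)"
  using assms
proof (induction ls)
  case (Cons l ls)
  then have l: "l \<in> loops d V z" by simp
  from steps_reverse_word[OF loopsD(2)[OF l], of z] loopsD(4)[OF l] Cons show ?case
    by (simp add: step_mset_def)
qed (simp add: step_mset_def)

text \<open>Along a closed path each site is entered as often as it is left. This preserves the
  denominators of the moments under reversal.\<close>

lemma fst_step_mset_reverse: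
  assumes "ls \<in> lists (loops d V z)"
  shows "image_mset (fst \<circ> reverse_step d) (step_mset d z ls) = image_mset fst (step_mset d z ls)"
  using assms
proof (induction ls)
  case (Cons l ls)
  then have l: "l \<in> loops d V z" by simp
  have "mset (map (fst \<circ> reverse_step d) (steps d z l)) = mset (map fst (steps d z l))"
    using arg_cong[OF visited_after[of z d l], of mset] loopsD(4)[OF l] by simp
  with Cons show ?case by (simp add: step_mset_def image_mset.compositionality o_def)
qed (simp add: step_mset_def)

lemma inj_on_reverse_step: "inj_on (reverse_step d) (UNIV \<times> {1..2*d})"
proof (rule inj_onI)
  fix s t assume s: "s \<in> UNIV \<times> {1..2*d}" and t: "t \<in> UNIV \<times> {1..2*d}" and e: "reverse_step d s = reverse_step d t"
  have "reverse_step d (reverse_step d r) = r" if "r \<in> UNIV \<times> {1..2*d}" for r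
    using that by (auto simp: reverse_step_def neighbour_opposite opposite_opposite)
  with s t e show "s = t" by metis
qed

lemma AE_dirichlet_prod:
  assumes n: "\<And>y. 1 \<le> n y" and a: "\<And>y. \<forall>j\<in>{1..n y}. 0 < a y j" and "countable V"
  shows "AE p in dirichlet_prod V n a. \<forall>y\<in>V. (\<forall>j\<in>{1..n y}. 0 < p y j) \<and> (\<Sum>j\<in>{1..n y}. p y j) = 1"
  unfolding dirichlet_prod_def
proof (subst AE_ball_countable[OF assms(3)], intro ballI)
  fix y assume "y \<in> V"
  then show "AE p in PiM V (\<lambda>y. dirichlet (n y) (a y)). (\<forall>j\<in>{1..n y}. 0 < p y j) \<and> (\<Sum>j\<in>{1..n y}. p y j) = 1"
    by (intro AE_PiM_component[where P="\<lambda>x. (\<forall>j\<in>{1..n y}. 0 < x j) \<and> (\<Sum>j\<in>{1..n y}. x j) = 1" for y]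
       prob_space_dirichlet n a AE_dirichlet)
qed

lemma dirichlet_moment_single:
  assumes n: "1 \<le> n" and a: "\<forall>i\<in>{1..n}. 0 < a i" and k: "k \<in> {1..n}" and b: "0 < a k + b"
  shows "(\<integral>\<^sup>+x. ennreal (x k powr b) \<partial>dirichlet n a) =
    ennreal (Gamma (a k + b) * Gamma (\<Sum>i=1..n. a i) / (Gamma (a k) * Gamma ((\<Sum>i=1..n. a i) + b)))"
proof -
  define c where "c = (\<lambda>i. if i = k then b else 0)"
  have "(\<integral>\<^sup>+x. ennreal (x k powr b) \<partial>dirichlet n a) = (\<integral>\<^sup>+x. (\<Prod>i=1..n. ennreal (x i powr c i)) \<partial>dirichlet n a)"
  proof (rule nn_integral_cong_AE, use AE_dirichlet[OF n a] in eventually_elim)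
    fix x :: "nat \<Rightarrow> real" assume x: "(\<forall>i\<in>{1..n}. 0 < x i) \<and> sum x {1..n} = 1"
    have "(\<Prod>i=1..n. ennreal (x i powr c i)) = (\<Prod>i=1..n. if i = k then ennreal (x k powr b) else 1)"
    proof (intro prod.cong refl)
      fix i assume "i \<in> {1..n}"
      with x have "x i \<noteq> 0" by force
      then show "ennreal (x i powr c i) = (if i = k then ennreal (x k powr b) else 1)"
        by (simp add: c_def)
    qed
    with k show "ennreal (x k powr b) = (\<Prod>i=1..n. ennreal (x i powr c i))" by simp
  qed
  also have "\<dots> = ennreal (dirichlet_const n (\<lambda>i. a i + c i) / dirichlet_const n a)"
    using n a b by (intro dirichlet_moment) (auto simp: c_def)
  also have "dirichlet_const n (\<lambda>i. a i + c i) / dirichlet_const n a =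
      Gamma (a k + b) * Gamma (\<Sum>i=1..n. a i) / (Gamma (a k) * Gamma ((\<Sum>i=1..n. a i) + b))"
  proof -
    define P where "P = (\<Prod>i\<in>{1..n} - {k}. Gamma (a i))"
    have "(\<Prod>i=1..n. Gamma (a i + c i)) = Gamma (a k + b) * P"
      using k by (subst prod.remove[of _ k]) (auto simp: c_def P_def intro!: prod.cong)
    moreover have "(\<Prod>i=1..n. Gamma (a i)) = Gamma (a k) * P"
      using k by (subst prod.remove[of _ k]) (auto simp: P_def)
    moreover have "P > 0" unfolding P_def
      using a by (intro prod_pos Gamma_real_pos) auto
    moreover have "(\<Sum>i=1..n. a i + c i) = (\<Sum>i=1..n. a i) + b"
      using k by (simp add: sum.distrib c_def)
    ultimately show ?thesis by (simp add: dirichlet_const_def)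
  qed
  finally show ?thesis .
qed

lemma measurable_loop_prod:
  assumes "ls \<in> lists (loops d V z)" "\<And>y. 2*d \<le> n y"
  shows "(\<lambda>p. loop_prod d p z ls) \<in> borel_measurable (dirichlet_prod V n a)"
proof -
  have "(\<lambda>p. \<Prod>s\<in>#m. ennreal (p (fst s) (snd s))) \<in> borel_measurable (dirichlet_prod V n a)"
    if "set_mset m \<subseteq> V \<times> {1..2*d}" for m
    using that
  proof (induction m)
    case (add s m)
    have s: "fst s \<in> V" "snd s \<in> {1..n (fst s)}"
      using add.prems assms(2)[of "fst s"] by auto
    note [measurable] = measurable_dirichlet_prod_component[where y="fst s" and j="snd s" and a=a and V=V and n=n, OF s]
    have [measurable]: "(\<lambda>p. \<Prod>s\<in>#m. ennreal (p (fst s) (snd s))) \<in> borel_measurable (dirichlet_prod V n a)"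
      using add by auto
    show ?case by simp
  qed simp
  from this[OF set_step_mset[OF assms(1)]] show ?thesis by (simp add: loop_prod_step_mset)
qed

lemma nn_integral_green_power:
  assumes "\<And>y. 2*d \<le> n y"
  shows "(\<integral>\<^sup>+p. green_power d V s p z \<partial>dirichlet_prod V n a) =
    (\<integral>\<^sup>+ls. ennreal (green_coeff s (length ls)) * (\<integral>\<^sup>+p. loop_prod d p z ls \<partial>dirichlet_prod V n a)
       \<partial>count_space (lists (loops d V z)))"
  unfolding green_power_def using measurable_loop_prod[OF _ assms]
  by (subst nn_integral_count_space_nn_integral)
     (auto intro!: nn_integral_cong nn_integral_cmult simp del: in_lists_conv_set)

text \<open>A reversed edge inherits the parameter of the original one. Beyond \<open>2 * d\<close>,
  the only index in use will be \<open>Suc (2 * d)\<close> at \<open>z\<close>, the edge to the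
  cemetery.\<close>

definition reversed_weights :: "nat \<Rightarrow> (site \<Rightarrow> nat \<Rightarrow> real) \<Rightarrow> real \<Rightarrow> site \<Rightarrow> nat \<Rightarrow> real" where
  "reversed_weights d a \<gamma> y j = (if j \<in> {1..2*d} then a (neighbour d y j) (opposite d j) else \<gamma>)"

text \<open>The numerators agree factor by factor, because every edge carries its parameter along.
  In the denominators the counts agree since the paths are closed. The totals agree by the balance:
  the reversed total at a site is the old incoming total, and the edge of parameter
  \<open>\<gamma>\<close> makes up for the excess at \<open>z\<close>.\<close>

lemma reversed_moment:
  assumes d: "1 \<le> d" and V: "finite V" and a: "\<And>y j. j \<in> {1..2*d} \<Longrightarrow> 0 < a y j" and g: "0 < \<gamma>"
    and balance: "\<And>y. y \<in> V \<Longrightarrow> (\<Sum>j=1..2*d. a y j) =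
      (\<Sum>j=1..2*d. a (neighbour d y j) (opposite d j)) + (if y = z then \<gamma> else 0)"
    and ls: "ls \<in> lists (loops d V z)"
  defines "n \<equiv> \<lambda>y. if y = z then Suc (2*d) else 2*d"
  shows "(\<integral>\<^sup>+p. loop_prod d p z ls \<partial>dirichlet_prod V (\<lambda>_. 2*d) a) =
    (\<integral>\<^sup>+p. loop_prod d p z (map (reverse_word d) ls) \<partial>dirichlet_prod V n (reversed_weights d a \<gamma>))"
proof -
  let ?m = "step_mset d z ls" and ?r = "reverse_step d" and ?b = "reversed_weights d a \<gamma>"
  have m: "set_mset ?m \<subseteq> V \<times> {1..2*d}" by (rule set_step_mset[OF ls])
  have rls: "map (reverse_word d) ls \<in> lists (loops d V z)"
    using bij_map_reverse_word[of d V z] ls by (blast dest: bij_betwE)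
  have rm: "set_mset (image_mset ?r ?m) \<subseteq> V \<times> {1..2*d}"
    using set_step_mset[OF rls] by (simp add: step_mset_reverse[OF ls])
  have inj: "inj_on ?r (set_mset ?m)"
    using m by (intro inj_on_subset[OF inj_on_reverse_step]) auto
  have cnt: "count (image_mset ?r ?m) (?r s) = count ?m s" if "s \<in># ?m" for s
  proof -
    have "?r -` {?r s} \<inter> set_mset ?m = {s}" using inj that by (auto dest: inj_onD)
    then show ?thesis by (simp add: count_image_mset)
  qed
  have b: "?b (fst (?r s)) (snd (?r s)) = a (fst s) (snd s)" if "s \<in># ?m" for s
    using that m opposite_in[of "snd s" d]
    by (auto simp: reversed_weights_def reverse_step_def neighbour_opposite opposite_opposite)
  have tot: "(\<Sum>j\<in>{1..n y}. ?b y j) = (\<Sum>j=1..2*d. a y j)" if "y \<in> V" for y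
    using balance[OF that] by (auto simp: n_def reversed_weights_def)
  have "(\<integral>\<^sup>+p. loop_prod d p z ls \<partial>dirichlet_prod V (\<lambda>_. 2*d) a) =
    ennreal ((\<Prod>s\<in>set_mset ?m. pochhammer (a (fst s) (snd s)) (count ?m s)) /
      (\<Prod>y\<in>V. pochhammer (\<Sum>j=1..2*d. a y j) (count (image_mset fst ?m) y)))"
    unfolding loop_prod_step_mset using d a V m by (intro nn_integral_step_prod[where d=d]) auto
  also have "(\<Prod>s\<in>set_mset ?m. pochhammer (a (fst s) (snd s)) (count ?m s)) =
      (\<Prod>s\<in>set_mset (image_mset ?r ?m). pochhammer (?b (fst s) (snd s)) (count (image_mset ?r ?m) s))"
    using inj by (simp add: prod.reindex cnt b)
  also have "(\<Prod>y\<in>V. pochhammer (\<Sum>j=1..2*d. a y j) (count (image_mset fst ?m) y)) =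
      (\<Prod>y\<in>V. pochhammer (\<Sum>j\<in>{1..n y}. ?b y j) (count (image_mset fst (image_mset ?r ?m)) y))"
    using fst_step_mset_reverse[OF ls] by (intro prod.cong) (auto simp: tot image_mset.compositionality o_def)
  also have "ennreal ((\<Prod>s\<in>set_mset (image_mset ?r ?m). pochhammer (?b (fst s) (snd s)) (count (image_mset ?r ?m) s)) /
      (\<Prod>y\<in>V. pochhammer (\<Sum>j\<in>{1..n y}. ?b y j) (count (image_mset fst (image_mset ?r ?m)) y))) =
    (\<integral>\<^sup>+p. loop_prod d p z (map (reverse_word d) ls) \<partial>dirichlet_prod V n ?b)"
    unfolding loop_prod_step_mset step_mset_reverse[OF ls]
    using d a g V rm opposite_in[of _ d]
    by (intro nn_integral_step_prod[where d=d, symmetric]) (auto simp: n_def reversed_weights_def)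
  finally show ?thesis .
qed

text \<open>In the reversed environment the walk may jump from \<open>z\<close> to the cemetery, with a
  probability whose negative moments of order below \<open>\<gamma>\<close> are finite and do not depend on \<open>V\<close>.\<close>

theorem nn_integral_green_power_le:
  assumes d: "1 \<le> d" and V: "finite V" "z \<in> V" and a: "\<And>y j. j \<in> {1..2*d} \<Longrightarrow> 0 < a y j"
    and balance: "\<And>y. y \<in> V \<Longrightarrow> (\<Sum>j=1..2*d. a y j) =
      (\<Sum>j=1..2*d. a (neighbour d y j) (opposite d j)) + (if y = z then \<gamma> else 0)"
    and s: "0 < s" "s < \<gamma>"
  shows "(\<integral>\<^sup>+p. green_power d V s p z \<partial>dirichlet_prod V (\<lambda>_. 2*d) a) \<le>
    ennreal (Gamma (\<gamma> - s) * Gamma (\<Sum>j=1..2*d. a z j) / (Gamma \<gamma> * Gamma ((\<Sum>j=1..2*d. a z j) - s)))"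
proof -
  define n where "n = (\<lambda>y. if y = z then Suc (2*d) else 2*d)"
  let ?b = "reversed_weights d a \<gamma>" and ?N = "Suc (2*d)" and ?L = "lists (loops d V z)"
  let ?c = "\<lambda>ls. ennreal (green_coeff s (length ls))"
  have g: "0 < \<gamma>" using s by simp
  have n: "1 \<le> n y" "2*d \<le> n y" for y using d by (auto simp: n_def)
  have b: "\<forall>j\<in>{1..n y}. 0 < ?b y j" for y
    using a g opposite_in[of _ d] by (auto simp: reversed_weights_def)
  have rm: "(\<integral>\<^sup>+p. loop_prod d p z ls \<partial>dirichlet_prod V (\<lambda>_. 2*d) a) =
    (\<integral>\<^sup>+p. loop_prod d p z (map (reverse_word d) ls) \<partial>dirichlet_prod V n ?b)" if "ls \<in> ?L" for ls
    unfolding n_def using d V(1) a g balance that by (rule reversed_moment)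
  have "(\<integral>\<^sup>+p. green_power d V s p z \<partial>dirichlet_prod V (\<lambda>_. 2*d) a) =
     (\<integral>\<^sup>+ls. ?c (map (reverse_word d) ls) *
        (\<integral>\<^sup>+p. loop_prod d p z (map (reverse_word d) ls) \<partial>dirichlet_prod V n ?b) \<partial>count_space ?L)"
    by (subst nn_integral_green_power) (auto intro!: nn_integral_cong simp: rm simp del: in_lists_conv_set)
  \<comment> \<open>The coefficients depend only on the number of loops, so that reversal of the
    loops merely permutes the terms.\<close>
  also have "\<dots> = (\<integral>\<^sup>+ls. ?c ls * (\<integral>\<^sup>+p. loop_prod d p z ls \<partial>dirichlet_prod V n ?b) \<partial>count_space ?L)"
    by (rule nn_integral_bij_count_space[OF bij_map_reverse_word])
  also have "\<dots> = (\<integral>\<^sup>+p. green_power d V s p z \<partial>dirichlet_prod V n ?b)"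
    by (rule nn_integral_green_power[symmetric]) (rule n)
  \<comment> \<open>The first step of a loop goes to a neighbour, which has probability
    \<open>1 - p z ?N\<close> in the reversed environment.\<close>
  also have "\<dots> \<le> (\<integral>\<^sup>+p. ennreal (p z ?N powr (- s)) \<partial>dirichlet_prod V n ?b)"
  proof (rule nn_integral_mono_AE, use AE_dirichlet_prod[where n=n and a="?b", OF n(1) b countable_finite[OF V(1)]] in eventually_elim)
    fix p :: environment assume p: "\<forall>y\<in>V. (\<forall>j\<in>{1..n y}. 0 < p y j) \<and> (\<Sum>j\<in>{1..n y}. p y j) = 1"
    have sub: "(\<Sum>j=1..2*d. p y j) \<le> 1" if "y \<in> V" for y
    proof -
      have "(\<Sum>j=1..2*d. p y j) \<le> (\<Sum>j\<in>{1..n y}. p y j)"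
        using p that n(2)[of y] by (intro sum_mono2) (auto intro: less_imp_le)
      with p that show ?thesis by auto
    qed
    have nn: "0 \<le> p y j" if "y \<in> V" "j \<in> {1..2*d}" for y j
      using p that n(2)[of y] by (auto intro: less_imp_le)
    have en: "(\<Sum>j=1..2*d. ennreal (p y j)) = ennreal (\<Sum>j=1..2*d. p y j)" if "y \<in> V" for y
      using nn that by (intro sum_ennreal) auto
    have z: "(\<Sum>j=1..2*d. p z j) = 1 - p z ?N" "0 < p z ?N"
      using p V(2) by (auto simp: n_def)
    moreover have "return_weight d V p z \<le> (\<Sum>j=1..2*d. ennreal (p z j))"
      using sub by (intro return_weight_le) (simp add: en)
    moreover have "0 \<le> (\<Sum>j=1..2*d. p z j)" using nn V by (intro sum_nonneg) auto
    ultimately show "green_power d V s p z \<le> ennreal (p z ?N powr (- s))"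
      using s V by (intro green_power_le) (auto simp: en)
  qed
  also have "\<dots> = (\<integral>\<^sup>+p. (\<Prod>y\<in>V. if y = z then ennreal (p y ?N powr (- s)) else 1) \<partial>dirichlet_prod V n ?b)"
    using V by (intro nn_integral_cong) auto
  also have "\<dots> = (\<Prod>y\<in>V. \<integral>\<^sup>+x. (if y = z then ennreal (x ?N powr (- s)) else 1) \<partial>dirichlet (n y) (?b y))"
  proof (intro nn_integral_dirichlet_prod n b V)
    fix y
    show "(\<lambda>x. if y = z then ennreal (x ?N powr (- s)) else 1) \<in> borel_measurable (dirichlet (n y) (?b y))"
      by (cases "y = z") (auto simp: n_def)
  qed
  also have "\<dots> = (\<Prod>y\<in>V. if y = z then \<integral>\<^sup>+x. ennreal (x ?N powr (- s)) \<partial>dirichlet (n z) (?b z) else 1)"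
    using prob_space.emeasure_space_1[OF prob_space_dirichlet[OF n(1) b]] by (intro prod.cong) auto
  also have "\<dots> = (\<integral>\<^sup>+x. ennreal (x ?N powr (- s)) \<partial>dirichlet (n z) (?b z))"
    using V by simp
  also have "\<dots> = ennreal (Gamma (\<gamma> - s) * Gamma (\<Sum>j=1..2*d. a z j) / (Gamma \<gamma> * Gamma ((\<Sum>j=1..2*d. a z j) - s)))"
  proof -
    have "(\<Sum>j\<in>{1..n z}. ?b z j) = (\<Sum>j=1..2*d. a z j)"
      using balance[OF V(2)] by (auto simp: n_def reversed_weights_def)
    moreover have "?b z ?N = \<gamma>" by (simp add: reversed_weights_def)
    ultimately show ?thesis
      using dirichlet_moment_single[of "n z" "?b z" ?N "- s"] n(1)[of z] b[of z] s by (simp add: n_def)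
  qed
  finally show ?thesis .
qed

subsection \<open>Change of measure\<close>

lemma Polygamma_1_nonneg: "0 < x \<Longrightarrow> 0 \<le> Polygamma 1 (x::real)"
  using nonpos_Ints_nonpos[of x] by (intro less_imp_le Polygamma_real_odd_pos) (auto simp: not_le[symmetric])

text \<open>The weights \<open>1 / (b - 1)\<close> and 1 compensate the displacements
  \<open>(b - 1) * u\<close> and \<open>- u\<close>, so that the derivative at \<open>u = 0\<close>
  vanishes. What remains is a variation of \<open>Digamma\<close>; as \<open>Polygamma 1\<close>
  decreases, it is controlled by its value at \<open>e * a\<close>, a lower bound for all
  arguments.\<close>

lemma ln_Gamma_second_order:
  fixes a b e u :: real
  assumes a: "0 < a" and b: "1 < b" and e: "0 < e" and u: "0 \<le> u" "u \<le> (1 - e) * a"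
  shows "ln_Gamma (a + (b - 1) * u) / (b - 1) + ln_Gamma (a - u) \<le>
    ln_Gamma a / (b - 1) + ln_Gamma a + b * Polygamma 1 (e * a) * u\<^sup>2"
proof (cases "u = 0")
  case False
  with u have u0: "0 < u" by simp
  have ea: "0 < e * a" using a e by simp
  have pos: "0 < a + (b - 1) * v" "e * a \<le> a - v" if "0 \<le> v" "v \<le> u" for v
  proof -
    show "0 < a + (b - 1) * v" using that a b by (intro add_pos_nonneg mult_nonneg_nonneg) auto
    show "e * a \<le> a - v" using that u by (simp add: algebra_simps)
  qed
  define h where "h v = ln_Gamma (a + (b - 1) * v) / (b - 1) + ln_Gamma (a - v)" for v
  have "(h has_real_derivative (Digamma (a + (b - 1) * v) - Digamma (a - v))) (at v)"
    if "0 \<le> v" "v \<le> u" for v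
    using pos[OF that] ea b unfolding h_def
    by (auto intro!: derivative_eq_intros)
  then obtain v where v: "0 < v" "v < u" "h u - h 0 = (u - 0) * (Digamma (a + (b - 1) * v) - Digamma (a - v))"
    using MVT2[OF u0, of h "\<lambda>v. Digamma (a + (b - 1) * v) - Digamma (a - v)"] by auto
  have lt: "a - v < a + (b - 1) * v" using b v by (simp add: algebra_simps)
  have "(Digamma has_real_derivative Polygamma 1 w) (at w)" if "a - v \<le> w" "w \<le> a + (b - 1) * v" for w
  proof -
    have "0 < w" using that pos(2)[of v] v ea by simp
    then have "w \<notin> \<int>\<^sub>\<le>\<^sub>0" using nonpos_Ints_nonpos[of w] by (meson not_le)
    then show ?thesis using has_field_derivative_Polygamma[of w 0 UNIV] by (simp add: One_nat_def)
  qed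
  \<comment> \<open>The two arguments of \<open>Digamma\<close> differ by \<open>b * v\<close>; this
    supplies the second factor of order \<open>u\<close>.\<close>
  then obtain w where w: "a - v < w" "w < a + (b - 1) * v"
      "Digamma (a + (b - 1) * v) - Digamma (a - v) = (a + (b - 1) * v - (a - v)) * Polygamma 1 w"
    using MVT2[OF lt, of Digamma "Polygamma 1"] by auto
  have "Polygamma 1 w \<le> Polygamma 1 (e * a)"
    using w(1) pos(2)[of v] v ea by (intro less_imp_le[OF Polygamma_real_strict_antimono]) auto
  moreover have "0 \<le> b * v" using b v by simp
  ultimately have "Digamma (a + (b - 1) * v) - Digamma (a - v) \<le> b * v * Polygamma 1 (e * a)"
  proof -
    have "a + (b - 1) * v - (a - v) = b * v" by (simp add: algebra_simps)
    then show ?thesis unfolding w(3) using \<open>0 \<le> b * v\<close> \<open>Polygamma 1 w \<le> _\<close> by (simp only: mult_left_mono)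
  qed
  also have "\<dots> \<le> b * u * Polygamma 1 (e * a)"
    using v b Polygamma_1_nonneg[OF ea] by (intro mult_right_mono mult_left_mono) auto
  finally have "h u - h 0 \<le> u * (b * u * Polygamma 1 (e * a))"
    unfolding v(3) using u0 by (simp add: mult_left_mono)
  then show ?thesis by (simp add: h_def power2_eq_square mult_ac)
qed simp

text \<open>\<open>A\<close> is the mean of \<open>A + (b - 1) * U\<close> and \<open>A - U\<close>
  with weights \<open>1 / b\<close> and \<open>(b - 1) / b\<close>. The totals of the parameters
  enter the cost of the tilt with the opposite sign to the single edges, so that for them convexity
  of \<open>ln \<circ> Gamma\<close> suffices, without any second order term.\<close>

lemma ln_Gamma_convex_combination:
  fixes A b U :: real
  assumes "0 < A" "0 < A - U" "0 < A + (b - 1) * U" "1 < b"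
  shows "ln_Gamma A / (b - 1) + ln_Gamma A \<le> ln_Gamma (A + (b - 1) * U) / (b - 1) + ln_Gamma (A - U)"
proof -
  have cv: "convex_on {0<..} (ln \<circ> Gamma :: real \<Rightarrow> real)" by (rule log_convex_Gamma_real)
  define t where "t = (b - 1) / b"
  have t: "0 \<le> t" "t \<le> 1" "1 - t = 1 / b" using assms by (auto simp: t_def field_simps)
  have A: "(1 - t) * (A + (b - 1) * U) + t * (A - U) = A"
    using assms by (simp add: t_def field_simps)
  have "ln (Gamma A) \<le> (1 - t) * ln (Gamma (A + (b - 1) * U)) + t * ln (Gamma (A - U))"
   using convex_onD[OF cv t(1,2), of "A + (b - 1) * U" "A - U"] assms by (simp add: A)
  then have "b * ln (Gamma A) \<le> ln (Gamma (A + (b - 1) * U)) + (b - 1) * ln (Gamma (A - U))"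
    unfolding t(3) using assms by (simp add: t_def field_simps)
  moreover have "x / (b - 1) + x \<le> y / (b - 1) + w" if "b * x \<le> y + (b - 1) * w" for x y w
  proof -
    have "x / (b - 1) + x = b * x / (b - 1)" using assms by (simp add: field_simps)
    also have "\<dots> \<le> (y + (b - 1) * w) / (b - 1)" using that assms by (intro divide_right_mono) auto
    also have "\<dots> = y / (b - 1) + w" using assms by (simp add: add_divide_distrib)
    finally show ?thesis .
  qed
  ultimately show ?thesis using assms by (simp add: ln_Gamma_real_pos)
qed

text \<open>The density of \<open>dirichlet n a\<close> with respect to
  \<open>dirichlet n b\<close>, in this order.\<close>

definition site_density :: "nat \<Rightarrow> (nat \<Rightarrow> real) \<Rightarrow> (nat \<Rightarrow> real) \<Rightarrow> (nat \<Rightarrow> real) \<Rightarrow> real" where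
  "site_density n a b x = dirichlet_const n b / dirichlet_const n a * (\<Prod>i=1..n. x i powr (a i - b i))"

lemma measurable_site_density [measurable]: "site_density n a b \<in> borel_measurable (dirichlet n c)"
  unfolding site_density_def by measurable

lemma site_density_nonneg:
  assumes "1 \<le> n" "\<forall>i\<in>{1..n}. 0 < a i" "\<forall>i\<in>{1..n}. 0 < b i"
  shows "0 \<le> site_density n a b x"
  unfolding site_density_def using assms dirichlet_const_pos[of n a] dirichlet_const_pos[of n b]
  by (intro mult_nonneg_nonneg divide_nonneg_nonneg prod_nonneg) auto

lemma dirichlet_site_density:
  assumes "1 \<le> n" "\<forall>i\<in>{1..n}. 0 < a i" "\<forall>i\<in>{1..n}. 0 < b i"
  shows "dirichlet n a = density (dirichlet n b) (\<lambda>x. ennreal (site_density n a b x))"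
  unfolding dirichlet_change[OF assms] site_density_def
  using dirichlet_const_pos[OF assms(1,2)] dirichlet_const_pos[OF assms(1,3)]
  by (intro density_cong) (auto simp: ennreal_mult'[symmetric] prod_ennreal)

lemma dirichlet_prod_change:
  assumes n: "\<And>y. 1 \<le> n y" and a: "\<And>y. \<forall>j\<in>{1..n y}. 0 < a y j" and b: "\<And>y. \<forall>j\<in>{1..n y}. 0 < b y j"
    and V: "finite V"
  shows "dirichlet_prod V n a = density (dirichlet_prod V n b) (\<lambda>p. \<Prod>y\<in>V. ennreal (site_density (n y) (a y) (b y) (p y)))"
proof -
  let ?D = "\<lambda>y x. ennreal (site_density (n y) (a y) (b y) x)"
  interpret A: product_sigma_finite "\<lambda>y. dirichlet (n y) (a y)"
    by (rule product_sigma_finite_dirichlet[OF n a])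
  have sp: "sets (dirichlet_prod V n b) = sets (PiM V (\<lambda>y. dirichlet (n y) (a y)))"
    using sets_dirichlet_prod[of V n a] by (simp add: sets_dirichlet_prod dirichlet_prod_def[of V n a])
  have D[measurable]: "(\<lambda>p. \<Prod>y\<in>V. ?D y (p y)) \<in> borel_measurable (dirichlet_prod V n b)"
  proof (intro borel_measurable_prod_ennreal measurable_compose[OF _ measurable_ennreal])
    fix y assume y: "y \<in> V"
    have "(\<lambda>p. p y) \<in> dirichlet_prod V n b \<rightarrow>\<^sub>M dirichlet (n y) (b y)"
      unfolding dirichlet_prod_def by (rule measurable_component_singleton[OF y])
    from measurable_compose[OF this measurable_site_density]
    show "(\<lambda>p. site_density (n y) (a y) (b y) (p y)) \<in> borel_measurable (dirichlet_prod V n b)" .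
  qed
  have "density (dirichlet_prod V n b) (\<lambda>p. \<Prod>y\<in>V. ?D y (p y)) = PiM V (\<lambda>y. dirichlet (n y) (a y))"
  proof (rule A.PiM_eqI[OF V])
    show "sets (density (dirichlet_prod V n b) (\<lambda>p. \<Prod>y\<in>V. ?D y (p y))) = sets (PiM V (\<lambda>y. dirichlet (n y) (a y)))"
      by (simp add: sp)
  next
    fix X assume X: "\<And>y. y \<in> V \<Longrightarrow> X y \<in> sets (dirichlet (n y) (a y))"
    have Xb: "X y \<in> sets (dirichlet (n y) (b y))" if "y \<in> V" for y
      using X[OF that] by (simp add: sets_dirichlet)
    have PX: "Pi\<^sub>E V X \<in> sets (dirichlet_prod V n b)"
      unfolding sp using X V by (intro sets_PiM_I_finite) auto
    have "emeasure (density (dirichlet_prod V n b) (\<lambda>p. \<Prod>y\<in>V. ?D y (p y))) (Pi\<^sub>E V X) =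
        (\<integral>\<^sup>+p. (\<Prod>y\<in>V. ?D y (p y)) * indicator (Pi\<^sub>E V X) p \<partial>dirichlet_prod V n b)"
      by (rule emeasure_density[OF D PX])
    also have "\<dots> = (\<integral>\<^sup>+p. (\<Prod>y\<in>V. ?D y (p y) * indicator (X y) (p y)) \<partial>dirichlet_prod V n b)"
    proof (rule nn_integral_cong)
      fix p assume "p \<in> space (dirichlet_prod V n b)"
      then have "p \<in> extensional V" by (auto simp: dirichlet_prod_def space_PiM PiE_def)
      then have "indicator (Pi\<^sub>E V X) p = (\<Prod>y\<in>V. indicator (X y) (p y) :: ennreal)"
        using V by (auto simp: indicator_def PiE_def Pi_def prod_zero_iff)
      then show "(\<Prod>y\<in>V. ?D y (p y)) * indicator (Pi\<^sub>E V X) p = (\<Prod>y\<in>V. ?D y (p y) * indicator (X y) (p y))"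
        by (simp add: prod.distrib)
    qed
    also have "\<dots> = (\<Prod>y\<in>V. \<integral>\<^sup>+x. ?D y x * indicator (X y) x \<partial>dirichlet (n y) (b y))"
      using Xb by (intro nn_integral_dirichlet_prod n b V borel_measurable_times_ennreal borel_measurable_indicator) auto
    also have "\<dots> = (\<Prod>y\<in>V. emeasure (dirichlet (n y) (a y)) (X y))"
      using Xb by (intro prod.cong refl) (subst dirichlet_site_density[OF n a b], subst emeasure_density, auto)
    finally show "emeasure (density (dirichlet_prod V n b) (\<lambda>p. \<Prod>y\<in>V. ?D y (p y))) (Pi\<^sub>E V X) =
        (\<Prod>y\<in>V. emeasure (dirichlet (n y) (a y)) (X y))" .
  qed
  then show ?thesis by (simp add: dirichlet_prod_def)
qed

lemma borel_measurable_nn_integral_count_space: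
  fixes f :: "'i::countable \<Rightarrow> 'a \<Rightarrow> ennreal"
  assumes "\<And>i. i \<in> I \<Longrightarrow> f i \<in> borel_measurable M"
  shows "(\<lambda>x. \<integral>\<^sup>+i. f i x \<partial>count_space I) \<in> borel_measurable M"
proof -
  \<comment> \<open>Several naturals may decode to the same index; the condition that
    \<open>to_nat (from_nat n)\<close> be \<open>n\<close> counts each index once.\<close>
  have "(\<integral>\<^sup>+i. f i x \<partial>count_space I) = (\<Sum>n. if from_nat n \<in> I \<and> to_nat (from_nat n :: 'i) = n then f (from_nat n) x else 0)" for x
  proof -
    have im: "n \<in> to_nat ` I \<longleftrightarrow> from_nat n \<in> I \<and> to_nat (from_nat n :: 'i) = n" for n by force
    have "(\<integral>\<^sup>+i. f i x \<partial>count_space I) = (\<integral>\<^sup>+i. f (from_nat (to_nat i)) x \<partial>count_space I)" by simp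
    also have "\<dots> = (\<integral>\<^sup>+n. f (from_nat n) x \<partial>count_space (to_nat ` I))"
      by (rule nn_integral_bij_count_space) (auto simp: bij_betw_def inj_on_def)
    also have "\<dots> = (\<integral>\<^sup>+n. (if from_nat n \<in> I \<and> to_nat (from_nat n :: 'i) = n then f (from_nat n) x else 0) \<partial>count_space UNIV)"
      by (subst nn_integral_count_space_indicator) (auto intro!: nn_integral_cong simp: indicator_def im)
    finally show ?thesis by (simp add: nn_integral_count_space_nat)
  qed
  moreover have "(\<lambda>x. if from_nat n \<in> I \<and> to_nat (from_nat n :: 'i) = n then f (from_nat n) x else 0)
      \<in> borel_measurable M" for n
  proof (cases "from_nat n \<in> I \<and> to_nat (from_nat n :: 'i) = n")
    case True
    then show ?thesis unfolding if_P[OF True] using assms by simp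
  next
    case False
    show ?thesis unfolding if_not_P[OF False] by simp
  qed
  ultimately show ?thesis by simp
qed

lemma measurable_green_power:
  assumes "V \<subseteq> W" "\<And>y. 2*d \<le> n y"
  shows "(\<lambda>p. green_power d V s p z) \<in> borel_measurable (dirichlet_prod W n a)"
  unfolding green_power_def
  using measurable_loop_prod[OF subsetD[OF lists_mono[OF loops_mono[OF assms(1)]]] assms(2)]
  by (intro borel_measurable_nn_integral_count_space borel_measurable_times_ennreal) auto

text \<open>At \<open>y = x powr (b - 1)\<close> the product and both powers coincide, which
  suggests the case distinction. Young's inequality is preferred to Hoelder's because the resulting
  sum of two moments can be bounded term by term, uniformly in \<open>V\<close>; the sharp constants
  are irrelevant for this.\<close>

lemma Young_crude:
  fixes x y b :: real
  assumes "0 \<le> x" "0 \<le> y" "1 < b"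
  shows "x * y \<le> x powr b + y powr (b / (b - 1))"
proof (cases "y \<le> x powr (b - 1)")
  case True
  then have "x * y \<le> x * x powr (b - 1)" using assms by (intro mult_left_mono)
  also have "\<dots> = x powr b" using assms by (simp add: powr_mult_base)
  finally show ?thesis by (simp add: add_increasing2)
next
  case False
  then have "x = (x powr (b - 1)) powr (1 / (b - 1))" using assms by (simp add: powr_powr)
  also have "\<dots> \<le> y powr (1 / (b - 1))" using False assms by (intro powr_mono2) auto
  finally have "x * y \<le> y powr (1 / (b - 1)) * y" using assms by (intro mult_right_mono)
  also have "\<dots> = y powr (b / (b - 1))"
    using assms powr_mult_base[of y "1 / (b - 1)"] by (simp add: field_simps)
  finally show ?thesis by (simp add: add_increasing)
qed

lemma ennpowr_ennpowr: "0 < s \<Longrightarrow> 0 < b \<Longrightarrow> ennpowr (ennpowr x s) b = ennpowr x (s * b)"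
  by (auto simp: ennpowr_def powr_powr)

lemma Young_crude_ennreal:
  assumes "0 \<le> y" "1 < b"
  shows "x * ennreal y \<le> ennpowr x b + ennreal (y powr (b / (b - 1)))"
proof (cases x)
  case (real r)
  then show ?thesis
    using Young_crude[of r y b] assms
    by (simp add: ennpowr_ennreal ennreal_mult'[symmetric] ennreal_plus[symmetric] del: ennreal_plus)
qed (simp add: ennpowr_def)

text \<open>The moment of order \<open>b / (b - 1)\<close> of the density. The density has the
  exponents \<open>- (b - 1) * t j\<close>, its power has \<open>- b * t j\<close>, and these turn
  the tilted parameters \<open>a j + (b - 1) * t j\<close> into \<open>a j - t j\<close>.\<close>

definition site_factor :: "nat \<Rightarrow> real \<Rightarrow> (nat \<Rightarrow> real) \<Rightarrow> (nat \<Rightarrow> real) \<Rightarrow> real" where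
  "site_factor n b a t = (dirichlet_const n (\<lambda>j. a j + (b - 1) * t j) / dirichlet_const n a) powr (b / (b - 1)) *
     (dirichlet_const n (\<lambda>j. a j - t j) / dirichlet_const n (\<lambda>j. a j + (b - 1) * t j))"

lemma site_density_powr:
  assumes "1 \<le> n" "\<forall>i\<in>{1..n}. 0 < a i" "\<forall>i\<in>{1..n}. 0 \<le> t i" "1 < b" "\<forall>i\<in>{1..n}. 0 < x i"
  shows "site_density n a (\<lambda>j. a j + (b - 1) * t j) x powr (b / (b - 1)) =
    (dirichlet_const n (\<lambda>j. a j + (b - 1) * t j) / dirichlet_const n a) powr (b / (b - 1)) * (\<Prod>i=1..n. x i powr (- b * t i))"
proof -
  have "0 < dirichlet_const n a" "0 < dirichlet_const n (\<lambda>j. a j + (b - 1) * t j)"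
    using assms by (auto intro!: dirichlet_const_pos add_pos_nonneg)
  then have C: "0 \<le> dirichlet_const n (\<lambda>j. a j + (b - 1) * t j) / dirichlet_const n a" by simp
  have "(\<Prod>i=1..n. x i powr (a i - (a i + (b - 1) * t i))) powr (b / (b - 1)) = (\<Prod>i=1..n. x i powr (- b * t i))"
    unfolding prod_powr_distrib using assms(4) by (auto simp: powr_powr mult.commute intro!: prod.cong)
  then show ?thesis
    unfolding site_density_def using C by (subst powr_mult) (auto intro: prod_nonneg)
qed

lemma nn_integral_site_density_powr:
  assumes "1 \<le> n" "\<forall>i\<in>{1..n}. 0 < a i" "\<forall>i\<in>{1..n}. 0 \<le> t i" "1 < b" "\<forall>i\<in>{1..n}. t i < a i"
  shows "(\<integral>\<^sup>+x. ennreal (site_density n a (\<lambda>j. a j + (b - 1) * t j) x powr (b / (b - 1))) \<partial>dirichlet n (\<lambda>j. a j + (b - 1) * t j)) =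
    ennreal (site_factor n b a t)"
proof -
  let ?a' = "\<lambda>j. a j + (b - 1) * t j" and ?q = "b / (b - 1)"
  let ?C = "(dirichlet_const n ?a' / dirichlet_const n a) powr ?q"
  have a': "\<forall>i\<in>{1..n}. 0 < ?a' i" using assms by (auto intro!: add_pos_nonneg)
  have "(\<integral>\<^sup>+x. ennreal (site_density n a ?a' x powr ?q) \<partial>dirichlet n ?a') =
      (\<integral>\<^sup>+x. ennreal ?C * (\<Prod>i=1..n. ennreal (x i powr (- b * t i))) \<partial>dirichlet n ?a')"
  proof (rule nn_integral_cong_AE, use AE_dirichlet[OF assms(1) a'] in eventually_elim)
    fix x :: "nat \<Rightarrow> real" assume x: "(\<forall>i\<in>{1..n}. 0 < x i) \<and> sum x {1..n} = 1"
    show "ennreal (site_density n a ?a' x powr ?q) = ennreal ?C * (\<Prod>i=1..n. ennreal (x i powr (- b * t i)))"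
      using x by (subst site_density_powr[OF assms(1-4)]) (auto simp: ennreal_mult' prod_ennreal)
  qed
  also have "\<dots> = ennreal ?C * ennreal (dirichlet_const n (\<lambda>i. ?a' i + - b * t i) / dirichlet_const n ?a')"
    using assms a' by (subst nn_integral_cmult, measurable, subst dirichlet_moment) (auto simp: algebra_simps)
  also have "(\<lambda>i. ?a' i + - b * t i) = (\<lambda>i. a i - t i)" by (simp add: algebra_simps)
  finally show ?thesis unfolding site_factor_def by (simp add: ennreal_mult'[symmetric])
qed

lemma ln_dirichlet_const:
  assumes "1 \<le> n" "\<forall>i\<in>{1..n}. 0 < a i"
  shows "ln (dirichlet_const n a) = (\<Sum>i=1..n. ln_Gamma (a i)) - ln_Gamma (\<Sum>i=1..n. a i)"
proof -
  have g: "0 < Gamma (a i)" if "i \<in> {1..n}" for i using assms that by (intro Gamma_real_pos) auto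
  have "0 < (\<Sum>i=1..n. a i)" using assms by (intro sum_pos) auto
  then have "ln (dirichlet_const n a) = ln (\<Prod>i=1..n. Gamma (a i)) - ln_Gamma (\<Sum>i=1..n. a i)"
  proof -
    assume S: "0 < (\<Sum>i=1..n. a i)"
    have ld: "ln (x / y) = ln x - ln y" if "0 < x" "0 < y" for x y :: real
      using that by (simp add: ln_div)
    have "0 < (\<Prod>i=1..n. Gamma (a i))" using g by (rule prod_pos)
    then show ?thesis
      unfolding dirichlet_const_def ln_Gamma_real_pos[OF S] using Gamma_real_pos[OF S] by (rule ld)
  qed
  also have "ln (\<Prod>i=1..n. Gamma (a i)) = (\<Sum>i=1..n. ln (Gamma (a i)))"
    by (intro ln_prod less_imp_neq[OF g, symmetric]) simp_all
  also have "\<dots> = (\<Sum>i=1..n. ln_Gamma (a i))"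
    using assms by (intro sum.cong) (auto simp: ln_Gamma_real_pos)
  finally show ?thesis .
qed

text \<open>The logarithm splits into terms for the single edges, which are of second order in
  \<open>t\<close>, and one term for the totals, which is at most 0. Multiplied over the sites, the
  bounds give the exponential of the energy of the flow.\<close>

lemma site_factor_le:
  assumes n: "1 \<le> n" and a: "\<forall>i\<in>{1..n}. 0 < a i" and t: "\<forall>i\<in>{1..n}. 0 \<le> t i \<and> t i \<le> (1 - e) * a i"
    and b: "1 < b" and e: "0 < e"
  shows "site_factor n b a t \<le> exp ((\<Sum>i=1..n. b * Polygamma 1 (e * a i)) * (\<Sum>i=1..n. (t i)\<^sup>2))"
proof -
  let ?a' = "\<lambda>j. a j + (b - 1) * t j" and ?am = "\<lambda>j. a j - t j" and ?q = "b / (b - 1)"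
  let ?c = "dirichlet_const n" and ?J = "{1..n}"
  have lt: "t i < a i" if "i \<in> ?J" for i
  proof -
    have "(1 - e) * a i < 1 * a i" using a e that by (intro mult_strict_right_mono) auto
    with t that show ?thesis by fastforce
  qed
  have a': "\<forall>i\<in>?J. 0 < ?a' i" using a t b by (auto intro!: add_pos_nonneg)
  have am: "\<forall>i\<in>?J. 0 < ?am i" using lt by auto
  have pos: "0 < ?c a" "0 < ?c ?a'" "0 < ?c ?am"
    using dirichlet_const_pos[OF n] a a' am by auto
  have sa: "0 < sum a ?J" "0 < sum ?a' ?J" "0 < sum ?am ?J" using n a a' am by (auto intro!: sum_pos)
  define L where "L v = (\<Sum>i\<in>?J. ln_Gamma (v i :: real))" for v
  define l where "l v = ln_Gamma (sum v ?J :: real)" for v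
  have q: "?q = 1 / (b - 1) + 1" using b by (simp add: field_simps)
  have "ln (site_factor n b a t) = ?q * (ln (?c ?a') - ln (?c a)) + (ln (?c ?am) - ln (?c ?a'))"
    using pos unfolding site_factor_def by (subst ln_mult) (auto simp: ln_powr ln_div)
  also have "\<dots> = (L ?a' / (b - 1) + L ?am - (L a / (b - 1) + L a)) + ((l a / (b - 1) + l a) - (l ?a' / (b - 1) + l ?am))"
    unfolding ln_dirichlet_const[OF n a] ln_dirichlet_const[OF n a'] ln_dirichlet_const[OF n am] L_def[symmetric] l_def[symmetric] q
    by (simp add: algebra_simps diff_divide_distrib add_divide_distrib)
  also have "(l a / (b - 1) + l a) - (l ?a' / (b - 1) + l ?am) \<le> 0"
    using ln_Gamma_convex_combination[of "sum a ?J" "sum t ?J" b] sa b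
    by (simp add: l_def sum.distrib sum_subtractf sum_distrib_left[symmetric])
  also have "L ?a' / (b - 1) + L ?am - (L a / (b - 1) + L a) =
     (\<Sum>i\<in>?J. (ln_Gamma (?a' i) / (b - 1) + ln_Gamma (?am i)) - (ln_Gamma (a i) / (b - 1) + ln_Gamma (a i)))"
    by (simp add: L_def sum_divide_distrib sum.distrib sum_subtractf)
  also have "\<dots> \<le> (\<Sum>i\<in>?J. b * Polygamma 1 (e * a i) * (t i)\<^sup>2)"
  proof (rule sum_mono)
    fix i assume i: "i \<in> ?J"
    then have "0 < a i" "0 \<le> t i" "t i \<le> (1 - e) * a i" using a t by auto
    from ln_Gamma_second_order[OF this(1) b e this(2,3)] show
      "ln_Gamma (?a' i) / (b - 1) + ln_Gamma (?am i) - (ln_Gamma (a i) / (b - 1) + ln_Gamma (a i)) \<le> b * Polygamma 1 (e * a i) * (t i)\<^sup>2"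
      by simp
  qed
  \<comment> \<open>Bounding each square by the sum of all squares separates a constant depending
    only on \<open>a\<close>, \<open>b\<close> and \<open>e\<close> from the energy.\<close>
  also have "\<dots> \<le> (\<Sum>i\<in>?J. b * Polygamma 1 (e * a i) * (\<Sum>i\<in>?J. (t i)\<^sup>2))"
  proof (intro sum_mono mult_left_mono)
    fix i assume i: "i \<in> ?J"
    then show "(t i)\<^sup>2 \<le> (\<Sum>i\<in>?J. (t i)\<^sup>2)" by (intro member_le_sum) auto
    have "e * a i > 0" using i a e by auto
    then show "0 \<le> b * Polygamma 1 (e * a i)"
      using b Polygamma_1_nonneg[of "e * a i"] by simp
  qed
  finally have "ln (site_factor n b a t) \<le> (\<Sum>i\<in>?J. b * Polygamma 1 (e * a i)) * (\<Sum>i\<in>?J. (t i)\<^sup>2)"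
    by (simp add: sum_distrib_right)
  moreover have "0 < site_factor n b a t" using pos by (simp add: site_factor_def)
  ultimately show ?thesis by (simp add: ln_le_cancel_iff[symmetric] ln_ge_iff)
qed

text \<open>At the base point, one direction carries a large flow, but there the walk is restricted to
  the event that this direction has a transition probability bounded below.\<close>

lemma nn_integral_site_density_powr_restricted:
  assumes n: "1 \<le> n" and a: "\<forall>j\<in>{1..n}. 0 < a j" and t: "\<forall>j\<in>{1..n}. 0 \<le> t j" and b: "1 < b"
    and lt: "\<forall>j\<in>{1..n} - {i}. t j < a j" and c: "0 < c" and i: "i \<in> {1..n}"
  shows "\<exists>M. (\<integral>\<^sup>+x. indicator {x. c \<le> x i} x * ennreal (site_density n a (\<lambda>j. a j + (b - 1) * t j) x powr (b / (b - 1)))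
      \<partial>dirichlet n (\<lambda>j. a j + (b - 1) * t j)) \<le> ennreal M"
proof -
  let ?a' = "\<lambda>j. a j + (b - 1) * t j" and ?q = "b / (b - 1)"
  let ?C = "(dirichlet_const n ?a' / dirichlet_const n a) powr ?q * c powr (- b * t i)"
  \<comment> \<open>The exponent at \<open>i\<close> is left out, since
    \<open>x i powr (- b * t i)\<close> is at most its value at \<open>c\<close>. The parameter at
    \<open>i\<close> then remains \<open>a i + (b - 1) * t i\<close>, which is positive however
    large \<open>t i\<close> is.\<close>
  define u where "u j = (if j = i then 0 else - b * t j)" for j
  have a': "\<forall>i\<in>{1..n}. 0 < ?a' i" using a t b by (auto intro!: add_pos_nonneg)
  have "(\<integral>\<^sup>+x. indicator {x. c \<le> x i} x * ennreal (site_density n a ?a' x powr ?q) \<partial>dirichlet n ?a') \<le>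
      (\<integral>\<^sup>+x. ennreal ?C * (\<Prod>j=1..n. ennreal (x j powr u j)) \<partial>dirichlet n ?a')"
  proof (rule nn_integral_mono_AE, use AE_dirichlet[OF n a'] in eventually_elim)
    fix x :: "nat \<Rightarrow> real" assume "(\<forall>i\<in>{1..n}. 0 < x i) \<and> sum x {1..n} = 1"
    then have x: "\<forall>i\<in>{1..n}. 0 < x i" by simp
    show "indicator {x. c \<le> x i} x * ennreal (site_density n a ?a' x powr ?q) \<le> ennreal ?C * (\<Prod>j=1..n. ennreal (x j powr u j))"
    proof (cases "c \<le> x i")
      case True
      have "(\<Prod>j=1..n. x j powr (- b * t j)) \<le> (\<Prod>j=1..n. (if j = i then c powr (- b * t i) else 1) * x j powr u j)"
      proof (rule prod_mono, intro conjI)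
        fix j assume j: "j \<in> {1..n}"
        have "x j \<noteq> 0" using x j by force
        moreover have "x i powr (- b * t i) \<le> c powr (- b * t i)" if "i = j"
          using that True c b t j by (intro powr_mono2') auto
        ultimately show "x j powr (- b * t j) \<le> (if j = i then c powr (- b * t i) else 1) * x j powr u j"
          by (auto simp: u_def)
      qed auto
      also have "\<dots> = (\<Prod>j=1..n. (if j = i then c powr (- b * t i) else 1)) * (\<Prod>j=1..n. x j powr u j)"
        by (rule prod.distrib)
      also have "\<dots> = c powr (- b * t i) * (\<Prod>j=1..n. x j powr u j)"
        using i by simp
      finally have "site_density n a ?a' x powr ?q \<le> ?C * (\<Prod>j=1..n. x j powr u j)"
        by (subst site_density_powr[OF n a t b x]) (simp add: mult.assoc mult_left_mono)
      then show ?thesis using True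
        by (simp add: prod_ennreal ennreal_mult'[symmetric] prod_nonneg del: ennreal_mult')
    qed simp
  qed
  also have "\<dots> = ennreal ?C * ennreal (dirichlet_const n (\<lambda>i. ?a' i + u i) / dirichlet_const n ?a')"
  proof (subst nn_integral_cmult, measurable, subst dirichlet_moment[OF n a'])
    show "\<forall>j\<in>{1..n}. 0 < ?a' j + u j"
      using a' lt by (auto simp: u_def algebra_simps)
  qed simp
  finally show ?thesis by (auto simp: ennreal_mult'[symmetric])
qed


section \<open>Tilting constant parameters along a flow\<close>

text \<open>The edge entering \<open>y\<close> from \<open>neighbour d y j\<close> has direction \<open>opposite d j\<close>.\<close>

definition inflow :: "nat \<Rightarrow> (site \<Rightarrow> nat \<Rightarrow> real) \<Rightarrow> site \<Rightarrow> real" where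
  "inflow d t y = (\<Sum>j=1..2*d. t (neighbour d y j) (opposite d j))"

definition outflow :: "nat \<Rightarrow> (site \<Rightarrow> nat \<Rightarrow> real) \<Rightarrow> site \<Rightarrow> real" where
  "outflow d t y = (\<Sum>j=1..2*d. t y j)"

lemma bij_opposite: "bij_betw (opposite d) {1..2*d} {1..2*d}"
  by (rule bij_betwI[where g="opposite d"]) (use opposite_in in \<open>auto simp: opposite_opposite\<close>)

text \<open>Under the tilted parameters the excess at \<open>z\<close> is
  \<open>(b - 1) * g\<close>, so that reversal bounds the moment of order \<open>s * b\<close>.
  Young's inequality then leaves the moment of the density: the restriction to the event controls it
  at \<open>z\<close>, and the energy controls it at the other sites.\<close>

theorem green_power_restricted_bound:
  fixes a :: "nat \<Rightarrow> real" and t :: "site \<Rightarrow> nat \<Rightarrow> real"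
  assumes d: "1 \<le> d" and a: "\<forall>j\<in>{1..2*d}. 0 < a j" and t: "\<And>y j. 0 \<le> t y j"
    and balance: "\<And>y. outflow d t y = inflow d t y + (if y = z then g else 0)"
    and cap: "\<And>y j. j \<in> {1..2*d} \<Longrightarrow> (y, j) \<noteq> (z, i) \<Longrightarrow> t y j \<le> (1 - e) * a j"
    and energy: "\<And>V. finite V \<Longrightarrow> (\<Sum>y\<in>V. \<Sum>j=1..2*d. (t y j)\<^sup>2) \<le> K"
    and e: "0 < e" and i: "i \<in> {1..2*d}" and s: "0 < s" "s < g" and c: "0 < c"
  shows "\<exists>M. \<forall>V. finite V \<longrightarrow> z \<in> V \<longrightarrow>
    (\<integral>\<^sup>+p. indicator {p. c \<le> p z i} p * green_power d V s p z \<partial>dirichlet_prod V (\<lambda>_. 2*d) (\<lambda>_. a)) \<le> ennreal M"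
proof -
  let ?n = "2*d"
  \<comment> \<open>Every \<open>b > g / (g - s)\<close> gives \<open>s * b < (b - 1) * g\<close>.
    With twice this value the difference is exactly \<open>g\<close>.\<close>
  define b where "b = 2 * g / (g - s)"
  have b: "1 < b" "s * b < (b - 1) * g"
  proof -
    have bg: "b * (g - s) = 2 * g" using s by (simp add: b_def)
    show "1 < b" using s by (simp add: b_def)
    have "(b - 1) * g - s * b = g" using bg by (simp add: algebra_simps)
    then show "s * b < (b - 1) * g" using s by simp
  qed
  define a' where "a' y j = a j + (b - 1) * t y j" for y j
  let ?q = "b / (b - 1)"
  let ?D = "\<lambda>y. site_density ?n a (a' y)"
  let ?P = "\<lambda>V. dirichlet_prod V (\<lambda>_. ?n) (\<lambda>_. a)" and ?P' = "\<lambda>V. dirichlet_prod V (\<lambda>_. ?n) a'"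
  let ?A = "{p :: environment. c \<le> p z i}" and ?Az = "{x :: nat \<Rightarrow> real. c \<le> x i}"
  have n: "1 \<le> ?n" using d by simp
  have a': "\<forall>j\<in>{1..?n}. 0 < a' y j" for y
    using a t b by (auto simp: a'_def intro!: add_pos_nonneg)
  have lt: "t y j < a j" if "j \<in> {1..?n}" "(y, j) \<noteq> (z, i)" for y j
  proof -
    have "(1 - e) * a j < 1 * a j" using a e that by (intro mult_strict_right_mono) auto
    with cap[OF that] show ?thesis by simp
  qed
  have a'_eq: "a' y = (\<lambda>j. a j + (b - 1) * t y j)" for y by (rule ext) (simp add: a'_def)
  obtain Mz where Mz: "(\<integral>\<^sup>+x. indicator ?Az x * ennreal (?D z x powr ?q) \<partial>dirichlet ?n (a' z)) \<le> ennreal Mz"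
    using nn_integral_site_density_powr_restricted[OF n a _ b(1) _ c i, of "t z"] t lt
    unfolding a'_eq by auto
  define C where "C = (\<Sum>j=1..?n. b * Polygamma 1 (e * a j))"
  have C: "0 \<le> C" unfolding C_def
    using a e b by (intro sum_nonneg mult_nonneg_nonneg Polygamma_1_nonneg) auto
  define A where "A = (\<Sum>j=1..?n. a' z j)"
  define M1 where "M1 = Gamma ((b - 1) * g - s * b) * Gamma A / (Gamma ((b - 1) * g) * Gamma (A - s * b))"
  define M2 where "M2 = max 0 Mz * exp (C * K)"
  have "(\<integral>\<^sup>+p. indicator ?A p * green_power d V s p z \<partial>?P V) \<le> ennreal (max 0 M1 + M2)"
    if V: "finite V" "z \<in> V" for V
  proof -
    have mA: "?A \<inter> space (?P' V) \<in> sets (?P' V)"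
    proof -
      have [measurable]: "(\<lambda>p. p z i) \<in> borel_measurable (?P' V)"
        by (rule measurable_dirichlet_prod_component) (use V i in auto)
      have "{p \<in> space (?P' V). c \<le> p z i} \<in> sets (?P' V)" by measurable
      then show ?thesis by (simp add: Int_def conj_commute)
    qed
    then have [measurable]: "(indicator ?A :: _ \<Rightarrow> ennreal) \<in> borel_measurable (?P' V)"
      by (simp only: borel_measurable_indicator_iff)
    have [measurable]: "(\<lambda>p. green_power d V s p z) \<in> borel_measurable (?P' V)" for s
      by (rule measurable_green_power) simp_all
    have D[measurable]: "(\<lambda>p. ?D y (p y)) \<in> borel_measurable (?P' V)" if "y \<in> V" for y
    proof -
      have "(\<lambda>p. p y) \<in> ?P' V \<rightarrow>\<^sub>M dirichlet ?n (a' y)"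
        unfolding dirichlet_prod_def by (rule measurable_component_singleton[OF that])
      from measurable_compose[OF this measurable_site_density] show ?thesis .
    qed
    have Dnn: "0 \<le> ?D y x" for y x using n a a' by (intro site_density_nonneg) auto
    have "(\<integral>\<^sup>+p. indicator ?A p * green_power d V s p z \<partial>?P V) =
       (\<integral>\<^sup>+p. (\<Prod>y\<in>V. ennreal (?D y (p y))) * (indicator ?A p * green_power d V s p z) \<partial>?P' V)"
      unfolding dirichlet_prod_change[of "\<lambda>_. ?n" "\<lambda>_. a" a' V, OF n a a' V(1)]
      by (subst nn_integral_density) (auto intro!: borel_measurable_prod_ennreal)
    \<comment> \<open>Young's inequality with exponent \<open>b\<close>. Almost surely the return
      weight is at most 1, so that the power \<open>b\<close> of the Green term is the Green term of
      order \<open>s * b\<close>.\<close>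
    also have "\<dots> \<le> (\<integral>\<^sup>+p. green_power d V (s * b) p z + (\<Prod>y\<in>V. (if y = z then indicator ?Az (p y) else 1) * ennreal (?D y (p y) powr ?q)) \<partial>?P' V)"
    proof (rule nn_integral_mono_AE, use AE_dirichlet_prod[of "\<lambda>_. ?n" a', OF n a' countable_finite[OF V(1)]] in eventually_elim)
      fix p :: environment assume p: "\<forall>y\<in>V. (\<forall>j\<in>{1..?n}. 0 < p y j) \<and> (\<Sum>j=1..?n. p y j) = 1"
      have "(\<Sum>j=1..?n. ennreal (p y j)) = 1" if "y \<in> V" for y
        using p that by (subst sum_ennreal) (auto intro: less_imp_le)
      then have rw: "return_weight d V p z \<le> 1"
        using return_weight_le[of V p d z] V by auto
      have sb: "0 < s * b" using s b by simp
      have gp: "green_power d V (s * b) p z = ennpowr (green_power d V s p z) b"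
        unfolding green_power_eq_ennpowr[OF s(1) rw] green_power_eq_ennpowr[OF sb rw]
        using s b by (simp add: ennpowr_ennpowr)
      define D where "D = (\<Prod>y\<in>V. ?D y (p y))"
      have D0: "0 \<le> D" unfolding D_def using Dnn by (intro prod_nonneg) auto
      have "(\<Prod>y\<in>V. ennreal (?D y (p y))) = ennreal D"
        unfolding D_def using Dnn by (intro prod_ennreal) auto
      moreover have "(\<Prod>y\<in>V. (if y = z then indicator ?Az (p y) else 1) * ennreal (?D y (p y) powr ?q)) =
          indicator ?A p * ennreal (D powr ?q)"
        using V by (simp add: prod.distrib D_def prod_powr_distrib prod_ennreal) (simp add: indicator_def)
      moreover have "ennreal D * (indicator ?A p * green_power d V s p z) \<le>
          green_power d V (s * b) p z + indicator ?A p * ennreal (D powr ?q)"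
        using Young_crude_ennreal[OF D0 b(1), of "green_power d V s p z"]
        unfolding gp mult.commute[of "ennreal D" "green_power d V s p z"]
        by (cases "p \<in> ?A") (auto simp: mult.commute[of "ennreal D" "green_power d V s p z"])
      ultimately show "(\<Prod>y\<in>V. ennreal (?D y (p y))) * (indicator ?A p * green_power d V s p z) \<le>
          green_power d V (s * b) p z + (\<Prod>y\<in>V. (if y = z then indicator ?Az (p y) else 1) * ennreal (?D y (p y) powr ?q))"
        by simp
    qed
    also have "\<dots> = (\<integral>\<^sup>+p. green_power d V (s * b) p z \<partial>?P' V) +
        (\<integral>\<^sup>+p. (\<Prod>y\<in>V. (if y = z then indicator ?Az (p y) else 1) * ennreal (?D y (p y) powr ?q)) \<partial>?P' V)"
    proof (rule nn_integral_add)
      have "(\<lambda>p. (if y = z then indicator ?Az (p y) else 1) * ennreal (?D y (p y) powr ?q)) \<in> borel_measurable (?P' V)"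
        if "y \<in> V" for y
      proof -
        have "(\<lambda>p. (if y = z then indicator ?A p else 1) * ennreal (?D y (p y) powr ?q)) \<in> borel_measurable (?P' V)"
          using D[OF that] by (cases "y = z") simp_all
        moreover have "(if y = z then indicator ?A p else 1) = (if y = z then indicator ?Az (p y) else (1 :: ennreal))" for p
          by (simp add: indicator_def)
        ultimately show ?thesis by simp
      qed
      then show "(\<lambda>p. \<Prod>y\<in>V. (if y = z then indicator ?Az (p y) else 1) * ennreal (?D y (p y) powr ?q)) \<in> borel_measurable (?P' V)"
        by (rule borel_measurable_prod_ennreal)
    qed simp
    also have "(\<integral>\<^sup>+p. green_power d V (s * b) p z \<partial>?P' V) \<le> ennreal M1"
      unfolding M1_def A_def
    proof (rule nn_integral_green_power_le[OF d V])
      fix y assume "y \<in> V"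
      \<comment> \<open>Constant parameters are balanced, since \<open>opposite\<close> permutes the
        directions; the excess comes from the flow alone.\<close>
      have "(\<Sum>j=1..?n. a (opposite d j)) = (\<Sum>j=1..?n. a j)"
        by (rule sum.reindex_bij_betw[OF bij_opposite])
      moreover have "(\<Sum>j=1..?n. a' y j) = (\<Sum>j=1..?n. a j) + (b - 1) * outflow d t y"
        by (simp add: a'_def sum.distrib sum_distrib_left outflow_def)
      moreover have "(\<Sum>j=1..?n. a' (neighbour d y j) (opposite d j)) =
          (\<Sum>j=1..?n. a (opposite d j)) + (b - 1) * inflow d t y"
        by (simp add: a'_def sum.distrib sum_distrib_left inflow_def)
      ultimately show "(\<Sum>j=1..?n. a' y j) = (\<Sum>j=1..?n. a' (neighbour d y j) (opposite d j)) +
          (if y = z then (b - 1) * g else 0)"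
        using balance[of y] by (cases "y = z") (simp_all add: algebra_simps)
    qed (use a' s b in auto)
    also have "(\<integral>\<^sup>+p. (\<Prod>y\<in>V. (if y = z then indicator ?Az (p y) else 1) * ennreal (?D y (p y) powr ?q)) \<partial>?P' V) =
       (\<Prod>y\<in>V. \<integral>\<^sup>+x. (if y = z then indicator ?Az x else 1) * ennreal (?D y x powr ?q) \<partial>dirichlet ?n (a' y))"
    proof (intro nn_integral_dirichlet_prod n a' V)
      fix y
      have [measurable]: "?Az \<inter> space (dirichlet ?n (a' y)) \<in> sets (dirichlet ?n (a' y))"
      proof -
        have [measurable]: "(\<lambda>x. x i) \<in> borel_measurable (dirichlet ?n (a' y))"
          using i by measurable
        have "{x \<in> space (dirichlet ?n (a' y)). c \<le> x i} \<in> sets (dirichlet ?n (a' y))" by measurable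
        then show ?thesis by (simp add: Int_def conj_commute)
      qed
      then have [measurable]: "(indicator ?Az :: _ \<Rightarrow> ennreal) \<in> borel_measurable (dirichlet ?n (a' y))"
        by (simp only: borel_measurable_indicator_iff)
      show "(\<lambda>x. (if y = z then indicator ?Az x else 1) * ennreal (?D y x powr ?q)) \<in> borel_measurable (dirichlet ?n (a' y))"
        by (cases "y = z") simp_all
    qed
    also have "\<dots> \<le> (\<Prod>y\<in>V. if y = z then ennreal (max 0 Mz) else ennreal (exp (C * (\<Sum>j=1..?n. (t y j)\<^sup>2))))"
    proof (rule prod_mono_ennreal)
      fix y assume "y \<in> V"
      show "(\<integral>\<^sup>+x. (if y = z then indicator ?Az x else 1) * ennreal (?D y x powr ?q) \<partial>dirichlet ?n (a' y)) \<le>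
         (if y = z then ennreal (max 0 Mz) else ennreal (exp (C * (\<Sum>j=1..?n. (t y j)\<^sup>2))))"
      proof (cases "y = z")
        case True
        have "ennreal Mz \<le> ennreal (max 0 Mz)" by (intro ennreal_leI) simp
        with Mz True show ?thesis by (auto intro: order_trans)
      next
        case False
        have "(\<integral>\<^sup>+x. ennreal (?D y x powr ?q) \<partial>dirichlet ?n (a' y)) = ennreal (site_factor ?n b a (t y))"
          unfolding a'_eq using n a t b lt False by (intro nn_integral_site_density_powr) auto
        also have "\<dots> \<le> ennreal (exp (C * (\<Sum>j=1..?n. (t y j)\<^sup>2)))"
          unfolding C_def using n a t cap False b e by (intro ennreal_leI site_factor_le) auto
        finally show ?thesis using False by simp
      qed
    qed
    also have "\<dots> = ennreal (max 0 Mz) * (\<Prod>y\<in>V - {z}. ennreal (exp (C * (\<Sum>j=1..?n. (t y j)\<^sup>2))))"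
      using V by (subst prod.remove[of V z]) (auto intro!: prod.cong arg_cong[where f="\<lambda>x. _ * x"])
    also have "(\<Prod>y\<in>V - {z}. ennreal (exp (C * (\<Sum>j=1..?n. (t y j)\<^sup>2)))) =
        ennreal (exp (C * (\<Sum>y\<in>V - {z}. \<Sum>j=1..?n. (t y j)\<^sup>2)))"
      using V by (subst prod_ennreal) (auto simp: exp_sum[symmetric] sum_distrib_left[symmetric])
    also have "ennreal (max 0 Mz) * \<dots> \<le> ennreal M2"
      unfolding M2_def using energy[of "V - {z}"] V C
      by (subst ennreal_mult'[symmetric]) (auto intro!: ennreal_leI mult_left_mono)
    finally have "(\<integral>\<^sup>+p. indicator ?A p * green_power d V s p z \<partial>?P V) \<le> ennreal M1 + ennreal M2"
      by (auto intro: add_mono)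
    also have "\<dots> \<le> ennreal (max 0 M1) + ennreal M2"
      by (intro add_mono ennreal_leI) auto
    also have "\<dots> = ennreal (max 0 M1 + M2)"
      by (intro ennreal_plus[symmetric]) (auto simp: M2_def)
    finally show ?thesis .
  qed
  then show ?thesis by blast
qed

subsection \<open>Flows of finite energy\<close>

definition divergence :: "nat \<Rightarrow> (site \<Rightarrow> nat \<Rightarrow> real) \<Rightarrow> site \<Rightarrow> real" where
  "divergence d t y = outflow d t y - inflow d t y"

definition finite_energy :: "nat \<Rightarrow> (site \<Rightarrow> nat \<Rightarrow> real) \<Rightarrow> bool" where
  "finite_energy d t \<longleftrightarrow> (\<exists>K. \<forall>V. finite V \<longrightarrow> (\<Sum>y\<in>V. \<Sum>j=1..2*d. (t y j)\<^sup>2) \<le> K)"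

lemma inflow_alt: "inflow d t y = (\<Sum>j=1..2*d. t (neighbour d y (opposite d j)) j)"
proof -
  have "inflow d t y = (\<Sum>j=1..2*d. t (neighbour d y (opposite d j)) (opposite d (opposite d j)))"
    unfolding inflow_def
    by (rule sum.reindex_bij_betw[OF bij_opposite, of "\<lambda>j. t (neighbour d y j) (opposite d j)", symmetric])
  then show ?thesis by (simp add: opposite_opposite)
qed

lemma divergence_add: "divergence d (\<lambda>y j. s y j + t y j) y = divergence d s y + divergence d t y"
  by (simp add: divergence_def outflow_def inflow_def sum.distrib)

lemma divergence_cmult: "divergence d (\<lambda>y j. c * t y j) y = c * divergence d t y"
  by (simp add: divergence_def outflow_def inflow_def sum_distrib_left algebra_simps)

lemma divergence_zero: "divergence d (\<lambda>y j. 0) y = 0"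
  by (simp add: divergence_def outflow_def inflow_def)

lemma divergence_sum:
  "divergence d (\<lambda>y j. \<Sum>k\<in>I. t k y j) y = (\<Sum>k\<in>I. divergence d (t k) y)"
  by (induction I rule: infinite_finite_induct) (simp_all add: divergence_zero divergence_add)

lemma finite_energy_add:
  assumes "finite_energy d s" "finite_energy d t"
  shows "finite_energy d (\<lambda>y j. s y j + t y j)"
proof -
  from assms obtain K L where KL: "finite V \<Longrightarrow> (\<Sum>y\<in>V. \<Sum>j=1..2*d. (s y j)\<^sup>2) \<le> K"
    "finite V \<Longrightarrow> (\<Sum>y\<in>V. \<Sum>j=1..2*d. (t y j)\<^sup>2) \<le> L" for V
    unfolding finite_energy_def by blast
  have sq: "(x + y)\<^sup>2 \<le> 2 * x\<^sup>2 + 2 * y\<^sup>2" for x y :: real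
    using zero_le_power2[of "x - y"] by (simp add: power2_sum power2_diff)
  have "(\<Sum>y\<in>V. \<Sum>j=1..2*d. (s y j + t y j)\<^sup>2) \<le> 2 * K + 2 * L" if "finite V" for V
  proof -
    have "(\<Sum>y\<in>V. \<Sum>j=1..2*d. (s y j + t y j)\<^sup>2) \<le> (\<Sum>y\<in>V. \<Sum>j=1..2*d. 2 * (s y j)\<^sup>2 + 2 * (t y j)\<^sup>2)"
      by (intro sum_mono sq)
    also have "\<dots> = 2 * (\<Sum>y\<in>V. \<Sum>j=1..2*d. (s y j)\<^sup>2) + 2 * (\<Sum>y\<in>V. \<Sum>j=1..2*d. (t y j)\<^sup>2)"
      by (simp add: sum.distrib sum_distrib_left)
    also have "\<dots> \<le> 2 * K + 2 * L" using KL[OF that] by simp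
    finally show ?thesis .
  qed
  then show ?thesis unfolding finite_energy_def by blast
qed

lemma finite_energy_cmult:
  assumes "finite_energy d t" shows "finite_energy d (\<lambda>y j. c * t y j)"
proof -
  from assms obtain K where K: "finite V \<Longrightarrow> (\<Sum>y\<in>V. \<Sum>j=1..2*d. (t y j)\<^sup>2) \<le> K" for V
    unfolding finite_energy_def by blast
  have "(\<Sum>y\<in>V. \<Sum>j=1..2*d. (c * t y j)\<^sup>2) \<le> c\<^sup>2 * K" if "finite V" for V
    using mult_left_mono[OF K[OF that], of "c\<^sup>2"] by (simp add: power_mult_distrib sum_distrib_left)
  then show ?thesis unfolding finite_energy_def by blast
qed

lemma finite_energy_zero: "finite_energy d (\<lambda>y j. 0)"
  unfolding finite_energy_def by (auto intro: exI[of _ 0])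

lemma finite_energy_sum:
  assumes "\<And>k. k \<in> I \<Longrightarrow> finite_energy d (t k)"
  shows "finite_energy d (\<lambda>y j. \<Sum>k\<in>I. t k y j)"
  using assms
  by (induction I rule: infinite_finite_induct) (simp_all add: finite_energy_zero finite_energy_add)

section \<open>Translates and single edges\<close>

definition translate :: "site \<Rightarrow> site \<Rightarrow> site" where
  "translate z y = (\<lambda>i. y i - z i)"

lemma inj_translate: "inj (translate z)"
  by (auto simp: inj_def translate_def fun_eq_iff)

lemma translate_neighbour: "translate z (neighbour d y j) = neighbour d (translate z y) j"
  by (auto simp: translate_def neighbour_def)

lemma divergence_translate: "divergence d (\<lambda>y. t (translate z y)) y = divergence d t (translate z y)"
  by (simp add: divergence_def outflow_def inflow_def translate_neighbour)

lemma finite_energy_translate: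
  assumes "finite_energy d t" shows "finite_energy d (\<lambda>y. t (translate z y))"
proof -
  from assms obtain K where K: "finite V \<Longrightarrow> (\<Sum>y\<in>V. \<Sum>j=1..2*d. (t y j)\<^sup>2) \<le> K" for V
    unfolding finite_energy_def by blast
  have "(\<Sum>y\<in>V. \<Sum>j=1..2*d. (t (translate z y) j)\<^sup>2) \<le> K" if "finite V" for V
  proof -
    have "(\<Sum>y\<in>V. \<Sum>j=1..2*d. (t (translate z y) j)\<^sup>2) = (\<Sum>y\<in>translate z ` V. \<Sum>j=1..2*d. (t y j)\<^sup>2)"
      using inj_translate[of z] by (subst sum.reindex) (auto intro: inj_on_subset)
    with K[of "translate z ` V"] that show ?thesis by simp
  qed
  then show ?thesis unfolding finite_energy_def by blast
qed

definition edge_flow :: "site \<Rightarrow> nat \<Rightarrow> site \<Rightarrow> nat \<Rightarrow> real" where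
  "edge_flow z k y j = (if y = z \<and> j = k then 1 else 0)"

lemma divergence_edge_flow:
  assumes "k \<in> {1..2*d}"
  shows "divergence d (edge_flow z k) y = (if y = z then 1 else 0) - (if y = neighbour d z k then 1 else 0)"
proof -
  have "outflow d (edge_flow z k) y = (\<Sum>j=1..2*d. if j = k then (if y = z then 1 else 0) else 0)"
    unfolding outflow_def edge_flow_def by (intro sum.cong) auto
  moreover have "inflow d (edge_flow z k) y = (\<Sum>j=1..2*d. if j = k then (if y = neighbour d z k then 1 else 0) else 0)"
    unfolding inflow_alt edge_flow_def
  proof (intro sum.cong refl)
    fix j assume "j \<in> {1..2*d}"
    then have "neighbour d y (opposite d j) = z \<longleftrightarrow> y = neighbour d z j"
      using neighbour_opposite[of "opposite d j" d y] neighbour_opposite[of j d z]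
      using opposite_in[of j d] by (auto simp: opposite_opposite)
    then show "(if neighbour d y (opposite d j) = z \<and> j = k then 1 else 0) =
        (if j = k then (if y = neighbour d z k then 1 else 0) else (0::real))" by auto
  qed
  ultimately show ?thesis using assms by (simp add: divergence_def)
qed

lemma finite_energy_edge_flow: "finite_energy d (edge_flow z k)"
proof -
  have "(\<Sum>y\<in>V. \<Sum>j=1..2*d. (edge_flow z k y j)\<^sup>2) \<le> 1" if "finite V" for V
  proof -
    have "(\<Sum>y\<in>V. \<Sum>j=1..2*d. (edge_flow z k y j)\<^sup>2) \<le> (\<Sum>y\<in>V. if y = z then 1 else 0)"
    proof (rule sum_mono)
      fix y
      have "(\<Sum>j=1..2*d. (edge_flow z k y j)\<^sup>2) = (\<Sum>j=1..2*d. if j = k then (if y = z then 1 else 0) else 0)"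
        by (intro sum.cong) (auto simp: edge_flow_def)
      then show "(\<Sum>j=1..2*d. (edge_flow z k y j)\<^sup>2) \<le> (if y = z then 1 else 0)"
        by auto
    qed
    also have "\<dots> \<le> 1" using that by simp
    finally show ?thesis .
  qed
  then show ?thesis unfolding finite_energy_def by blast
qed

section \<open>A unit flow of finite energy in three dimensions\<close>

text \<open>The transition probabilities of the following unit flow to infinity are those of a Polya
  urn with three colours, started from one ball of each colour; the urn is uniformly distributed
  over its possible states, which makes the flow explicit.\<close>

definition octant :: "site \<Rightarrow> bool" where
  "octant x \<longleftrightarrow> (\<forall>i\<in>{1,2,3}. 0 \<le> x i) \<and> (\<forall>i. i \<notin> {1,2,3} \<longrightarrow> x i = 0)"

definition level :: "site \<Rightarrow> nat" where
  "level x = nat (x 1 + x 2 + x 3)"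

text \<open>Level \<open>n\<close> has \<open>(n + 1) * (n + 2) / 2\<close> states, and a ball of
  colour \<open>j\<close> is added with probability \<open>(x j + 1) / (n + 3)\<close>. The flow is
  the probability of the state times that of the transition.\<close>

definition urn_flow :: "site \<Rightarrow> nat \<Rightarrow> real" where
  "urn_flow x j = (if octant x \<and> j \<in> {1,2,3} then
     2 * (real_of_int (x j) + 1) / ((real (level x) + 1) * (real (level x) + 2) * (real (level x) + 3)) else 0)"

lemma urn_flow_nonneg: "0 \<le> urn_flow x j"
proof (cases "octant x \<and> j \<in> {1,2,3}")
  case True
  then have "0 \<le> x j" unfolding octant_def by blast
  with True show ?thesis by (simp add: urn_flow_def)
next
  case False
  then show ?thesis unfolding urn_flow_def by (subst if_not_P) auto
qed

text \<open>At a site of level \<open>n\<close> in the octant, the outflow is the probability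
  \<open>2 / ((n + 1) * (n + 2))\<close> of the state. The inflow has the same value, except at the
  origin, where it is 0.\<close>

lemma divergence_urn_flow:
  assumes d: "3 \<le> d"
  shows "divergence d urn_flow x = (if x = origin then 1 else 0)"
proof -
  have sub: "{1,2,3} \<subseteq> {1..2*d}" using d by auto
  have restr: "(\<Sum>j=1..2*d. f j) = f 1 + f 2 + f 3" if "\<And>j. j \<notin> {1,2,3} \<Longrightarrow> f j = (0::real)" for f :: "nat \<Rightarrow> real"
  proof -
    have "(\<Sum>j=1..2*d. f j) = (\<Sum>j\<in>{1,2,3}. f j)"
      using that sub by (intro sum.mono_neutral_right) auto
    then show ?thesis by simp
  qed
  have nb: "neighbour d x (opposite d k) = (\<lambda>i. x i - (if i = k then 1 else 0))" if "k \<in> {1,2,3}" for k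
    using that d by (auto simp: neighbour_def unit_vec_def opposite_def fun_eq_iff)
  have out: "outflow d urn_flow x = urn_flow x 1 + urn_flow x 2 + urn_flow x 3"
    unfolding outflow_def by (rule restr) (auto simp: urn_flow_def)
  have inn: "inflow d urn_flow x = (\<Sum>k\<in>{1,2,3}. urn_flow (\<lambda>i. x i - (if i = k then 1 else 0)) k)"
    unfolding inflow_alt by (subst restr) (auto simp: urn_flow_def nb)
  show ?thesis
  proof (cases "octant x")
    case False
    have "\<not> octant (\<lambda>i. x i - (if i = k then 1 else 0))" if "k \<in> {1,2,3}" for k
    proof
      assume *: "octant (\<lambda>i. x i - (if i = k then 1 else 0))"
      have "octant x" unfolding octant_def
      proof (intro conjI ballI allI impI)
        fix i assume "i \<in> {1,2,3::nat}"
        with * have "0 \<le> x i - (if i = k then 1 else 0)" unfolding octant_def by blast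
        then show "0 \<le> x i" by (auto split: if_splits)
      next
        fix i assume i: "i \<notin> {1,2,3::nat}"
        with * have "x i - (if i = k then 1 else 0) = 0" unfolding octant_def by blast
        with i that show "x i = 0" by (auto split: if_splits)
      qed
      with False show False by simp
    qed
    then have "inflow d urn_flow x = 0" unfolding inn by (auto simp: urn_flow_def)
    moreover have "x \<noteq> origin" using False by (auto simp: octant_def origin_def)
    ultimately show ?thesis using False unfolding divergence_def out by (simp add: urn_flow_def)
  next
    case True
    define n where "n = level x"
    have nn: "0 \<le> x 1" "0 \<le> x 2" "0 \<le> x 3" using True by (auto simp: octant_def)
    then have n: "real n = real_of_int (x 1) + real_of_int (x 2) + real_of_int (x 3)"
      by (simp add: n_def level_def)
    have o: "outflow d urn_flow x = 2 / ((real n + 1) * (real n + 2))"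
    proof -
      have "outflow d urn_flow x = 2 * (real_of_int (x 1) + 1 + (real_of_int (x 2) + 1) + (real_of_int (x 3) + 1)) /
          ((real n + 1) * (real n + 2) * (real n + 3))"
        unfolding out using True by (simp add: urn_flow_def n_def add_divide_distrib[symmetric] distrib_left)
      also have "real_of_int (x 1) + 1 + (real_of_int (x 2) + 1) + (real_of_int (x 3) + 1) = real n + 3"
        unfolding n by simp
      also have "2 * (real n + 3) / ((real n + 1) * (real n + 2) * (real n + 3)) = 2 / ((real n + 1) * (real n + 2))"
        by (rule mult_divide_mult_cancel_right) simp
      finally show ?thesis .
    qed
    show ?thesis
    proof (cases "n = 0")
      case True
      then have z: "x 1 = 0" "x 2 = 0" "x 3 = 0" using nn by (auto simp: n_def level_def)
      have "x i = 0" for i using \<open>octant x\<close> z by (cases "i \<in> {1,2,3}") (auto simp: octant_def)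
      then have "x = origin" by (auto simp: origin_def)
      moreover have "inflow d urn_flow x = 0" unfolding inn using z by (auto simp: urn_flow_def octant_def)
      ultimately show ?thesis using o True by (simp add: divergence_def)
    next
      case False
      \<comment> \<open>If \<open>x k = 0\<close>, the site before the step lies outside the octant,
        and the formula gives 0 as well.\<close>
      have tm: "urn_flow (\<lambda>i. x i - (if i = k then 1 else 0)) k =
          2 * real_of_int (x k) / (real n * (real n + 1) * (real n + 2))" if k: "k \<in> {1,2,3}" for k
      proof (cases "x k = 0")
        case True
        have "\<not> octant (\<lambda>i. x i - (if i = k then 1 else 0))"
          using True k by (auto simp: octant_def intro!: exI[of _ k])
        with True show ?thesis by (simp add: urn_flow_def)
      next
        case False
        have oc: "octant (\<lambda>i. x i - (if i = k then 1 else 0))"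
          using \<open>octant x\<close> False k unfolding octant_def
          by auto
        have l: "real (level (\<lambda>i. x i - (if i = k then 1 else 0))) = real n - 1"
          using k nn n \<open>n \<noteq> 0\<close> by (auto simp: level_def of_nat_nat)
        show ?thesis using oc k \<open>n \<noteq> 0\<close> unfolding urn_flow_def l by (simp add: algebra_simps)
      qed
      have "inflow d urn_flow x = 2 * (real_of_int (x 1) + real_of_int (x 2) + real_of_int (x 3)) /
          (real n * (real n + 1) * (real n + 2))"
        unfolding inn using tm by (simp add: add_divide_distrib[symmetric] distrib_left)
      also have "\<dots> = 2 / ((real n + 1) * (real n + 2))"
        unfolding n[symmetric] using False by simp
      finally have "divergence d urn_flow x = 0" using o by (simp add: divergence_def)
      moreover have "x \<noteq> origin" using False by (auto simp: n_def level_def origin_def)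
      ultimately show ?thesis by simp
    qed
  qed
qed

lemma card_octant_level:
  assumes "finite V" shows "card {x \<in> V. octant x \<and> level x = n} \<le> (n + 1)\<^sup>2"
proof -
  let ?S = "{x \<in> V. octant x \<and> level x = n}" and ?f = "\<lambda>x. (nat (x 1), nat (x 2))"
  have "inj_on ?f ?S"
  proof (rule inj_onI)
    fix x y assume x: "x \<in> ?S" and y: "y \<in> ?S" and e: "?f x = ?f y"
    have nn: "0 \<le> x 1" "0 \<le> x 2" "0 \<le> x 3" "0 \<le> y 1" "0 \<le> y 2" "0 \<le> y 3"
      using x y by (auto simp: octant_def)
    then have e': "x 1 = y 1" "x 2 = y 2" using e by auto
    then have "x 3 = y 3" using x y nn by (auto simp: level_def)
    show "x = y"
    proof
      fix i show "x i = y i"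
        using e' \<open>x 3 = y 3\<close> x y by (cases "i \<in> {1,2,3}") (auto simp: octant_def)
    qed
  qed
  moreover have "?f ` ?S \<subseteq> {0..n} \<times> {0..n}"
    by (auto simp: octant_def level_def)
  ultimately have "card ?S \<le> card ({0..n} \<times> {0..n})"
    by (intro card_inj_on_le[of ?f]) auto
  then show ?thesis by (simp add: power2_eq_square algebra_simps)
qed

text \<open>Level \<open>n\<close> contains at most \<open>(n + 1)\<^sup>2\<close> sites, each with
  energy of order \<open>n\<close> to the power -4, so that the energies of the levels are summable.
  With two colours the same count would lead to the harmonic series.\<close>

lemma finite_energy_urn_flow:
  "finite_energy d urn_flow"
proof -
  \<comment> \<open>Three edges leave a site, each with flow at most
    \<open>2 / (n + 1)\<^sup>2\<close>.\<close>
  define h where "h n = 12 / (real n + 1) ^ 4" for n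
  have bound: "urn_flow x j \<le> (if j \<in> {1,2,3} then 2 / (real (level x) + 1)\<^sup>2 else 0)" for x j
  proof (cases "octant x \<and> j \<in> {1,2,3}")
    case True
    then have "real_of_int (x j) \<le> real (level x)" "0 \<le> x j"
      by (auto simp: octant_def level_def of_nat_nat)
    then have "2 * (real_of_int (x j) + 1) / ((real (level x) + 1) * (real (level x) + 2) * (real (level x) + 3)) \<le>
        2 * (real (level x) + 1) / ((real (level x) + 1) * (real (level x) + 1) * (real (level x) + 1))"
      by (intro frac_le mult_mono) auto
    also have "\<dots> = 2 / ((real (level x) + 1) * (real (level x) + 1))"
      by (rule mult_divide_mult_cancel_right) simp
    also have "\<dots> = 2 / (real (level x) + 1)\<^sup>2" by (simp add: power2_eq_square)
    finally show ?thesis using True by (simp add: urn_flow_def)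
  qed (auto simp: urn_flow_def)
  have sq: "(\<Sum>j=1..2*d. (urn_flow x j)\<^sup>2) \<le> h (level x)" for x
  proof -
    have "(\<Sum>j=1..2*d. (urn_flow x j)\<^sup>2) \<le> (\<Sum>j=1..2*d. if j \<in> {1,2,3} then 4 / (real (level x) + 1) ^ 4 else 0)"
    proof (rule sum_mono)
      fix j
      have "(urn_flow x j)\<^sup>2 \<le> (if j \<in> {1,2,3} then 2 / (real (level x) + 1)\<^sup>2 else 0)\<^sup>2"
        by (intro power_mono bound urn_flow_nonneg)
      also have "\<dots> = (if j \<in> {1,2,3} then 4 / (real (level x) + 1) ^ 4 else 0)"
        by (auto simp: power_divide simp flip: power_mult)
      finally show "(urn_flow x j)\<^sup>2 \<le> \<dots>" .
    qed
    also have "\<dots> = (\<Sum>j\<in>{1..2*d} \<inter> {1,2,3}. 4 / (real (level x) + 1) ^ 4)"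
      by (rule sum.inter_restrict[symmetric]) simp
    also have "\<dots> \<le> (\<Sum>j\<in>{1,2,3::nat}. 4 / (real (level x) + 1) ^ 4)"
      by (rule sum_mono2) auto
    also have "\<dots> = h (level x)" by (simp add: h_def)
    finally show ?thesis .
  qed
  have summ: "summable (\<lambda>n. 12 / (real n + 1)\<^sup>2)"
  proof -
    have "summable (\<lambda>n. 12 * inverse ((real (Suc n))\<^sup>2))"
      by (subst summable_Suc_iff[where f="\<lambda>n. 12 * inverse ((real n)\<^sup>2)"])
         (intro summable_mult inverse_power_summable, simp)
    then show ?thesis by (simp add: divide_inverse add.commute)
  qed
  have "(\<Sum>y\<in>V. \<Sum>j=1..2*d. (urn_flow y j)\<^sup>2) \<le> (\<Sum>n. 12 / (real n + 1)\<^sup>2)" if V: "finite V" for V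
  proof -
    let ?O = "{y \<in> V. octant y}"
    have "(\<Sum>y\<in>V. \<Sum>j=1..2*d. (urn_flow y j)\<^sup>2) = (\<Sum>y\<in>?O. \<Sum>j=1..2*d. (urn_flow y j)\<^sup>2)"
      using V by (intro sum.mono_neutral_right) (auto simp: urn_flow_def)
    also have "\<dots> \<le> (\<Sum>y\<in>?O. h (level y))" by (intro sum_mono sq)
    also have "\<dots> = (\<Sum>n\<in>level ` ?O. \<Sum>y\<in>{y \<in> ?O. level y = n}. h (level y))"
      using V by (intro sum.image_gen) auto
    also have "\<dots> \<le> (\<Sum>n\<in>level ` ?O. 12 / (real n + 1)\<^sup>2)"
    proof (rule sum_mono)
      fix n
      have "(\<Sum>y\<in>{y \<in> ?O. level y = n}. h (level y)) = real (card {y \<in> V. octant y \<and> level y = n}) * h n"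
        by (simp add: conj_assoc)
      also have "\<dots> \<le> real ((n + 1)\<^sup>2) * h n"
        using card_octant_level[OF V, of n] by (intro mult_right_mono of_nat_mono) (auto simp: h_def)
      also have "\<dots> = 12 / (real n + 1)\<^sup>2"
      proof -
        have "x\<^sup>2 * (12 / x ^ 4) = 12 / x\<^sup>2" if "0 < x" for x :: real
          using that by (simp add: field_simps power2_eq_square power4_eq_xxxx)
        from this[of "real n + 1"] show ?thesis by (simp add: h_def add.commute)
      qed
      finally show "(\<Sum>y\<in>{y \<in> ?O. level y = n}. h (level y)) \<le> 12 / (real n + 1)\<^sup>2" .
    qed
    also have "\<dots> \<le> (\<Sum>n. 12 / (real n + 1)\<^sup>2)"
      using V by (intro sum_le_suminf summ) auto
    finally show ?thesis .
  qed
  then show ?thesis unfolding finite_energy_def by blast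
qed

section \<open>Flows spread out along rays\<close>

definition ray :: "nat \<Rightarrow> site \<Rightarrow> nat \<Rightarrow> nat \<Rightarrow> site" where
  "ray d z k m = (\<lambda>i. z i + int m * unit_vec d k i)"

lemma ray_0: "ray d z k 0 = z"
  by (simp add: ray_def)

lemma ray_Suc: "ray d z k (Suc m) = neighbour d (ray d z k m) k"
  by (auto simp: ray_def neighbour_def fun_eq_iff algebra_simps)

definition axis :: "nat \<Rightarrow> nat \<Rightarrow> nat" where
  "axis d k = (if k \<le> d then k else k - d)"

lemma unit_vec_axis: "unit_vec d k (axis d k) \<noteq> 0"
  by (simp add: unit_vec_def axis_def)

lemma unit_vec_eq_0: "i \<noteq> axis d k \<Longrightarrow> unit_vec d k i = 0"
  by (cases "k \<le> d") (simp_all add: unit_vec_def axis_def)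

lemma axis_eq:
  assumes "j \<in> {1..2*d}" "k \<in> {1..2*d}" "axis d j = axis d k"
  shows "k = j \<or> k = opposite d j"
  using assms by (auto simp: axis_def opposite_def split: if_splits)

lemma inj_ray: "inj (ray d z k)"
proof (rule injI)
  fix m n assume "ray d z k m = ray d z k n"
  from fun_cong[OF this, of "axis d k"] show "m = n"
    using unit_vec_axis[of d k] by (simp add: ray_def)
qed

text \<open>The flow along a ray is broken into \<open>M\<close> equal parts, each of which spreads out after one
  more step; this makes the flow off the ray uniformly small.\<close>

definition ray_flow :: "nat \<Rightarrow> nat \<Rightarrow> site \<Rightarrow> nat \<Rightarrow> site \<Rightarrow> nat \<Rightarrow> real" where
  "ray_flow d M z k y j = 1 / real M * (\<Sum>m=1..M.
     (\<Sum>l<m. edge_flow (ray d z k l) k y j) + urn_flow (translate (ray d z k m) y) j)"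

lemma ray_flow_nonneg: "0 \<le> ray_flow d M z k y j"
  unfolding ray_flow_def
  by (intro mult_nonneg_nonneg sum_nonneg add_nonneg_nonneg urn_flow_nonneg) (auto simp: edge_flow_def)

text \<open>In the part numbered \<open>m\<close>, the edges of the ray carry the unit from
  \<open>z\<close> to \<open>ray d z k m\<close>, where a translated urn flow takes it over; the
  divergences telescope.\<close>

lemma divergence_ray_flow:
  assumes d: "3 \<le> d" and M: "1 \<le> M" and k: "k \<in> {1..2*d}"
  shows "divergence d (ray_flow d M z k) y = (if y = z then 1 else 0)"
proof -
  have e: "(\<Sum>l<m. divergence d (edge_flow (ray d z k l) k) y) =
      (if y = z then 1 else 0) - (if y = ray d z k m then 1 else 0)" for m
    by (induction m) (auto simp: divergence_edge_flow[OF k] ray_0 ray_Suc)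
  have u: "divergence d (\<lambda>y. urn_flow (translate (ray d z k m) y)) y = (if y = ray d z k m then 1 else 0)" for m
  proof -
    have "translate (ray d z k m) y = origin \<longleftrightarrow> y = ray d z k m"
      by (auto simp: translate_def origin_def fun_eq_iff)
    then show ?thesis by (simp add: divergence_translate divergence_urn_flow[OF d])
  qed
  have "divergence d (ray_flow d M z k) y = 1 / real M * (\<Sum>m=1..M.
     (\<Sum>l<m. divergence d (edge_flow (ray d z k l) k) y) + divergence d (\<lambda>y. urn_flow (translate (ray d z k m) y)) y)"
    unfolding ray_flow_def[abs_def] by (simp only: divergence_cmult divergence_sum divergence_add)
  also have "\<dots> = (if y = z then 1 else 0)"
    unfolding e u using M by simp
  finally show ?thesis .
qed

lemma finite_energy_ray_flow: "finite_energy d (ray_flow d M z k)"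
  unfolding ray_flow_def[abs_def]
  by (intro finite_energy_cmult finite_energy_sum finite_energy_add finite_energy_edge_flow
    finite_energy_translate finite_energy_urn_flow)

text \<open>Seen from \<open>M\<close> different points of the ray, an edge is \<open>M\<close>
  different edges of one urn flow. Their squares sum up to at most the energy \<open>K\<close>, so
  that by Cauchy-Schwarz the average of the urn parts is at most the root of \<open>K / M\<close>,
  which is at most \<open>h\<close> for large \<open>M\<close>.\<close>

lemma ray_flow_le:
  assumes h: "0 < h"
  shows "\<exists>M\<ge>1. \<forall>z k y j. j \<in> {1..2*d} \<longrightarrow>
    ray_flow d M z k y j \<le> (if j = k \<and> y \<in> range (ray d z k) then 1 else 0) + h"
proof -
  obtain K where K: "finite V \<Longrightarrow> (\<Sum>y\<in>V. \<Sum>j=1..2*d. (urn_flow y j)\<^sup>2) \<le> K" for V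
    using finite_energy_urn_flow[of d] unfolding finite_energy_def by blast
  have "0 \<le> K" using K[of "{}"] by simp
  obtain M :: nat where M: "K / h\<^sup>2 + 1 < real M" using reals_Archimedean2 by blast
  have M1: "1 \<le> M"
  proof -
    have "0 \<le> K / h\<^sup>2" using \<open>0 \<le> K\<close> by simp
    with M have "0 < real M" by linarith
    then show ?thesis by simp
  qed
  have KM: "K \<le> real M * h\<^sup>2"
  proof -
    have "K + h\<^sup>2 < real M * h\<^sup>2" using M h by (simp add: field_simps)
    with zero_le_power2[of h] show ?thesis by linarith
  qed
  have "ray_flow d M z k y j \<le> (if j = k \<and> y \<in> range (ray d z k) then 1 else 0) + h" if j: "j \<in> {1..2*d}" for z k y j
  proof -
    let ?u = "\<lambda>m. urn_flow (translate (ray d z k m) y) j"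
    let ?on = "if j = k \<and> y \<in> range (ray d z k) then 1 else (0::real)"
    have "(\<Sum>l<m. edge_flow (ray d z k l) k y j) \<le> ?on" for m
    proof (cases "j = k \<and> y \<in> range (ray d z k)")
      case True
      then obtain n where n: "y = ray d z k n" by auto
      have "(\<Sum>l<m. edge_flow (ray d z k l) k y j) = (\<Sum>l<m. if l = n then 1 else 0)"
        using True inj_ray[of d z k] unfolding n edge_flow_def by (intro sum.cong) (auto dest: injD)
      also have "\<dots> \<le> 1" by simp
      finally show ?thesis using True by simp
    next
      case False
      then have "(\<Sum>l<m. edge_flow (ray d z k l) k y j) = 0"
        by (intro sum.neutral) (auto simp: edge_flow_def)
      then show ?thesis by auto
    qed
    then have "(\<Sum>m=1..M. (\<Sum>l<m. edge_flow (ray d z k l) k y j)) \<le> (\<Sum>m=1..M. ?on)"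
      by (rule sum_mono)
    also have "\<dots> = real M * ?on" by simp
    finally have 1: "(\<Sum>m=1..M. (\<Sum>l<m. edge_flow (ray d z k l) k y j)) \<le> real M * ?on" .
    have inj: "inj_on (\<lambda>m. translate (ray d z k m) y) {1..M}"
    proof (rule inj_onI)
      fix m n assume "translate (ray d z k m) y = translate (ray d z k n) y"
      then have "ray d z k m = ray d z k n" by (auto simp: translate_def fun_eq_iff)
      with inj_ray[of d z k] show "m = n" by (auto dest: injD)
    qed
    have "(\<Sum>m=1..M. (?u m)\<^sup>2) = (\<Sum>x\<in>(\<lambda>m. translate (ray d z k m) y) ` {1..M}. (urn_flow x j)\<^sup>2)"
      using inj by (simp add: sum.reindex)
    also have "\<dots> \<le> (\<Sum>x\<in>(\<lambda>m. translate (ray d z k m) y) ` {1..M}. \<Sum>j=1..2*d. (urn_flow x j)\<^sup>2)"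
      using j by (intro sum_mono member_le_sum) auto
    also have "\<dots> \<le> K" by (rule K) simp
    also note KM
    finally have "(\<Sum>m=1..M. (?u m)\<^sup>2) * real M \<le> (real M * h\<^sup>2) * real M"
      by (rule mult_right_mono) simp
    moreover have "(\<Sum>m=1..M. ?u m)\<^sup>2 \<le> (\<Sum>m=1..M. (?u m)\<^sup>2) * real M"
      using sum_squared_le_sum_of_squares[of ?u "{1..M}"] by simp
    moreover have "(real M * h\<^sup>2) * real M = (real M * h)\<^sup>2" by (simp add: power2_eq_square)
    ultimately have "(\<Sum>m=1..M. ?u m)\<^sup>2 \<le> (real M * h)\<^sup>2" by linarith
    then have 2: "(\<Sum>m=1..M. ?u m) \<le> real M * h"
      by (rule power2_le_imp_le) (use h in simp)
    have "ray_flow d M z k y j \<le> 1 / real M * (real M * ?on + real M * h)"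
      unfolding ray_flow_def sum.distrib using 1 2 by (intro mult_left_mono add_mono) auto
    also have "\<dots> = ?on + h" using M1 by (simp add: distrib_left)
    finally show ?thesis .
  qed
  with M1 show ?thesis by blast
qed

text \<open>The edge \<open>(origin, i)\<close> has unbounded capacity, so that its endpoints together emit all
  that the other edges leaving them can carry.\<close>

theorem exists_flow:
  fixes a :: "nat \<Rightarrow> real"
  assumes d: "3 \<le> d" and a: "\<forall>j\<in>{1..2*d}. 0 < a j" and i: "i \<in> {1..2*d}"
    and g: "g < 2 * (\<Sum>j=1..2*d. a j) - a i - a (opposite d i)"
  shows "\<exists>t g' e K. g < g' \<and> 0 < e \<and> (\<forall>y j. 0 \<le> t y j) \<and>
    (\<forall>y. outflow d t y = inflow d t y + (if y = origin then g' else 0)) \<and>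
    (\<forall>y j. j \<in> {1..2*d} \<longrightarrow> (y, j) \<noteq> (origin, i) \<longrightarrow> t y j \<le> (1 - e) * a j) \<and>
    (\<forall>V. finite V \<longrightarrow> (\<Sum>y\<in>V. \<Sum>j=1..2*d. (t y j)\<^sup>2) \<le> K)"
proof -
  let ?J = "{1..2*d}" and ?o = "opposite d i"
  define A where "A = (\<Sum>j\<in>?J. a j)"
  define k where "k = 2 * A - a i - a ?o"
  have o: "?o \<in> ?J" by (rule opposite_in[OF i])
  have "i \<noteq> ?o" using i by (auto simp: opposite_def)
  have Ai: "(\<Sum>j\<in>?J - {i}. a j) = A - a i" and Ao: "(\<Sum>j\<in>?J - {?o}. a j) = A - a ?o"
    using i o by (simp_all add: A_def sum_diff1)
  have "A - a i = a ?o + (\<Sum>j\<in>?J - {i} - {?o}. a j)"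
    unfolding Ai[symmetric] using o \<open>i \<noteq> ?o\<close> by (subst sum.remove[of _ ?o]) auto
  moreover have "0 \<le> (\<Sum>j\<in>?J - {i} - {?o}. a j)"
    using a by (intro sum_nonneg) (auto intro: less_imp_le)
  moreover have "0 < A" unfolding A_def using a d by (intro sum_pos) auto
  ultimately have k: "0 < k" unfolding k_def by simp
  \<comment> \<open>Scaling the flow by \<open>1 - e\<close> must leave a strength above
    \<open>g\<close>.\<close>
  define e where "e = min (1 / 2) ((k - g) / (2 * k))"
  have kg: "g < k" using g by (simp add: k_def A_def)
  have e: "0 < e" "e < 1" "e * k < k - g"
  proof -
    show "0 < e" "e < 1" using k kg by (auto simp: e_def)
    have "e * k \<le> (k - g) / (2 * k) * k" using k by (intro mult_right_mono) (auto simp: e_def)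
    also have "\<dots> < k - g" using k kg by simp
    finally show "e * k < k - g" .
  qed
  define m where "m = Min (a ` ?J)"
  have m: "0 < m" "\<And>j. j \<in> ?J \<Longrightarrow> m \<le> a j"
  proof -
    have "a ` ?J \<noteq> {}" using d by auto
    then show "0 < m" unfolding m_def using a by (subst Min_gr_iff) auto
    show "m \<le> a j" if "j \<in> ?J" for j unfolding m_def using that by (intro Min_le) auto
  qed
  \<comment> \<open>Each of the two families of rays below has total strength at most
    \<open>A\<close>, so that their spread at any edge is at most \<open>2 * A * h = e * m\<close>
    altogether.\<close>
  define h where "h = e * m / (2 * A)"
  have h: "0 < h" using e m \<open>0 < A\<close> by (simp add: h_def)
  obtain M where M: "1 \<le> M" and Mle: "\<And>z l y j. j \<in> ?J \<Longrightarrow>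
      ray_flow d M z l y j \<le> (if j = l \<and> y \<in> range (ray d z l) then 1 else 0) + h"
    using ray_flow_le[OF h, of d] by blast
  let ?z = "neighbour d origin i" and ?R = "ray_flow d M"
  \<comment> \<open>The origin emits rays of strength \<open>a l\<close> in all directions but
    \<open>i\<close>, and \<open>?z\<close> does so in all directions but \<open>?o\<close>. What
    leaves \<open>?z\<close> is brought there through the edge \<open>(origin, i)\<close>. The total
    strength before scaling is \<open>k\<close>.\<close>
  define t where "t y j = (1 - e) * ((\<Sum>l\<in>?J - {i}. a l * ?R origin l y j) +
      (\<Sum>l\<in>?J - {?o}. a l * (edge_flow origin i y j + ?R ?z l y j)))" for y j
  have div: "divergence d t y = (if y = origin then (1 - e) * k else 0)" for y
  proof -
    have "divergence d t y = (1 - e) * ((\<Sum>l\<in>?J - {i}. a l * divergence d (?R origin l) y) +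
      (\<Sum>l\<in>?J - {?o}. a l * (divergence d (edge_flow origin i) y + divergence d (?R ?z l) y)))"
      unfolding t_def[abs_def] by (simp only: divergence_cmult divergence_sum divergence_add)
    also have "\<dots> = (1 - e) * ((\<Sum>l\<in>?J - {i}. a l * (if y = origin then 1 else 0)) +
      (\<Sum>l\<in>?J - {?o}. a l * (if y = origin then 1 else 0)))"
      using d M i by (simp add: divergence_ray_flow divergence_edge_flow cong: sum.cong_simp)
    also have "\<dots> = (1 - e) * ((A - a i) * (if y = origin then 1 else 0) + (A - a ?o) * (if y = origin then 1 else 0))"
      by (simp only: sum_distrib_right[symmetric] Ai Ao)
    finally show ?thesis by (cases "y = origin") (simp_all add: k_def algebra_simps)
  qed
  have nn: "0 \<le> t y j" for y j
    unfolding t_def using e a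
    by (intro mult_nonneg_nonneg add_nonneg_nonneg sum_nonneg ray_flow_nonneg) (auto simp: edge_flow_def intro: less_imp_le)
  \<comment> \<open>Before scaling, the rays contribute at most \<open>a j\<close> and the spread at
    most \<open>e * a j\<close>; since \<open>(1 - e) * (1 + e) = 1 - e\<^sup>2\<close>, the
    remaining margin is \<open>e\<^sup>2\<close>.\<close>
  have cap: "t y j \<le> (1 - e\<^sup>2) * a j" if j: "j \<in> ?J" and ne: "(y, j) \<noteq> (origin, i)" for y j
  proof -
    let ?on = "\<lambda>z l. if j = l \<and> y \<in> range (ray d z l) then 1 else (0::real)"
    have e0: "edge_flow origin i y j = 0" using ne by (auto simp: edge_flow_def)
    have "(\<Sum>l\<in>?J - {i}. a l * ?R origin l y j) \<le> (\<Sum>l\<in>?J - {i}. a l * (?on origin l + h))"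
      using a by (intro sum_mono mult_left_mono Mle[OF j]) (auto intro: less_imp_le)
    also have "\<dots> = (\<Sum>l\<in>?J - {i}. a l * ?on origin l) + (A - a i) * h"
      by (simp only: distrib_left sum.distrib sum_distrib_right[symmetric] Ai)
    also have "(A - a i) * h \<le> A * h"
      using a i h by (intro mult_right_mono) (auto intro: less_imp_le)
    finally have 1: "(\<Sum>l\<in>?J - {i}. a l * ?R origin l y j) \<le> (\<Sum>l\<in>?J - {i}. a l * ?on origin l) + A * h"
      by simp
    have "(\<Sum>l\<in>?J - {?o}. a l * ?R ?z l y j) \<le> (\<Sum>l\<in>?J - {?o}. a l * (?on ?z l + h))"
      using a by (intro sum_mono mult_left_mono Mle[OF j]) (auto intro: less_imp_le)
    also have "\<dots> = (\<Sum>l\<in>?J - {?o}. a l * ?on ?z l) + (A - a ?o) * h"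
      by (simp only: distrib_left sum.distrib sum_distrib_right[symmetric] Ao)
    also have "(A - a ?o) * h \<le> A * h"
      using a o h by (intro mult_right_mono) (auto intro: less_imp_le)
    finally have 2: "(\<Sum>l\<in>?J - {?o}. a l * ?R ?z l y j) \<le> (\<Sum>l\<in>?J - {?o}. a l * ?on ?z l) + A * h"
      by simp
    have s1: "(\<Sum>l\<in>?J - {i}. a l * ?on origin l) = (if j \<noteq> i \<and> y \<in> range (ray d origin j) then a j else 0)"
    proof -
      have "(\<Sum>l\<in>?J - {i}. a l * ?on origin l) = (\<Sum>l\<in>?J - {i}. if l = j then (if y \<in> range (ray d origin j) then a j else 0) else 0)"
        by (intro sum.cong) auto
      then show ?thesis using j by auto
    qed
    have s2: "(\<Sum>l\<in>?J - {?o}. a l * ?on ?z l) = (if j \<noteq> ?o \<and> y \<in> range (ray d ?z j) then a j else 0)"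
    proof -
      have "(\<Sum>l\<in>?J - {?o}. a l * ?on ?z l) = (\<Sum>l\<in>?J - {?o}. if l = j then (if y \<in> range (ray d ?z j) then a j else 0) else 0)"
        by (intro sum.cong) auto
      then show ?thesis using j by auto
    qed
    \<comment> \<open>Rays of the same direction \<open>j\<close> from the two endpoints meet only
      if \<open>j\<close> is parallel to \<open>i\<close>. But the direction \<open>i\<close> is
      missing at the origin and \<open>?o\<close> at \<open>?z\<close>.\<close>
    have disj: "\<not> (j \<noteq> i \<and> y \<in> range (ray d origin j) \<and> j \<noteq> ?o \<and> y \<in> range (ray d ?z j))"
    proof
      assume *: "j \<noteq> i \<and> y \<in> range (ray d origin j) \<and> j \<noteq> ?o \<and> y \<in> range (ray d ?z j)"
      then obtain m n where "ray d origin j m = ray d ?z j n" by auto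
      from fun_cong[OF this, of "axis d i"]
      have "(int m - int n) * unit_vec d j (axis d i) = unit_vec d i (axis d i)"
        by (simp add: ray_def neighbour_def origin_def algebra_simps)
      with unit_vec_axis[of d i] have "unit_vec d j (axis d i) \<noteq> 0" by auto
      then have "axis d i = axis d j" using unit_vec_eq_0 by blast
      from axis_eq[OF i j this] * show False by auto
    qed
    have "t y j = (1 - e) * ((\<Sum>l\<in>?J - {i}. a l * ?R origin l y j) + (\<Sum>l\<in>?J - {?o}. a l * ?R ?z l y j))"
      unfolding t_def e0 by simp
    also have "\<dots> \<le> (1 - e) * (a j + 2 * (A * h))"
    proof (intro mult_left_mono)
      show "(\<Sum>l\<in>?J - {i}. a l * ?R origin l y j) + (\<Sum>l\<in>?J - {?o}. a l * ?R ?z l y j) \<le> a j + 2 * (A * h)"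
      proof -
        have "0 < a j" using a j by simp
        then have "(if j \<noteq> i \<and> y \<in> range (ray d origin j) then a j else 0) +
            (if j \<noteq> ?o \<and> y \<in> range (ray d ?z j) then a j else 0) \<le> a j"
          using disj by auto
        with 1 2 show ?thesis unfolding s1 s2 by linarith
      qed
    qed (use e in simp)
    also have "2 * (A * h) = e * m" using \<open>0 < A\<close> by (simp add: h_def)
    also have "(1 - e) * (a j + e * m) \<le> (1 - e) * (a j + e * a j)"
      using e m(2)[OF j] by (intro mult_left_mono add_left_mono) auto
    also have "\<dots> = (1 - e\<^sup>2) * a j" by (simp add: algebra_simps power2_eq_square)
    finally show ?thesis .
  qed
  have "finite_energy d t"
    unfolding t_def[abs_def]
    by (intro finite_energy_cmult finite_energy_add finite_energy_sum finite_energy_edge_flow finite_energy_ray_flow)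
  then obtain K where K: "\<forall>V. finite V \<longrightarrow> (\<Sum>y\<in>V. \<Sum>j\<in>?J. (t y j)\<^sup>2) \<le> K"
    unfolding finite_energy_def by blast
  have "outflow d t y = inflow d t y + (if y = origin then (1 - e) * k else 0)" for y
    using div[of y] by (simp add: divergence_def)
  moreover have "g < (1 - e) * k" using e(3) by (simp add: algebra_simps)
  moreover have "0 < e\<^sup>2" using e by simp
  ultimately show ?thesis using nn cap K by blast
qed

lemma exists_flow_from:
  fixes a :: "nat \<Rightarrow> real"
  assumes "3 \<le> d" "\<forall>j\<in>{1..2*d}. 0 < a j" "i \<in> {1..2*d}"
    "g < 2 * (\<Sum>j=1..2*d. a j) - a i - a (opposite d i)"
  shows "\<exists>t g' e K. g < g' \<and> 0 < e \<and> (\<forall>y j. 0 \<le> t y j) \<and>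
    (\<forall>y. outflow d t y = inflow d t y + (if y = z then g' else 0)) \<and>
    (\<forall>y j. j \<in> {1..2*d} \<longrightarrow> (y, j) \<noteq> (z, i) \<longrightarrow> t y j \<le> (1 - e) * a j) \<and>
    (\<forall>V. finite V \<longrightarrow> (\<Sum>y\<in>V. \<Sum>j=1..2*d. (t y j)\<^sup>2) \<le> K)"
proof -
  from exists_flow[OF assms] obtain t g' e K where t: "g < g'" "0 < e" "\<And>y j. 0 \<le> t y j"
    "\<And>y. outflow d t y = inflow d t y + (if y = origin then g' else 0)"
    "\<And>y j. j \<in> {1..2*d} \<Longrightarrow> (y, j) \<noteq> (origin, i) \<Longrightarrow> t y j \<le> (1 - e) * a j"
    "\<forall>V. finite V \<longrightarrow> (\<Sum>y\<in>V. \<Sum>j=1..2*d. (t y j)\<^sup>2) \<le> K" by blast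
  let ?t = "\<lambda>y. t (translate z y)"
  have o: "translate z y = origin \<longleftrightarrow> y = z" for y
    by (auto simp: translate_def origin_def fun_eq_iff)
  have "finite_energy d t" using t(6) unfolding finite_energy_def by blast
  from finite_energy_translate[OF this, of z] obtain L where
    L: "\<forall>V. finite V \<longrightarrow> (\<Sum>y\<in>V. \<Sum>j=1..2*d. (?t y j)\<^sup>2) \<le> L"
    unfolding finite_energy_def by blast
  have bal: "outflow d ?t y = inflow d ?t y + (if y = z then g' else 0)" for y
    using divergence_translate[of d t z y] t(4)[of "translate z y"] by (simp add: divergence_def o)
  have cap: "?t y j \<le> (1 - e) * a j" if "j \<in> {1..2*d}" "(y, j) \<noteq> (z, i)" for y j
    using that by (intro t(5)) (auto simp: o)
  show ?thesis
    by (rule exI[of _ ?t], rule exI[of _ g'], rule exI[of _ e], rule exI[of _ L],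
        intro conjI allI impI t(1-3) bal cap L[rule_format])
qed

section \<open>The lattice and restriction to finite sets of sites\<close>

lemma countable_lattice: "countable (lattice d)"
proof -
  have "inj_on (\<lambda>x. map x [1..<Suc d]) (lattice d)"
  proof (rule inj_onI, rule ext)
    fix x y i assume x: "x \<in> lattice d" and y: "y \<in> lattice d" and e: "map x [1..<Suc d] = map y [1..<Suc d]"
    have "x i = y i" if "i \<in> {1..d}" for i
    proof -
      have "\<forall>k\<in>set [1..<Suc d]. x k = y k" using e by (simp only: map_eq_conv)
      moreover have "i \<in> set [1..<Suc d]" using that by auto
      ultimately show ?thesis by blast
    qed
    then show "x i = y i" using x y by (cases "i \<in> {1..d}") (auto simp: lattice_def)
  qed
  then show ?thesis by (rule countableI')
qed

lemma origin_in_lattice: "origin \<in> lattice d"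
  by (simp add: lattice_def origin_def)

lemma neighbour_in_lattice:
  assumes "x \<in> lattice d" "j \<in> {1..2*d}" shows "neighbour d x j \<in> lattice d"
proof -
  have "unit_vec d j i = 0" if "i \<notin> {1..d}" for i
    using that assms(2) by (intro unit_vec_eq_0) (auto simp: axis_def)
  then show ?thesis using assms(1) by (simp add: lattice_def neighbour_def)
qed

lemma env_law_eq: "env_law d \<alpha> = dirichlet_prod (lattice d) (\<lambda>_. 2*d) (\<lambda>_. \<alpha>)"
  by (simp add: env_law_def dirichlet_prod_def)

text \<open>Loops in \<open>V\<close> see the environment only at their starting points of steps,
  which lie in \<open>V\<close>. The expectation can therefore be computed under a finite marginal
  of \<open>env_law\<close>.\<close>

lemma green_power_restrict:
  "green_power d V s (restrict p V) z = green_power d V s p z"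
  unfolding green_power_def
proof (rule nn_integral_cong)
  fix ls assume "ls \<in> space (count_space (lists (loops d V z)))"
  then have ls: "ls \<in> lists (loops d V z)" by simp
  have "loop_prod d (restrict p V) z ls = loop_prod d p z ls"
    unfolding loop_prod_step_mset using set_step_mset[OF ls]
    by (intro arg_cong[where f=prod_mset] image_mset_cong) auto
  then show "ennreal (green_coeff s (length ls)) * loop_prod d (restrict p V) z ls =
      ennreal (green_coeff s (length ls)) * loop_prod d p z ls" by simp
qed

lemma nn_integral_dirichlet_prod_restrict:
  assumes n: "\<And>y. 1 \<le> n y" and a: "\<And>y. \<forall>j\<in>{1..n y}. 0 < a y j" and V: "finite V" "V \<subseteq> W"
    and f: "f \<in> borel_measurable (dirichlet_prod V n a)" "\<And>p. f (restrict p V) = f p"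
  shows "(\<integral>\<^sup>+p. f p \<partial>dirichlet_prod W n a) = (\<integral>\<^sup>+p. f p \<partial>dirichlet_prod V n a)"
proof -
  interpret product_prob_space "\<lambda>y. dirichlet (n y) (a y)" W
    using prob_space_dirichlet[OF n a] by (intro product_prob_spaceI)
  have "(\<integral>\<^sup>+p. f p \<partial>dirichlet_prod V n a) =
      (\<integral>\<^sup>+p. f p \<partial>distr (dirichlet_prod W n a) (dirichlet_prod V n a) (\<lambda>p. restrict p V))"
    unfolding dirichlet_prod_def distr_PiM_restrict_finite[OF V] ..
  also have "\<dots> = (\<integral>\<^sup>+p. f (restrict p V) \<partial>dirichlet_prod W n a)"
  proof (rule nn_integral_distr)
    show "(\<lambda>p. restrict p V) \<in> dirichlet_prod W n a \<rightarrow>\<^sub>M dirichlet_prod V n a"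
      unfolding dirichlet_prod_def by (rule measurable_restrict_subset[OF V(2)])
    show "f \<in> borel_measurable (distr (dirichlet_prod W n a) (dirichlet_prod V n a) (\<lambda>p. restrict p V))"
      using f(1) by simp
  qed
  finally show ?thesis by (simp add: f(2))
qed

subsection \<open>The upper bound\<close>

text \<open>The flow, and with it the tilted law, changes from one event \<open>?A i\<close> to the
  next; only the resulting bounds are added up.\<close>

lemma green_power_bound:
  assumes d: "3 \<le> d" and a: "\<forall>j\<in>{1..2*d}. 0 < a j" and s: "0 < s"
    "\<And>i. i \<in> {1..2*d} \<Longrightarrow> s < 2 * (\<Sum>j=1..2*d. a j) - a i - a (opposite d i)"
  shows "\<exists>M. \<forall>V. finite V \<longrightarrow> z \<in> V \<longrightarrow>
    (\<integral>\<^sup>+p. green_power d V s p z \<partial>dirichlet_prod V (\<lambda>_. 2*d) (\<lambda>_. a)) \<le> ennreal M"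
proof -
  define c where "c = 1 / (2 * real d)"
  have c: "0 < c" using d by (simp add: c_def)
  let ?A = "\<lambda>i. {p :: environment. c \<le> p z i}"
  have "\<exists>M. \<forall>V. finite V \<longrightarrow> z \<in> V \<longrightarrow>
    (\<integral>\<^sup>+p. indicator (?A i) p * green_power d V s p z \<partial>dirichlet_prod V (\<lambda>_. 2*d) (\<lambda>_. a)) \<le> ennreal M"
    if i: "i \<in> {1..2*d}" for i
  proof -
    from exists_flow_from[OF d a i s(2)[OF i], of z] show ?thesis
    proof (elim exE conjE)
      fix t g' e K
      assume t: "s < g'" "0 < e" "\<forall>y j. 0 \<le> t y j"
        "\<forall>y. outflow d t y = inflow d t y + (if y = z then g' else 0)"
        "\<forall>y j. j \<in> {1..2*d} \<longrightarrow> (y, j) \<noteq> (z, i) \<longrightarrow> t y j \<le> (1 - e) * a j"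
        "\<forall>V. finite V \<longrightarrow> (\<Sum>y\<in>V. \<Sum>j=1..2*d. (t y j)\<^sup>2) \<le> K"
      have "1 \<le> d" using d by simp
      then show ?thesis
        by (rule green_power_restricted_bound[where t=t and g=g' and e=e and K=K,
            OF _ a t(3)[rule_format] t(4)[rule_format] t(5)[rule_format] t(6)[rule_format] t(2) i s(1) t(1) c])
    qed
  qed
  then have "\<forall>i\<in>{1..2*d}. \<exists>M. \<forall>V. finite V \<longrightarrow> z \<in> V \<longrightarrow>
    (\<integral>\<^sup>+p. indicator (?A i) p * green_power d V s p z \<partial>dirichlet_prod V (\<lambda>_. 2*d) (\<lambda>_. a)) \<le> ennreal M"
    by blast
  from bchoice[OF this] obtain M where M: "\<And>i V. i \<in> {1..2*d} \<Longrightarrow> finite V \<Longrightarrow> z \<in> V \<Longrightarrow>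
    (\<integral>\<^sup>+p. indicator (?A i) p * green_power d V s p z \<partial>dirichlet_prod V (\<lambda>_. 2*d) (\<lambda>_. a)) \<le> ennreal (M i)"
    by blast
  have "(\<integral>\<^sup>+p. green_power d V s p z \<partial>dirichlet_prod V (\<lambda>_. 2*d) (\<lambda>_. a)) \<le> ennreal (\<Sum>i=1..2*d. max 0 (M i))"
    if V: "finite V" "z \<in> V" for V
  proof -
    let ?P = "dirichlet_prod V (\<lambda>_. 2*d) (\<lambda>_. a)"
    have n: "1 \<le> 2*d" using d by simp
    have ind: "(indicator (?A i) :: _ \<Rightarrow> ennreal) \<in> borel_measurable ?P" if "i \<in> {1..2*d}" for i
    proof -
      have [measurable]: "(\<lambda>p. p z i) \<in> borel_measurable ?P"
        by (rule measurable_dirichlet_prod_component) (use V that in auto)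
      have "{p \<in> space ?P. c \<le> p z i} \<in> sets ?P" by measurable
      then show ?thesis by (simp add: borel_measurable_indicator_iff Int_def conj_commute)
    qed
    have gm: "(\<lambda>p. green_power d V s p z) \<in> borel_measurable ?P"
      by (rule measurable_green_power) simp_all
    have "(\<integral>\<^sup>+p. green_power d V s p z \<partial>?P) \<le> (\<integral>\<^sup>+p. (\<Sum>i=1..2*d. indicator (?A i) p * green_power d V s p z) \<partial>?P)"
    proof (rule nn_integral_mono_AE, use AE_dirichlet_prod[of "\<lambda>_. 2*d" "\<lambda>_. a", OF n a countable_finite[OF V(1)]] in eventually_elim)
      fix p :: environment assume p: "\<forall>y\<in>V. (\<forall>j\<in>{1..2*d}. 0 < p y j) \<and> (\<Sum>j=1..2*d. p y j) = 1"
      have "\<exists>i\<in>{1..2*d}. c \<le> p z i"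
      proof (rule ccontr)
        assume "\<not> (\<exists>i\<in>{1..2*d}. c \<le> p z i)"
        then have "(\<Sum>j=1..2*d. p z j) < (\<Sum>j=1..2*d. c)"
          using n by (intro sum_strict_mono) (auto simp: not_le)
        also have "\<dots> = 1" using d by (simp add: c_def)
        finally show False using p V by auto
      qed
      then obtain i where i: "i \<in> {1..2*d}" "c \<le> p z i" by blast
      have "green_power d V s p z = indicator (?A i) p * green_power d V s p z" using i by simp
      also have "\<dots> \<le> (\<Sum>i=1..2*d. indicator (?A i) p * green_power d V s p z)"
        using i by (intro member_le_sum) auto
      finally show "green_power d V s p z \<le> (\<Sum>i=1..2*d. indicator (?A i) p * green_power d V s p z)" .
    qed
    also have "\<dots> = (\<Sum>i=1..2*d. \<integral>\<^sup>+p. indicator (?A i) p * green_power d V s p z \<partial>?P)"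
      using ind gm by (intro nn_integral_sum borel_measurable_times_ennreal)
    also have "\<dots> \<le> (\<Sum>i=1..2*d. ennreal (max 0 (M i)))"
    proof (rule sum_mono)
      fix i assume "i \<in> {1..2*d}"
      from M[OF this V] show "(\<integral>\<^sup>+p. indicator (?A i) p * green_power d V s p z \<partial>?P) \<le> ennreal (max 0 (M i))"
        by (rule order_trans) (auto intro: ennreal_leI)
    qed
    also have "\<dots> = ennreal (\<Sum>i=1..2*d. max 0 (M i))" by (intro sum_ennreal) auto
    finally show ?thesis .
  qed
  then show ?thesis by blast
qed

text \<open>Finitely many loops visit only finitely many sites, which all lie in one
  \<open>V n\<close>.\<close>

lemma lists_loops_UN:
  assumes "incseq V"
  shows "lists (loops d (\<Union>n. V n) z) = (\<Union>n. lists (loops d (V n) z))"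
proof (intro antisym subsetI)
  fix ls assume ls: "ls \<in> lists (loops d (\<Union>n. V n) z)"
  have ex: "\<exists>n. S \<subseteq> V n" if "finite S" "S \<subseteq> (\<Union>n. V n)" for S
    using that
  proof (induction S rule: finite_induct)
    case (insert x S)
    then obtain m n where "x \<in> V m" "S \<subseteq> V n" by auto
    moreover have "V m \<subseteq> V (max m n)" "V n \<subseteq> V (max m n)"
      using assms by (auto simp: incseq_def)
    ultimately show ?case by blast
  qed simp
  have "fst ` set_mset (step_mset d z ls) \<subseteq> (\<Union>n. V n)"
    using set_step_mset[OF ls] by force
  from ex[OF _ this] obtain n where n: "fst ` set_mset (step_mset d z ls) \<subseteq> V n" by auto
  have "l \<in> loops d (V n) z" if "l \<in> set ls" for l
  proof -
    have "l \<in> loops d (\<Union>n. V n) z" using ls that by auto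
    moreover have "fst ` set (steps d z l) \<subseteq> V n"
      using n that by (auto simp: step_mset_def image_subset_iff)
    ultimately show ?thesis by (auto simp: loops_def)
  qed
  then show "ls \<in> (\<Union>n. lists (loops d (V n) z))" by auto
next
  fix ls assume "ls \<in> (\<Union>n. lists (loops d (V n) z))"
  then show "ls \<in> lists (loops d (\<Union>n. V n) z)"
    using lists_mono[OF loops_mono[OF UN_upper[of _ UNIV V]]] by blast
qed

lemma green_power_UN:
  assumes "incseq V"
  shows "green_power d (\<Union>n. V n) s p z = (SUP n. green_power d (V n) s p z)"
proof -
  have "incseq (\<lambda>n. lists (loops d (V n) z))"
    using assms unfolding incseq_def by (intro allI impI lists_mono loops_mono) auto
  then show ?thesis
    unfolding green_power_def lists_loops_UN[OF assms] by (rule nn_integral_count_space_UN)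
qed

text \<open>The bound for finite sets does not depend on the set, so that monotone convergence along
  an exhaustion of the lattice preserves it.\<close>

theorem nn_integral_green_power_finite:
  assumes d: "3 \<le> d" and a: "\<forall>j\<in>{1..2*d}. 0 < a j" and s: "0 < s"
    "\<And>i. i \<in> {1..2*d} \<Longrightarrow> s < 2 * (\<Sum>j=1..2*d. a j) - a i - a (opposite d i)"
    and z: "z \<in> lattice d"
  shows "(\<integral>\<^sup>+p. green_power d (lattice d) s p z \<partial>env_law d a) < \<infinity>"
proof -
  obtain M where M: "\<And>V. finite V \<Longrightarrow> z \<in> V \<Longrightarrow>
    (\<integral>\<^sup>+p. green_power d V s p z \<partial>dirichlet_prod V (\<lambda>_. 2*d) (\<lambda>_. a)) \<le> ennreal M"
    using green_power_bound[OF d a s, of z] by blast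
  define V where "V n = insert z (from_nat_into (lattice d) ` {..<n})" for n :: nat
  have Vf: "finite (V n)" and zV: "z \<in> V n" for n by (auto simp: V_def)
  have Vl: "V n \<subseteq> lattice d" for n
    using z from_nat_into[of "lattice d"] by (auto simp: V_def)
  have inc: "incseq V" by (auto simp: incseq_def V_def)
  have "lattice d = (\<Union>n. V n)"
  proof
    show "lattice d \<subseteq> (\<Union>n. V n)"
    proof
      fix x assume "x \<in> lattice d"
      then obtain n where "x = from_nat_into (lattice d) n"
        using from_nat_into_surj[OF countable_lattice] by metis
      then have "x \<in> V (Suc n)" by (auto simp: V_def)
      then show "x \<in> (\<Union>n. V n)" by blast
    qed
  qed (use Vl in blast)
  then have "(\<integral>\<^sup>+p. green_power d (lattice d) s p z \<partial>env_law d a) =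
      (\<integral>\<^sup>+p. (SUP n. green_power d (V n) s p z) \<partial>env_law d a)"
    using green_power_UN[OF inc] by simp
  also have "\<dots> = (SUP n. \<integral>\<^sup>+p. green_power d (V n) s p z \<partial>env_law d a)"
  proof (rule nn_integral_monotone_convergence_SUP)
    show "incseq (\<lambda>n p. green_power d (V n) s p z)"
      using inc by (auto simp: incseq_def le_fun_def intro: green_power_mono)
    show "(\<lambda>p. green_power d (V n) s p z) \<in> borel_measurable (env_law d a)" for n
      unfolding env_law_eq by (rule measurable_green_power[OF Vl]) simp
  qed
  also have "\<dots> \<le> ennreal M"
  proof (rule SUP_least)
    fix n
    have "(\<integral>\<^sup>+p. green_power d (V n) s p z \<partial>env_law d a) =
        (\<integral>\<^sup>+p. green_power d (V n) s p z \<partial>dirichlet_prod (V n) (\<lambda>_. 2*d) (\<lambda>_. a))"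
      unfolding env_law_eq using d a
      by (intro nn_integral_dirichlet_prod_restrict Vf Vl measurable_green_power green_power_restrict) auto
    also have "\<dots> \<le> ennreal M" by (rule M[OF Vf zV])
    finally show "(\<integral>\<^sup>+p. green_power d (V n) s p z \<partial>env_law d a) \<le> ennreal M" .
  qed
  also have "\<dots> < \<infinity>" by simp
  finally show ?thesis .
qed

subsection \<open>The lower bound\<close>

text \<open>Since \<open>Gamma_series x n\<close> tends to \<open>Gamma x\<close>, this form shows
  the growth of the Pochhammer symbol to be that of \<open>fact n\<close> times
  \<open>n powr x\<close>.\<close>

lemma pochhammer_Gamma_series:
  assumes "0 < (x::real)" "0 < n"
  shows "pochhammer x (Suc n) = real n powr x * fact n / Gamma_series x n"
proof -
  have "pochhammer x (Suc n) > 0" using assms by (intro pochhammer_pos)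
  moreover have "real n powr x = exp (x * ln (real n))" using assms by (simp add: powr_def)
  ultimately show ?thesis by (simp add: Gamma_series_def Suc_eq_plus1)
qed

text \<open>The terms behave like a constant times \<open>k powr (s + b + c - 2 * A - 1)\<close>. By
  \<open>ge\<close> the exponent is at least -1, and the harmonic series is a minorant.\<close>

lemma suminf_pochhammer_top:
  fixes s b c A :: real
  assumes s: "0 < s" and b: "0 < b" and c: "0 < c" and A: "0 < A" and ge: "2 * A - b - c \<le> s"
  shows "(\<Sum>k. ennreal (green_coeff s k * (pochhammer b k / pochhammer A k) * (pochhammer c k / pochhammer A k))) = \<infinity>"
proof (rule ccontr)
  define f where "f k = green_coeff s k * (pochhammer b k / pochhammer A k) * (pochhammer c k / pochhammer A k)" for k
  have f0: "0 \<le> f k" for k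
    unfolding f_def green_coeff_def using s b c A
    by (intro mult_nonneg_nonneg divide_nonneg_nonneg pochhammer_nonneg) auto
  assume "(\<Sum>k. ennreal (green_coeff s k * (pochhammer b k / pochhammer A k) * (pochhammer c k / pochhammer A k))) \<noteq> \<infinity>"
  then have "summable f"
    using f0 by (intro summable_suminf_not_top) (auto simp: f_def)
  \<comment> \<open>\<open>u n\<close> is what remains of \<open>real (Suc n) * f (Suc n)\<close>
    once the powers of \<open>n\<close> are split off; its limit \<open>L\<close> is
    positive.\<close>
  define u where "u n = (Gamma_series A n)\<^sup>2 / (Gamma_series s n * Gamma_series b n * Gamma_series c n)" for n
  define L where "L = (Gamma A)\<^sup>2 / (Gamma s * Gamma b * Gamma c)"
  have G: "0 < Gamma s" "0 < Gamma b" "0 < Gamma c" "0 < Gamma A" using s b c A by auto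
  have L: "0 < L" using G by (simp add: L_def)
  have "u \<longlonglongrightarrow> L"
    unfolding u_def L_def using G by (intro tendsto_intros) auto
  then have "eventually (\<lambda>n. L / 2 < u n) sequentially"
    using L by (intro order_tendstoD) auto
  then obtain N where N: "\<And>n. N \<le> n \<Longrightarrow> L / 2 < u n" by (auto simp: eventually_sequentially)
  \<comment> \<open>Used with \<open>q = fact n\<close> and \<open>k = real (Suc n)\<close>: the
    factorials cancel, and the factor \<open>k\<close> of \<open>fact (Suc n)\<close> is the one
    that yields the harmonic series.\<close>
  have alg: "k * ((ps * q / gs) / (k * q) * ((pb * q / gb) / (pA * q / gA)) * ((pc * q / gc) / (pA * q / gA))) =
      (ps * pb * pc / (pA * pA)) * (gA\<^sup>2 / (gs * gb * gc))"
    if "k \<noteq> 0" "q \<noteq> 0" "gs \<noteq> 0" "gb \<noteq> 0" "gc \<noteq> 0" "gA \<noteq> 0" "pA \<noteq> 0"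
    for k q ps gs pb gb pc gc pA gA :: real
    using that by (simp add: field_simps power2_eq_square)
  have "L / 2 * inverse (real (Suc n)) \<le> f (Suc n)" if n: "max 1 N \<le> n" for n
  proof -
    have n0: "0 < n" and nN: "N \<le> n" using n by auto
    define r where "r = real n"
    have r: "1 \<le> r" using n by (simp add: r_def)
    have Gs: "0 < Gamma_series x n" if "0 < x" for x :: real
      using that by (auto simp: Gamma_series_def intro!: divide_pos_pos pochhammer_pos)
    have e: "r powr s * r powr b * r powr c / (r powr A * r powr A) = r powr (s + b + c - 2 * A)"
      using r by (simp add: powr_add[symmetric] powr_diff[symmetric] algebra_simps)
    have "real (Suc n) * f (Suc n) = (r powr s * r powr b * r powr c / (r powr A * r powr A)) * u n"
      unfolding f_def green_coeff_def u_def pochhammer_Gamma_series[OF s n0] pochhammer_Gamma_series[OF b n0]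
        pochhammer_Gamma_series[OF c n0] pochhammer_Gamma_series[OF A n0] r_def[symmetric] fact_Suc
      using Gs[OF s] Gs[OF b] Gs[OF c] Gs[OF A] r by (intro alg) auto
    also have "\<dots> \<ge> 1 * (L / 2)"
      unfolding e using N[OF nN] L r ge by (intro mult_mono) (auto intro!: ge_one_powr_ge_zero)
    finally show ?thesis by (simp add: field_simps)
  qed
  note bound = this
  have "summable (\<lambda>n. L / 2 * inverse (real (Suc n)))"
  proof (rule summable_comparison_test')
    show "summable (\<lambda>n. f (Suc n))" using \<open>summable f\<close> by (simp only: summable_Suc_iff)
    show "norm (L / 2 * inverse (real (Suc n))) \<le> f (Suc n)" if "max 1 N \<le> n" for n
    proof -
      have "0 \<le> L / 2 * inverse (real (Suc n))" using L by simp
      with bound[OF that] show ?thesis by (simp only: real_norm_def abs_of_nonneg)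
    qed
  qed
  from summable_mult[OF this, of "2 / L"] L have "summable (\<lambda>n. inverse (real (Suc n)))" by simp
  then have "summable (\<lambda>n. inverse (real n))" by (simp only: summable_Suc_iff[of "\<lambda>n. inverse (real n)"])
  with not_summable_harmonic[where 'a=real] show False by (simp add: inverse_eq_divide)
qed

lemma dirichlet_moment_power:
  assumes n: "1 \<le> n" and a: "\<forall>j\<in>{1..n}. 0 < a j" and i: "i \<in> {1..n}"
  shows "(\<integral>\<^sup>+x. ennreal (x i) ^ k \<partial>dirichlet n a) = ennreal (pochhammer (a i) k / pochhammer (\<Sum>j=1..n. a j) k)"
proof -
  define c where "c j = (if j = i then k else 0)" for j
  have "(\<integral>\<^sup>+x. ennreal (x i) ^ k \<partial>dirichlet n a) = (\<integral>\<^sup>+x. (\<Prod>j=1..n. ennreal (x j) ^ c j) \<partial>dirichlet n a)"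
  proof (rule nn_integral_cong)
    fix x
    have "(\<Prod>j=1..n. ennreal (x j) ^ c j) = (\<Prod>j=1..n. if j = i then ennreal (x i) ^ k else 1)"
      by (intro prod.cong) (auto simp: c_def)
    then show "ennreal (x i) ^ k = (\<Prod>j=1..n. ennreal (x j) ^ c j)" using i by simp
  qed
  also have "\<dots> = ennreal ((\<Prod>j=1..n. pochhammer (a j) (c j)) / pochhammer (\<Sum>j=1..n. a j) (\<Sum>j=1..n. c j))"
    by (rule dirichlet_pochhammer_moment[OF n a])
  also have "(\<Prod>j=1..n. pochhammer (a j) (c j)) = (\<Prod>j=1..n. if j = i then pochhammer (a i) k else 1)"
    by (intro prod.cong) (auto simp: c_def)
  also have "\<dots> = pochhammer (a i) k" using i by simp
  also have "(\<Sum>j=1..n. c j) = k" using i by (simp add: c_def)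
  finally show ?thesis .
qed

text \<open>It suffices to go back and forth along one edge. The weight of this loop is a product of
  two independent coordinates, so that the expectations of its powers are products of two quotients
  of Pochhammer symbols, which form the series of \<open>suminf_pochhammer_top\<close>.\<close>

theorem nn_integral_green_power_infinite:
  assumes d: "1 \<le> d" and a: "\<forall>j\<in>{1..2*d}. 0 < a j" and s: "0 < s" and i: "i \<in> {1..2*d}"
    and ge: "2 * (\<Sum>j=1..2*d. a j) - a i - a (opposite d i) \<le> s"
  shows "(\<integral>\<^sup>+p. green_power d {origin, neighbour d origin i} s p origin \<partial>env_law d a) = \<infinity>"
proof -
  let ?z = "neighbour d origin i" and ?o = "opposite d i" and ?n = "2*d" and ?A = "\<Sum>j=1..2*d. a j"
  let ?V = "{origin, ?z}"
  let ?P = "dirichlet_prod ?V (\<lambda>_. ?n) (\<lambda>_. a)"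
  have n: "1 \<le> ?n" using d by simp
  have o: "?o \<in> {1..?n}" by (rule opposite_in[OF i])
  have ne: "?z \<noteq> origin" by (rule neighbour_neq[OF i])
  have V: "finite ?V" "?V \<subseteq> lattice d"
    using origin_in_lattice neighbour_in_lattice[OF origin_in_lattice i] by auto
  have loop: "[i, ?o] \<in> loops d ?V origin"
    using i o ne neighbour_opposite[OF i] by (auto simp: loops_def)
  have F: "ennreal (p origin i) * ennreal (p ?z ?o) \<le> return_weight d ?V p origin" for p
  proof -
    have "ennreal (p origin i) * ennreal (p ?z ?o) = (\<integral>\<^sup>+w. weight d p origin w \<partial>count_space {[i, ?o]})"
      by (simp add: nn_integral_count_space_finite)
    also have "\<dots> \<le> return_weight d ?V p origin"
      unfolding return_weight_def using loop by (intro nn_integral_count_space_mono) auto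
    finally show ?thesis .
  qed
  define f where "f k y x = (if y = origin then ennreal (x i) ^ k else ennreal (x ?o) ^ k)" for k y and x :: "nat \<Rightarrow> real"
  have fm: "f k y \<in> borel_measurable (dirichlet ?n a)" for k y
    using i o unfolding f_def by (cases "y = origin") simp_all
  have fmP: "(\<lambda>p. \<Prod>y\<in>?V. f k y (p y)) \<in> borel_measurable ?P" for k
  proof (rule borel_measurable_prod_ennreal)
    fix y assume "y \<in> ?V"
    then have "(\<lambda>p. p y) \<in> ?P \<rightarrow>\<^sub>M dirichlet ?n a"
      unfolding dirichlet_prod_def by (rule measurable_component_singleton)
    from measurable_compose[OF this fm] show "(\<lambda>p. f k y (p y)) \<in> borel_measurable ?P" .
  qed
  have A: "0 < ?A" using a d by (intro sum_pos) auto
  have "\<infinity> = (\<Sum>k. ennreal (green_coeff s k * (pochhammer (a i) k / pochhammer ?A k) * (pochhammer (a ?o) k / pochhammer ?A k)))"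
    using a i o s ge A by (intro suminf_pochhammer_top[symmetric]) auto
  also have "\<dots> = (\<Sum>k. ennreal (green_coeff s k) * (\<integral>\<^sup>+p. (\<Prod>y\<in>?V. f k y (p y)) \<partial>?P))"
  proof (rule suminf_cong)
    fix k
    have "(\<integral>\<^sup>+p. (\<Prod>y\<in>?V. f k y (p y)) \<partial>?P) = (\<Prod>y\<in>?V. \<integral>\<^sup>+x. f k y x \<partial>dirichlet ?n a)"
      using n a V fm by (intro nn_integral_dirichlet_prod) auto
    also have "\<dots> = (\<integral>\<^sup>+x. ennreal (x i) ^ k \<partial>dirichlet ?n a) * (\<integral>\<^sup>+x. ennreal (x ?o) ^ k \<partial>dirichlet ?n a)"
      using ne by (simp add: f_def)
    also have "\<dots> = ennreal (pochhammer (a i) k / pochhammer ?A k) * ennreal (pochhammer (a ?o) k / pochhammer ?A k)"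
      by (simp only: dirichlet_moment_power[OF n a i] dirichlet_moment_power[OF n a o])
    finally have *: "(\<integral>\<^sup>+p. (\<Prod>y\<in>?V. f k y (p y)) \<partial>?P) = \<dots>" .
    have "0 \<le> green_coeff s k" "0 \<le> pochhammer (a i) k / pochhammer ?A k" "0 \<le> pochhammer (a ?o) k / pochhammer ?A k"
      using green_coeff_pos[OF s] a i o A by (auto intro!: divide_nonneg_nonneg pochhammer_nonneg intro: less_imp_le)
    then show "ennreal (green_coeff s k * (pochhammer (a i) k / pochhammer ?A k) * (pochhammer (a ?o) k / pochhammer ?A k)) =
        ennreal (green_coeff s k) * (\<integral>\<^sup>+p. (\<Prod>y\<in>?V. f k y (p y)) \<partial>?P)"
      unfolding * by (simp only: ennreal_mult mult.assoc mult_nonneg_nonneg)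
  qed
  also have "\<dots> = (\<integral>\<^sup>+p. (\<Sum>k. ennreal (green_coeff s k) * (\<Prod>y\<in>?V. f k y (p y))) \<partial>?P)"
    using fmP by (subst nn_integral_suminf) (auto simp: nn_integral_cmult)
  also have "\<dots> \<le> (\<integral>\<^sup>+p. green_power d ?V s p origin \<partial>?P)"
  proof (rule nn_integral_mono)
    fix p
    have "(\<Prod>y\<in>?V. f k y (p y)) \<le> return_weight d ?V p origin ^ k" for k
    proof -
      have "(\<Prod>y\<in>?V. f k y (p y)) = (ennreal (p origin i) * ennreal (p ?z ?o)) ^ k"
        using ne by (simp add: f_def power_mult_distrib)
      also have "\<dots> \<le> return_weight d ?V p origin ^ k" by (intro power_mono F) simp
      finally show ?thesis .
    qed
    then show "(\<Sum>k. ennreal (green_coeff s k) * (\<Prod>y\<in>?V. f k y (p y))) \<le> green_power d ?V s p origin"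
      unfolding green_power_eq_suminf by (intro suminf_le mult_left_mono) auto
  qed
  also have "\<dots> = (\<integral>\<^sup>+p. green_power d ?V s p origin \<partial>env_law d a)"
    unfolding env_law_eq using n a V
    by (intro nn_integral_dirichlet_prod_restrict[symmetric] measurable_green_power green_power_restrict) auto
  finally show ?thesis by (simp add: top_unique)
qed

subsection \<open>The walk and its Green function\<close>

text \<open>The almost sure event on which \<open>jump\<close> follows \<open>p\<close> at all sites
  of the lattice.\<close>

definition good_env :: "nat \<Rightarrow> environment \<Rightarrow> bool" where
  "good_env d p \<longleftrightarrow> (\<forall>y\<in>lattice d. (\<forall>j\<in>{1..2*d}. 0 < p y j) \<and> (\<Sum>j=1..2*d. p y j) = 1)"

lemma good_envD:
  assumes "good_env d p" "y \<in> lattice d"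
  shows "j \<in> {1..2*d} \<Longrightarrow> 0 < p y j" "(\<Sum>j=1..2*d. p y j) = 1" "(\<Sum>j=1..2*d. ennreal (p y j)) = 1"
proof -
  show 1: "j \<in> {1..2*d} \<Longrightarrow> 0 < p y j" for j using assms by (auto simp: good_env_def)
  show 2: "(\<Sum>j=1..2*d. p y j) = 1" using assms by (auto simp: good_env_def)
  have "(\<Sum>j=1..2*d. ennreal (p y j)) = ennreal (\<Sum>j=1..2*d. p y j)"
    using 1 by (intro sum_ennreal) (auto intro: less_imp_le)
  then show "(\<Sum>j=1..2*d. ennreal (p y j)) = 1" by (simp add: 2)
qed

lemma AE_good_env:
  assumes "1 \<le> d" "\<forall>j\<in>{1..2*d}. 0 < a j"
  shows "AE p in env_law d a. good_env d p"
  unfolding env_law_eq good_env_def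
  using assms countable_lattice by (intro AE_dirichlet_prod) auto

lemma sets_walk: "sets (walk d p x) = sets (PiM UNIV (\<lambda>_. count_space UNIV))"
proof -
  interpret IT: Ionescu_Tulcea "walk_kernel d p x" "\<lambda>_. count_space UNIV"
    by (rule Ionescu_Tulcea_walk_kernel)
  show ?thesis by (simp add: walk_def)
qed

lemma space_walk: "space (walk d p x) = UNIV"
  using sets_eq_imp_space_eq[OF sets_walk, of d p x] by (simp add: space_PiM)

text \<open>The total mass is read off from the projection to the empty set of times, whose law
  belongs to the projective family.\<close>

lemma prob_space_walk: "prob_space (walk d p x)"
proof -
  interpret IT: Ionescu_Tulcea "walk_kernel d p x" "\<lambda>_. count_space UNIV"
    by (rule Ionescu_Tulcea_walk_kernel)
  have "prob_space (distr IT.PF.lim (PiM {} (\<lambda>_. count_space UNIV)) (\<lambda>\<omega>. restrict \<omega> {}))"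
    by (subst IT.distr_lim) (auto intro: IT.PF.prob_space_P)
  then show ?thesis
    unfolding walk_def
    by (rule prob_space_distrD[rotated]) (auto intro!: measurable_restrict simp: measurable_cong_sets[OF IT.PF.sets_lim refl])
qed

lemma sets_walk_coordinate: "{\<omega>. \<omega> k = y} \<in> sets (walk d p x)"
proof -
  have "(\<lambda>\<omega>. \<omega> k) \<in> walk d p x \<rightarrow>\<^sub>M count_space UNIV"
    by (subst measurable_cong_sets[OF sets_walk refl]) (rule measurable_component_singleton, simp)
  from measurable_sets[OF this, of "{y}"] show ?thesis by (simp add: space_walk vimage_def)
qed

section \<open>Trajectories and words\<close>

definition word_path :: "nat \<Rightarrow> site \<Rightarrow> nat list \<Rightarrow> nat \<Rightarrow> site" where
  "word_path d x w k = endpoint d x (take k w)"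

definition cylinder :: "nat \<Rightarrow> site \<Rightarrow> nat list \<Rightarrow> (nat \<Rightarrow> site) set" where
  "cylinder d x w = {\<omega>. \<forall>k\<le>length w. \<omega> k = word_path d x w k}"

definition words :: "nat \<Rightarrow> nat \<Rightarrow> nat list set" where
  "words d n = {w. set w \<subseteq> {1..2*d} \<and> length w = n}"

lemma finite_words: "finite (words d n)"
  unfolding words_def by (rule finite_lists_length_eq) simp

lemma sets_cylinder: "cylinder d x w \<in> sets (walk d p z)"
proof -
  have "cylinder d x w = (\<Inter>k\<in>{..length w}. {\<omega>. \<omega> k = word_path d x w k})"
    by (auto simp: cylinder_def)
  then show ?thesis by (auto intro!: sets.finite_INT sets_walk_coordinate)
qed

lemma endpoint_in_lattice:
  "set w \<subseteq> {1..2*d} \<Longrightarrow> x \<in> lattice d \<Longrightarrow> endpoint d x w \<in> lattice d"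
proof (induction w arbitrary: x)
  case (Cons j w)
  then show ?case using neighbour_in_lattice[of x d j] by auto
qed simp

lemma steps_in_lattice:
  "set w \<subseteq> {1..2*d} \<Longrightarrow> x \<in> lattice d \<Longrightarrow> fst ` set (steps d x w) \<subseteq> lattice d"
proof (induction w arbitrary: x)
  case (Cons j w)
  then have "neighbour d x j \<in> lattice d" by (intro neighbour_in_lattice) auto
  with Cons.IH[OF _ this] Cons.prems show ?case by simp
qed simp

lemma steps_nth:
  "k < length w \<Longrightarrow> steps d x w ! k = (word_path d x w k, w ! k)"
proof (induction w arbitrary: x k)
  case (Cons j w)
  then show ?case by (cases k) (auto simp: word_path_def)
qed simp

lemma word_path_Suc: "k < length w \<Longrightarrow> word_path d x w (Suc k) = neighbour d (word_path d x w k) (w ! k)"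
  by (simp add: word_path_def take_Suc_conv_app_nth)

lemma emeasure_cylinder:
  assumes p: "good_env d p" and x: "x \<in> lattice d" and w: "set w \<subseteq> {1..2*d}"
  shows "emeasure (walk d p x) (cylinder d x w) = weight d p x w"
proof -
  have "emeasure (walk d p x) (cylinder d x w) =
      (\<Prod>k<length w. ennreal (pmf (jump d p (word_path d x w k)) (word_path d x w (Suc k))))"
    unfolding cylinder_def emeasure_walk_cylinder by (simp add: word_path_def)
  also have "\<dots> = (\<Prod>k<length w. ennreal (p (word_path d x w k) (w ! k)))"
  proof (intro prod.cong refl)
    fix k assume k: "k \<in> {..<length w}"
    have "word_path d x w k \<in> lattice d"
      unfolding word_path_def using w x by (intro endpoint_in_lattice) (auto dest: in_set_takeD)
    moreover have "w ! k \<in> {1..2*d}" using w k nth_mem[of k w] by blast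
    ultimately have "pmf (jump d p (word_path d x w k)) (neighbour d (word_path d x w k) (w ! k)) = p (word_path d x w k) (w ! k)"
      using good_envD(1,2)[OF p] by (intro pmf_jump less_imp_le)
    with k show "ennreal (pmf (jump d p (word_path d x w k)) (word_path d x w (Suc k))) = ennreal (p (word_path d x w k) (w ! k))"
      by (simp add: word_path_Suc)
  qed
  also have "\<dots> = weight d p x w"
    unfolding weight_steps prod.list_conv_set_nth
    by (intro prod.cong) (auto simp: steps_nth lessThan_atLeast0)
  finally show ?thesis .
qed

lemma disjoint_cylinder:
  assumes "u \<in> words d n" "v \<in> words d n" "\<omega> \<in> cylinder d x u" "\<omega> \<in> cylinder d x v"
  shows "u = v"
proof (rule nth_equalityI)
  show l: "length u = length v" using assms by (simp add: words_def)
  fix k assume k: "k < length u"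
  have "word_path d x u k = word_path d x v k" "word_path d x u (Suc k) = word_path d x v (Suc k)"
    using assms(3,4) k l by (auto simp: cylinder_def)
  then have "neighbour d (word_path d x u k) (u ! k) = neighbour d (word_path d x u k) (v ! k)"
    using k l by (simp add: word_path_Suc)
  moreover have "u ! k \<in> set u" "v ! k \<in> set v" using k l by auto
  then have "u ! k \<in> {1..2*d}" "v ! k \<in> {1..2*d}"
    using assms(1,2) unfolding words_def by blast+
  ultimately show "u ! k = v ! k" using neighbour_eq_iff by blast
qed

lemma sum_words:
  assumes p: "good_env d p" and "x \<in> lattice d"
  shows "(\<Sum>w\<in>words d n. weight d p x w) = 1"
  using assms(2)
proof (induction n arbitrary: x)
  case 0
  have "words d 0 = {[]}" by (auto simp: words_def)
  then show ?case by simp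
next
  case (Suc n)
  have "words d (Suc n) = (\<lambda>(j, w). j # w) ` ({1..2*d} \<times> words d n)"
    by (auto simp: words_def length_Suc_conv image_iff)
  then have "(\<Sum>w\<in>words d (Suc n). weight d p x w) = (\<Sum>(j, w)\<in>{1..2*d} \<times> words d n. weight d p x (j # w))"
    by (simp add: sum.reindex inj_on_def case_prod_unfold)
  also have "\<dots> = (\<Sum>j=1..2*d. ennreal (p x j) * (\<Sum>w\<in>words d n. weight d p (neighbour d x j) w))"
    by (simp add: sum.cartesian_product[symmetric] sum_distrib_left)
  also have "\<dots> = (\<Sum>j=1..2*d. ennreal (p x j))"
    using Suc.IH[OF neighbour_in_lattice[OF Suc.prems]] by simp
  finally show ?case using good_envD(3)[OF p Suc.prems] by simp
qed

lemma emeasure_UN_cylinder: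
  assumes p: "good_env d p" and x: "x \<in> lattice d" and A: "A \<subseteq> words d n"
  shows "emeasure (walk d p x) (\<Union>w\<in>A. cylinder d x w) = (\<Sum>w\<in>A. weight d p x w)"
proof -
  have "(\<Sum>w\<in>A. emeasure (walk d p x) (cylinder d x w)) = emeasure (walk d p x) (\<Union>w\<in>A. cylinder d x w)"
  proof (intro sum_emeasure)
    show "disjoint_family_on (cylinder d x) A"
      unfolding disjoint_family_on_def using disjoint_cylinder[OF subsetD[OF A] subsetD[OF A]] by blast
  qed (auto simp: sets_cylinder finite_subset[OF A finite_words])
  moreover have "(\<Sum>w\<in>A. emeasure (walk d p x) (cylinder d x w)) = (\<Sum>w\<in>A. weight d p x w)"
    using A by (intro sum.cong refl emeasure_cylinder p x) (auto simp: words_def)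
  ultimately show ?thesis by simp
qed

text \<open>For each \<open>n\<close>, the disjoint cylinders over words of length \<open>n\<close>
  have total mass 1. Events of the walk can then be expressed by words.\<close>

lemma AE_walk_cylinder:
  assumes p: "good_env d p" and x: "x \<in> lattice d"
  shows "AE \<omega> in walk d p x. \<forall>n. \<exists>w\<in>words d n. \<omega> \<in> cylinder d x w"
proof -
  interpret prob_space "walk d p x" by (rule prob_space_walk)
  have "AE \<omega> in walk d p x. \<exists>w\<in>words d n. \<omega> \<in> cylinder d x w" for n
  proof -
    have "emeasure (walk d p x) (\<Union>w\<in>words d n. cylinder d x w) = 1"
      using emeasure_UN_cylinder[OF p x order_refl] sum_words[OF p x] by simp
    moreover have "(\<Union>w\<in>words d n. cylinder d x w) \<in> sets (walk d p x)"
      using finite_words by (auto intro!: sets.finite_UN sets_cylinder)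
    ultimately have "AE \<omega> in walk d p x. \<omega> \<in> (\<Union>w\<in>words d n. cylinder d x w)"
      by (intro AE_in_set_eq_1[THEN iffD2]) (auto simp: emeasure_eq_measure)
    then show ?thesis by eventually_elim auto
  qed
  then show ?thesis by (simp add: AE_all_countable)
qed

lemma emeasure_walk_at:
  assumes p: "good_env d p" and x: "x \<in> lattice d"
  shows "emeasure (walk d p x) {\<omega>. \<omega> n = y} = (\<Sum>w\<in>{w \<in> words d n. endpoint d x w = y}. weight d p x w)"
proof -
  let ?A = "{w \<in> words d n. endpoint d x w = y}"
  have "emeasure (walk d p x) {\<omega>. \<omega> n = y} = emeasure (walk d p x) (\<Union>w\<in>?A. cylinder d x w)"
  proof (rule emeasure_eq_AE)
    show "AE \<omega> in walk d p x. \<omega> \<in> {\<omega>. \<omega> n = y} \<longleftrightarrow> \<omega> \<in> (\<Union>w\<in>?A. cylinder d x w)"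
      using AE_walk_cylinder[OF p x]
    proof eventually_elim
      case (elim \<omega>)
      then obtain w where w: "w \<in> words d n" "\<omega> \<in> cylinder d x w" by blast
      then have e: "\<omega> n = endpoint d x w" by (auto simp: cylinder_def words_def word_path_def)
      have "\<omega> n = endpoint d x v" if "v \<in> words d n" "\<omega> \<in> cylinder d x v" for v
        using that by (auto simp: cylinder_def words_def word_path_def)
      note at = this
      show ?case
      proof
        assume "\<omega> \<in> {\<omega>. \<omega> n = y}"
        with w e show "\<omega> \<in> (\<Union>w\<in>?A. cylinder d x w)" by auto
      next
        assume "\<omega> \<in> (\<Union>w\<in>?A. cylinder d x w)"
        then obtain v where "v \<in> words d n" "endpoint d x v = y" "\<omega> \<in> cylinder d x v" by blast
        with at[of v] show "\<omega> \<in> {\<omega>. \<omega> n = y}" by simp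
      qed
    qed
    show "(\<Union>w\<in>?A. cylinder d x w) \<in> sets (walk d p x)"
      using finite_words by (auto intro!: sets.finite_UN sets_cylinder)
  qed (rule sets_walk_coordinate)
  also have "\<dots> = (\<Sum>w\<in>?A. weight d p x w)"
    by (rule emeasure_UN_cylinder[OF p x]) auto
  finally show ?thesis .
qed

text \<open>Sorted by length, the closed words are the ways to be at \<open>x\<close> at time
  \<open>n\<close>; in the lattice no step is killed.\<close>

lemma green_eq_green_power:
  assumes p: "good_env d p" and x: "x \<in> lattice d"
  shows "green d p x x = green_power d (lattice d) 1 p x"
proof -
  let ?C = "closed_words d (lattice d) x" and ?B = "\<lambda>n. {w \<in> words d n. endpoint d x w = x}"
  have "green d p x x = (\<Sum>n. \<integral>\<^sup>+\<omega>. indicator {\<omega>. \<omega> n = x} \<omega> \<partial>walk d p x)"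
    unfolding green_def by (intro nn_integral_suminf borel_measurable_indicator sets_walk_coordinate)
  also have "\<dots> = (\<Sum>n. emeasure (walk d p x) {\<omega>. \<omega> n = x})"
    by (simp add: sets_walk_coordinate)
  also have "\<dots> = (\<Sum>n. \<integral>\<^sup>+w. weight d p x w * indicator (?B n) w \<partial>count_space UNIV)"
    using finite_words by (intro suminf_cong)
      (simp add: emeasure_walk_at[OF p x] nn_integral_count_space_indicator[symmetric] nn_integral_count_space_finite)
  also have "\<dots> = (\<integral>\<^sup>+w. (\<Sum>n. weight d p x w * indicator (?B n) w) \<partial>count_space UNIV)"
    by (rule nn_integral_suminf[symmetric]) simp
  also have "\<dots> = (\<integral>\<^sup>+w. weight d p x w * indicator ?C w \<partial>count_space UNIV)"
  proof (rule nn_integral_cong)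
    fix w
    have C: "w \<in> ?C \<longleftrightarrow> w \<in> ?B (length w)"
      using steps_in_lattice[OF _ x, of w] by (auto simp: closed_words_def words_def)
    have "(\<Sum>n. weight d p x w * indicator (?B n) w) = (\<Sum>n\<in>{length w}. weight d p x w * indicator (?B n) w)"
      by (rule suminf_finite) (auto simp: words_def indicator_def)
    then show "(\<Sum>n. weight d p x w * indicator (?B n) w) = weight d p x w * indicator ?C w"
      using C by (simp add: indicator_def)
  qed
  also have "\<dots> = green_power d (lattice d) 1 p x"
    unfolding green_power_1 by (simp add: nn_integral_count_space_indicator[symmetric])
  finally show ?thesis .
qed

lemma return_weight_le_1:
  assumes "good_env d p" "x \<in> lattice d"
  shows "return_weight d (lattice d) p x \<le> 1"
proof -
  have "return_weight d (lattice d) p x \<le> (\<Sum>j=1..2*d. ennreal (p x j))"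
    using good_envD(3)[OF assms(1)] by (intro return_weight_le) simp
  then show ?thesis using good_envD(3)[OF assms] by simp
qed

text \<open>Almost every trajectory that returns follows a loop up to its first return, and a union
  bound over the countably many loops applies.\<close>

lemma return_probability_le:
  assumes p: "good_env d p" and x: "x \<in> lattice d"
  shows "emeasure (walk d p x) {\<omega>. \<exists>n\<ge>1. \<omega> n = x} \<le> return_weight d (lattice d) p x"
proof -
  let ?L = "loops d (lattice d) x"
  have "emeasure (walk d p x) {\<omega>. \<exists>n\<ge>1. \<omega> n = x} \<le> emeasure (walk d p x) (\<Union>l\<in>?L. cylinder d x l)"
  proof (rule emeasure_mono_AE)
    show "AE \<omega> in walk d p x. \<omega> \<in> {\<omega>. \<exists>n\<ge>1. \<omega> n = x} \<longrightarrow> \<omega> \<in> (\<Union>l\<in>?L. cylinder d x l)"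
      using AE_walk_cylinder[OF p x]
    proof eventually_elim
      case (elim \<omega>)
      show ?case
      proof
        assume "\<omega> \<in> {\<omega>. \<exists>n\<ge>1. \<omega> n = x}"
        then have ex: "\<exists>n. 1 \<le> n \<and> \<omega> n = x" by auto
        define n where "n = (LEAST n. 1 \<le> n \<and> \<omega> n = x)"
        have n: "1 \<le> n" "\<omega> n = x" using LeastI_ex[OF ex] by (auto simp: n_def)
        have least: "\<omega> k \<noteq> x" if "1 \<le> k" "k < n" for k
          using not_less_Least[of k "\<lambda>n. 1 \<le> n \<and> \<omega> n = x"] that by (auto simp: n_def)
        from elim obtain w where w: "w \<in> words d n" "\<omega> \<in> cylinder d x w" by blast
        have len: "length w = n" and dirs: "set w \<subseteq> {1..2*d}" using w by (auto simp: words_def)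
        have pth: "\<omega> k = word_path d x w k" if "k \<le> n" for k
          using w that len by (auto simp: cylinder_def)
        have "endpoint d x w = x" using pth[of n] n len by (simp add: word_path_def)
        moreover have "x \<notin> fst ` set (tl (steps d x w))"
        proof
          assume "x \<in> fst ` set (tl (steps d x w))"
          then obtain k where k: "k < length (tl (steps d x w))" "fst (tl (steps d x w) ! k) = x"
            by (auto simp: in_set_conv_nth)
          then have "Suc k < n" "word_path d x w (Suc k) = x"
            using len by (auto simp: nth_tl steps_nth)
          with pth[of "Suc k"] least[of "Suc k"] show False by simp
        qed
        moreover have "w \<noteq> []" using n len by auto
        ultimately have "w \<in> ?L"
          using dirs steps_in_lattice[OF dirs x] by (simp add: loops_def)
        with w show "\<omega> \<in> (\<Union>l\<in>?L. cylinder d x l)" by blast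
      qed
    qed
    show "(\<Union>l\<in>?L. cylinder d x l) \<in> sets (walk d p x)"
      by (intro sets.countable_UN'' sets_cylinder) simp
  qed
  also have "\<dots> \<le> (\<integral>\<^sup>+l. emeasure (walk d p x) (cylinder d x l) \<partial>count_space ?L)"
  proof -
    have "emeasure (walk d p x) (\<Union>l\<in>?L. cylinder d x l) = (\<integral>\<^sup>+\<omega>. indicator (\<Union>l\<in>?L. cylinder d x l) \<omega> \<partial>walk d p x)"
      by (intro nn_integral_indicator[symmetric] sets.countable_UN'' sets_cylinder) simp
    also have "\<dots> \<le> (\<integral>\<^sup>+\<omega>. (\<integral>\<^sup>+l. indicator (cylinder d x l) \<omega> \<partial>count_space ?L) \<partial>walk d p x)"
    proof (rule nn_integral_mono)
      fix \<omega>
      show "indicator (\<Union>l\<in>?L. cylinder d x l) \<omega> \<le> (\<integral>\<^sup>+l. indicator (cylinder d x l) \<omega> \<partial>count_space ?L)"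
      proof (cases "\<omega> \<in> (\<Union>l\<in>?L. cylinder d x l)")
        case True
        then obtain l where l: "l \<in> ?L" "\<omega> \<in> cylinder d x l" by blast
        have "1 = (\<integral>\<^sup>+l. indicator (cylinder d x l) \<omega> \<partial>count_space {l})"
          using l by (simp add: nn_integral_count_space_finite)
        also have "\<dots> \<le> (\<integral>\<^sup>+l. indicator (cylinder d x l) \<omega> \<partial>count_space ?L)"
          using l by (intro nn_integral_count_space_mono) auto
        finally show ?thesis using True by simp
      qed simp
    qed
    also have "\<dots> = (\<integral>\<^sup>+l. emeasure (walk d p x) (cylinder d x l) \<partial>count_space ?L)"
      by (subst nn_integral_count_space_nn_integral) (auto simp: sets_cylinder intro!: borel_measurable_indicator)
    finally show ?thesis .
  qed
  also have "\<dots> = return_weight d (lattice d) p x"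
    unfolding return_weight_def
    by (intro nn_integral_cong) (auto simp: emeasure_cylinder[OF p x] dest: loopsD)
  finally show ?thesis .
qed

text \<open>Return weight 1 would make the series for the power \<open>s\<close> diverge.\<close>

lemma transientI:
  assumes p: "good_env d p" and fin: "\<And>x. x \<in> lattice d \<Longrightarrow> green_power d (lattice d) s p x < \<infinity>" and s: "0 < s"
  shows "transient d p"
  unfolding transient_def
proof
  fix x assume x: "x \<in> lattice d"
  interpret prob_space "walk d p x" by (rule prob_space_walk)
  have "return_weight d (lattice d) p x \<noteq> 1"
  proof
    assume "return_weight d (lattice d) p x = 1"
    then have "green_power d (lattice d) s p x = \<infinity>"
      using suminf_green_coeff_top[OF s] by (simp add: green_power_eq_suminf)
    with fin[OF x] show False by simp
  qed
  with return_weight_le_1[OF p x] have "return_weight d (lattice d) p x < 1" by simp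
  with return_probability_le[OF p x] have "emeasure (walk d p x) {\<omega>. \<exists>n\<ge>1. \<omega> n = x} < 1"
    by (rule le_less_trans)
  then show "measure (walk d p x) {\<omega> \<in> space (walk d p x). \<exists>n\<ge>1. \<omega> n = x} < 1"
    by (simp add: space_walk emeasure_eq_measure ennreal_less_iff flip: ennreal_1)
qed

section \<open>The exponent kappa and the conclusion\<close>

lemma kappa_le:
  assumes "1 \<le> d" "i \<in> {1..2*d}"
  shows "kappa d a \<le> 2 * (\<Sum>j=1..2*d. a j) - a i - a (opposite d i)"
proof -
  let ?S = "(\<lambda>i. a i + a (i + d)) ` {1..d}"
  have "a i + a (opposite d i) \<in> ?S"
  proof (cases "i \<le> d")
    case True
    then show ?thesis using assms by (auto simp: opposite_def)
  next
    case False
    then show ?thesis using assms by (auto simp: opposite_def intro!: image_eqI[of _ _ "i - d"])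
  qed
  then have "a i + a (opposite d i) \<le> Max ?S" by (intro Max_ge) auto
  then show ?thesis by (simp add: kappa_def)
qed

lemma kappa_attained:
  assumes "1 \<le> d"
  obtains i where "i \<in> {1..2*d}" "kappa d a = 2 * (\<Sum>j=1..2*d. a j) - a i - a (opposite d i)"
proof -
  let ?S = "(\<lambda>i. a i + a (i + d)) ` {1..d}"
  have "Max ?S \<in> ?S" using assms by (intro Max_in) auto
  then obtain i where i: "i \<in> {1..d}" "Max ?S = a i + a (i + d)" by auto
  then have "kappa d a = 2 * (\<Sum>j=1..2*d. a j) - a i - a (opposite d i)"
    by (simp add: kappa_def opposite_def)
  with i that[of i] show ?thesis by auto
qed

lemma kappa_pos:
  assumes "1 \<le> d" "\<forall>j\<in>{1..2*d}. 0 < a j"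
  shows "0 < kappa d a"
proof -
  obtain i where i: "i \<in> {1..2*d}" "kappa d a = 2 * (\<Sum>j=1..2*d. a j) - a i - a (opposite d i)"
    using kappa_attained[OF assms(1)] by blast
  have "a i + a (opposite d i) \<le> (\<Sum>j=1..2*d. a j)"
  proof -
    have "i \<noteq> opposite d i" using i by (auto simp: opposite_def)
    then have "a i + a (opposite d i) = (\<Sum>j\<in>{i, opposite d i}. a j)" by simp
    also have "\<dots> \<le> (\<Sum>j=1..2*d. a j)"
      using assms(2) i opposite_in[OF i(1)] by (intro sum_mono2) (auto intro: less_imp_le)
    finally show ?thesis .
  qed
  moreover have "0 < (\<Sum>j=1..2*d. a j)" using assms by (intro sum_pos) auto
  ultimately show ?thesis using i by simp
qed

theorem theorem1:
  fixes d :: nat and \<alpha> :: "nat \<Rightarrow> real"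
  assumes "d \<ge> 3"
    and "\<And>i. i \<in> {1..2 * d} \<Longrightarrow> \<alpha> i > 0"
  shows "(\<forall>s>0. (\<integral>\<^sup>+p. ennpowr (green d p origin origin) s \<partial>env_law d \<alpha>) < \<infinity>
                  \<longleftrightarrow> s < kappa d \<alpha>)
       \<and> (AE p in env_law d \<alpha>. transient d p)"
proof
  have d: "1 \<le> d" and pos: "\<forall>j\<in>{1..2*d}. 0 < \<alpha> j" using assms by auto
  note good = AE_good_env[OF d pos]
  have finite: "(\<integral>\<^sup>+p. green_power d (lattice d) s p x \<partial>env_law d \<alpha>) < \<infinity>"
    if "0 < s" "s < kappa d \<alpha>" "x \<in> lattice d" for s x
  proof (rule nn_integral_green_power_finite[OF assms(1) pos that(1) _ that(3)])
    fix i assume "i \<in> {1..2*d}"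
    from kappa_le[OF d this, of \<alpha>] that(2)
    show "s < 2 * (\<Sum>j=1..2*d. \<alpha> j) - \<alpha> i - \<alpha> (opposite d i)" by simp
  qed
  show "\<forall>s>0. (\<integral>\<^sup>+p. ennpowr (green d p origin origin) s \<partial>env_law d \<alpha>) < \<infinity> \<longleftrightarrow> s < kappa d \<alpha>"
  proof (intro allI impI)
    fix s :: real assume s: "0 < s"
    have eq: "(\<integral>\<^sup>+p. ennpowr (green d p origin origin) s \<partial>env_law d \<alpha>) =
        (\<integral>\<^sup>+p. green_power d (lattice d) s p origin \<partial>env_law d \<alpha>)"
    proof (rule nn_integral_cong_AE, use good in eventually_elim)
      fix p assume p: "good_env d p"
      show "ennpowr (green d p origin origin) s = green_power d (lattice d) s p origin"
        using green_power_eq_ennpowr[OF s return_weight_le_1[OF p origin_in_lattice]]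
          green_eq_green_power[OF p origin_in_lattice] by simp
    qed
    show "(\<integral>\<^sup>+p. ennpowr (green d p origin origin) s \<partial>env_law d \<alpha>) < \<infinity> \<longleftrightarrow> s < kappa d \<alpha>"
    proof
      assume "s < kappa d \<alpha>"
      from finite[OF s this origin_in_lattice]
      show "(\<integral>\<^sup>+p. ennpowr (green d p origin origin) s \<partial>env_law d \<alpha>) < \<infinity>" by (simp add: eq)
    next
      assume fin: "(\<integral>\<^sup>+p. ennpowr (green d p origin origin) s \<partial>env_law d \<alpha>) < \<infinity>"
      show "s < kappa d \<alpha>"
      proof (rule ccontr)
        assume "\<not> s < kappa d \<alpha>"
        moreover obtain i where i: "i \<in> {1..2*d}" "kappa d \<alpha> = 2 * (\<Sum>j=1..2*d. \<alpha> j) - \<alpha> i - \<alpha> (opposite d i)"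
          using kappa_attained[OF d] by blast
        \<comment> \<open>The walk killed outside the two endpoints of a minimizing edge already has
          an infinite moment, and enlarging the set only adds loops.\<close>
        ultimately have "\<infinity> = (\<integral>\<^sup>+p. green_power d {origin, neighbour d origin i} s p origin \<partial>env_law d \<alpha>)"
          by (intro nn_integral_green_power_infinite[symmetric] d pos s) auto
        also have "\<dots> \<le> (\<integral>\<^sup>+p. green_power d (lattice d) s p origin \<partial>env_law d \<alpha>)"
          using origin_in_lattice neighbour_in_lattice[OF origin_in_lattice i(1)]
          by (intro nn_integral_mono green_power_mono) auto
        finally show False using fin by (simp add: eq top_unique)
      qed
    qed
  qed
  \<comment> \<open>Any positive order below \<open>kappa d \<alpha>\<close> would do. The moment is
    used at every starting point, and the lattice is countable.\<close>
  define s where "s = kappa d \<alpha> / 2"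
  have s: "0 < s" "s < kappa d \<alpha>" using kappa_pos[OF d pos] by (auto simp: s_def)
  have "AE p in env_law d \<alpha>. \<forall>x\<in>lattice d. green_power d (lattice d) s p x \<noteq> \<infinity>"
  proof (subst AE_ball_countable[OF countable_lattice], intro ballI nn_integral_PInf_AE)
    fix x assume "x \<in> lattice d"
    with finite[OF s this] show "(\<integral>\<^sup>+p. green_power d (lattice d) s p x \<partial>env_law d \<alpha>) \<noteq> \<infinity>" by simp
    show "(\<lambda>p. green_power d (lattice d) s p x) \<in> borel_measurable (env_law d \<alpha>)"
      unfolding env_law_eq by (rule measurable_green_power) simp_all
  qed
  with good show "AE p in env_law d \<alpha>. transient d p"
    by eventually_elim (auto intro: transientI[OF _ _ s(1)] simp: less_top)
qed

end
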